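(* Let $p\ge1$ be an integer and let $H$ be a two-diagonal Hessenberg matrix (defined in the context) with $a_j>0$ for all $j$. Fix $n\in\mathbb N$ and $0\le k<l\le p$. Let $m_{k,n}$ and $\widetilde P_{k,n}$ be as in the context. Then: (a) We have $P_{k,l,n}(x)=x^{k-l+m_{k,n}}\,\widetilde P_{k,l,n}(x^{p+1})$, with $\widetilde P_{k,l,n}$ a polynomial whose zeros all lie in $\mathbb R_+$ if $k$ is even, and in $\mathbb R_-$ if $k$ is odd. (b) Denote the zeros of $\widetilde P_{k,n}(x)$ and $\widetilde P_{k,l,n}(x)$ as $(x_i)_{i=1,2,\dots}$ and $(y_i)_{i=1,2,\dots}$ respectively, ordered by increasing modulus and counting multiplicities. We have the weak interlacing relation $$0\le|y_1|\le|x_1|\le|y_2|\le|x_2|\le\cdots.$$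
   Context: Notation: $\mathbb N=\{1,2,3,\dots\}$; $[i:j]=\{i,i+1,\dots,j\}$; $\mathbb R_+=[0,\infty)$, $\mathbb R_-=(-\infty,0]$. The two-diagonal Hessenberg matrix $H=(H_{i,j})_{i,j=0}^\infty$ has $H_{j-1,j}=1$ for $j\ge1$, $H_{j+p,j}=a_j$ for $j\ge0$, and all other entries $0$; $H_n=(H_{i,j})_{i,j=0}^{n-1}$. $P_{k,n}(x)$ is the determinant of the submatrix of $H_n-xI_n$ obtained by skipping the first $k$ rows and the last $k$ columns; for $n\le k$ one sets $P_{k,n}(x)\equiv1$. For $1\le k\le l\le p$, $P_{k,l,n}(x)$ is the determinant of the submatrix of $H_n-xI_n$ obtained by skipping rows $0,1,\dots,k-1$ and columns $n-l,\,n-k+1,\,n-k+2,\dots,n-1$ (rows and columns labelled from $0$). For $k=0$, $P_{0,l,n}(x):=\det(H_{n-l}-xI_{n-l})$. Put $m_{k,n}=(j-k)(k+1)$ if $n\equiv j\bmod(p+1)$ with $j\in[k:p]$, and $m_{k,n}=(k-j)(p-k)$ if $n\equiv j\bmod(p+1)$ with $j\in[-1:k]$. The polynomial $\widetilde P_{k,n}$ is the one for which $P_{k,n}(x)=x^{m_{k,n}}\widetilde P_{k,n}(x^{p+1})$, with $\widetilde P_{k,n}(0)\neq0$. The interlacing chain runs through the (finitely many) zeros of the two polynomials, alternating as indicated.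
   Formalization: Restricted to n ≥ l (otherwise there is no column n−l); zeros are discussed only when P̃_{k,l,n} is not the zero polynomial (it is zero for p=3, k=2, l=3, n=6), and (b) only when P̃_{k,n} exists (P_{k,n}≡0 for p=2, k=1, n=2). *)

theory Defs
  imports
    "HOL-Computational_Algebra.Polynomial"
    "HOL-Library.Nonpos_Ints"
    "Jordan_Normal_Form.Determinant"
    "Jordan_Normal_Form.DL_Submatrix"
    Complex_Main
begin

definition hess :: "nat \<Rightarrow> (nat \<Rightarrow> real) \<Rightarrow> nat \<Rightarrow> nat \<Rightarrow> real" where
  "hess p a i j = (if j = i + 1 then 1 else if i = j + p then a j else 0)"

text \<open>The matrix \<open>H\<^sub>n - x I\<^sub>n\<close> over the complex polynomials in \<open>x\<close>, with rows and columns
  labelled from \<open>0\<close>.\<close>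

definition hess_char :: "nat \<Rightarrow> (nat \<Rightarrow> real) \<Rightarrow> nat \<Rightarrow> complex poly mat" where
  "hess_char p a n =
     mat n n (\<lambda>(i, j). [:complex_of_real (hess p a i j):]) - [:0, 1:] \<cdot>\<^sub>m 1\<^sub>m n"

definition P_minor :: "nat \<Rightarrow> (nat \<Rightarrow> real) \<Rightarrow> nat \<Rightarrow> nat \<Rightarrow> complex poly" where
  "P_minor p a k n =
     (if n \<le> k then 1
      else Determinant.det (submatrix (hess_char p a n) {k..<n} {0..<n - k}))"

text \<open>Only meaningful for \<open>k \<le> l \<le> n\<close>: otherwise there is no column labelled \<open>n - l\<close>.\<close>

definition P_minor2 :: "nat \<Rightarrow> (nat \<Rightarrow> real) \<Rightarrow> nat \<Rightarrow> nat \<Rightarrow> nat \<Rightarrow> complex poly" where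
  "P_minor2 p a k l n =
     (if k = 0 then Determinant.det (hess_char p a (n - l))
      else Determinant.det (submatrix (hess_char p a n)
             {k..<n} ({0..<n} - ({n - l} \<union> {n - k + 1..<n}))))"

text \<open>The representative \<open>j\<close> of \<open>n\<close> modulo \<open>p + 1\<close> is taken in \<open>{0..p}\<close>; for \<open>n \<equiv> -1\<close>, the
  formulas for \<open>j = p\<close> and \<open>j = -1\<close> both give \<open>(p - k)(k + 1)\<close>.\<close>

definition m_exp :: "nat \<Rightarrow> nat \<Rightarrow> nat \<Rightarrow> nat" where
  "m_exp p k n =
     (let j = n mod (p + 1)
      in if k \<le> j then (j - k) * (k + 1) else (k - j) * (p - k))"

text \<open>Here \<open>Q\<close> is the reduced polynomial of \<open>P\<^sub>k\<^sub>,\<^sub>n\<close>. It is determined by the minor; it does not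
  exist when the minor vanishes identically, as \<open>P\<^sub>1\<^sub>,\<^sub>2\<close> does for \<open>p = 2\<close>.\<close>

definition is_P_tilde :: "nat \<Rightarrow> (nat \<Rightarrow> real) \<Rightarrow> nat \<Rightarrow> nat \<Rightarrow> complex poly \<Rightarrow> bool" where
  "is_P_tilde p a k n Q \<longleftrightarrow>
     (\<forall>x. poly (P_minor p a k n) x = x ^ m_exp p k n * poly Q (x ^ (p + 1))) \<and> poly Q 0 \<noteq> 0"

text \<open>The exponent \<open>k - l + m\<^sub>k\<^sub>,\<^sub>n\<close> may be negative, hence the restriction to \<open>x \<noteq> 0\<close>.\<close>

definition is_P_tilde2 :: "nat \<Rightarrow> (nat \<Rightarrow> real) \<Rightarrow> nat \<Rightarrow> nat \<Rightarrow> nat \<Rightarrow> complex poly \<Rightarrow> bool" where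
  "is_P_tilde2 p a k l n Q \<longleftrightarrow>
     (\<forall>x. x \<noteq> 0 \<longrightarrow>
        poly (P_minor2 p a k l n) x
          = x powi (int k - int l + int (m_exp p k n)) * poly Q (x ^ (p + 1)))"

definition zeros_by_modulus :: "complex poly \<Rightarrow> complex list \<Rightarrow> bool" where
  "zeros_by_modulus Q zs \<longleftrightarrow> mset zs = proots Q \<and> sorted (map cmod zs)"

text \<open>The chain \<open>\<bar>y\<^sub>1\<bar> \<le> \<bar>x\<^sub>1\<bar> \<le> \<bar>y\<^sub>2\<bar> \<le> \<bar>x\<^sub>2\<bar> \<le> \<dots>\<close> uses up both lists, so it may end with an \<open>x\<close>
  or with a \<open>y\<close>. The indices below start from \<open>0\<close>.\<close>

definition weakly_interlacing :: "complex list \<Rightarrow> complex list \<Rightarrow> bool" where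
  "weakly_interlacing ys xs \<longleftrightarrow>
     (length ys = length xs \<or> length ys = length xs + 1) \<and>
     (\<forall>i < length xs. cmod (ys ! i) \<le> cmod (xs ! i)) \<and>
     (\<forall>i. i + 1 < length ys \<longrightarrow> cmod (xs ! i) \<le> cmod (ys ! (i + 1)))"

end

theory Submission
  imports Defs
begin

text \<open>Extend \<open>H - x\<close> by a first unit row to a unit lower triangular matrix \<open>L\<close>. By Jacobi's
  complementary minor formula, \<open>P\<^sub>k\<^sub>,\<^sub>n\<close> and \<open>P\<^sub>k\<^sub>,\<^sub>l\<^sub>,\<^sub>n\<close> are, up to sign, the minors of \<open>L\<close>-inverse with columns
  \<open>0, \<dots>, k\<close> and with rows \<open>n - k, \<dots>, n\<close> and \<open>n - l, n - k + 1, \<dots>, n\<close> respectively. The columns of the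
  inverse satisfy \<open>u\<^sub>s = x u\<^sub>s\<^sub>+\<^sub>1 - a\<^sub>s u\<^sub>s\<^sub>+\<^sub>p\<^sub>+\<^sub>1\<close>. After removing powers of \<open>x\<close> and signs this becomes
  \<open>r\<^sub>s = w\<^sub>s r\<^sub>s\<^sub>+\<^sub>1 + \<theta> a\<^sub>s r\<^sub>s\<^sub>+\<^sub>p\<^sub>+\<^sub>1\<close> with \<open>\<theta> = (-1)\<^sup>k\<close> and \<open>w\<^sub>s \<in> {1, t}\<close>, \<open>t = (-1)\<^sup>k\<^sup>+\<^sup>1 x\<^sup>p\<^sup>+\<^sup>1\<close>, and the minors of size
  \<open>k + 1\<close> obey a recurrence with nonnegative coefficients in \<open>t\<close>.

  Let \<open>F, G\<close> be the two minors with rows \<open>s, \<dots>, s + k\<close> and \<open>F', G'\<close> those with rows \<open>s + 1, \<dots>, s + k + 1\<close>.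
  By the Desnanot--Jacobi identity, \<open>G F' - F G'\<close> is a product of minors of sizes \<open>k\<close> and \<open>k + 2\<close>. These
  sizes belong to the opposite sign of \<open>\<theta>\<close>, so the product has a constant sign for \<open>t < 0\<close>. Hence strict
  interlacing of \<open>F', G'\<close> implies strict interlacing of \<open>F, G\<close>, provided that \<open>deg F - deg F'\<close> does not
  exceed the number (0 or 1) of factors \<open>t\<close> among \<open>w\<^sub>s, \<dots>, w\<^sub>s\<^sub>+\<^sub>k\<close>. Strictness is obtained by replacing the
  initial rows by a totally positive matrix; the theorem follows in the limit.\<close>

subsection \<open>Minors\<close>

text \<open>Rows and columns are lists, not sets: the recurrence below permutes rows and may repeat
  one, so order and multiplicity must be visible. The size is read off \<open>R\<close>
  alone.\<close>

definition minor :: "(nat \<Rightarrow> 'b \<Rightarrow> 'a::comm_ring_1) \<Rightarrow> nat list \<Rightarrow> 'b list \<Rightarrow> 'a" where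
  "minor f R C = Determinant.det (mat (length R) (length R) (\<lambda>(i, j). f (R ! i) (C ! j)))"

lemma minor_cong:
  assumes "length C = length R" "\<And>r c. r \<in> set R \<Longrightarrow> c \<in> set C \<Longrightarrow> f r c = g r c"
  shows "minor f R C = minor g R C"
  unfolding minor_def using assms by (intro arg_cong[of _ _ Determinant.det] eq_matI) auto

lemma minor_Nil [simp]: "minor f [] C = 1"
  unfolding minor_def by (simp add: det_dim_zero)

lemma nth_delete:
  assumes "j < length C" "i < length C - 1"
  shows "(take j C @ drop (Suc j) C) ! i = (if i < j then C ! i else C ! Suc i)"
  using assms by (auto simp: nth_append min_def)

lemma minor_Cons:
  assumes "length C = Suc (length R)"
  shows "minor f (x # R) C =
    (\<Sum>j<Suc (length R). (-1) ^ j * f x (C ! j) * minor f R (take j C @ drop (Suc j) C))"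
proof -
  let ?m = "Suc (length R)"
  let ?A = "mat ?m ?m (\<lambda>(i, j). f ((x # R) ! i) (C ! j))"
  have del: "mat_delete ?A 0 j = mat (length R) (length R) (\<lambda>(i, j'). f (R ! i) ((take j C @ drop (Suc j) C) ! j'))"
    if "j < ?m" for j
    unfolding mat_delete_def using that assms nth_delete[of j C]
    by (intro eq_matI) auto
  have "minor f (x # R) C = (\<Sum>j<?m. ?A $$ (0, j) * cofactor ?A 0 j)"
    unfolding minor_def list.size(4) add_0_right add_Suc_right by (rule laplace_expansion_row) auto
  also have "\<dots> = (\<Sum>j<?m. (-1) ^ j * f x (C ! j) * minor f R (take j C @ drop (Suc j) C))"
    by (intro sum.cong refl) (auto simp: cofactor_def del minor_def algebra_simps)
  finally show ?thesis .
qed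

lemma minor_snoc:
  assumes "length C = Suc (length R)"
  shows "minor f (R @ [x]) C =
    (\<Sum>j<Suc (length R). (-1) ^ (length R + j) * f x (C ! j) * minor f R (take j C @ drop (Suc j) C))"
proof -
  let ?m = "Suc (length R)"
  let ?A = "mat ?m ?m (\<lambda>(i, j). f ((R @ [x]) ! i) (C ! j))"
  have del: "mat_delete ?A (length R) j = mat (length R) (length R) (\<lambda>(i, j'). f (R ! i) ((take j C @ drop (Suc j) C) ! j'))"
    if "j < ?m" for j
    unfolding mat_delete_def using that assms nth_delete[of j C]
    by (intro eq_matI) (auto simp: nth_append)
  have "minor f (R @ [x]) C = (\<Sum>j<?m. ?A $$ (length R, j) * cofactor ?A (length R) j)"
    unfolding minor_def length_append list.size add_0_right add_Suc_right by (rule laplace_expansion_row) auto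
  also have "\<dots> = (\<Sum>j<?m. (-1) ^ (length R + j) * f x (C ! j) * minor f R (take j C @ drop (Suc j) C))"
    by (intro sum.cong refl) (simp add: cofactor_def del minor_def)
  finally show ?thesis .
qed

text \<open>The Laplace expansions along the row \<open>x\<close> have the same terms on both sides,
  up to the sign \<open>(-1) ^ length R\<close>. This puts a row that has jumped past all others
  back into increasing order.\<close>

lemma minor_rotate:
  fixes f :: "nat \<Rightarrow> 'b \<Rightarrow> 'a::comm_ring_1"
  assumes "length C = Suc (length R)"
  shows "minor f (x # R) C = (-1) ^ length R * minor f (R @ [x]) C"
  unfolding minor_Cons[OF assms] minor_snoc[OF assms] sum_distrib_left
proof (intro sum.cong refl)
  fix j
  have "(-1 :: 'a) ^ length R * (-1) ^ (length R + j) = (-1) ^ j"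
    by (simp add: power_add flip: mult.assoc power_mult_distrib)
  thus "(-1) ^ j * f x (C ! j) * minor f R (take j C @ drop (Suc j) C) =
      (-1) ^ length R * ((-1) ^ (length R + j) * f x (C ! j) * minor f R (take j C @ drop (Suc j) C))"
    by (metis mult.assoc)
qed

lemma minor_linear:
  assumes "length C = Suc (length R)"
    and "\<And>c. c \<in> set C \<Longrightarrow> f x c = u * f y c + v * f z c"
  shows "minor f (x # R) C = u * minor f (y # R) C + v * minor f (z # R) C"
  unfolding minor_Cons[OF assms(1)] sum_distrib_left sum.distrib[symmetric]
  using assms by (intro sum.cong refl) (simp add: algebra_simps)

lemma minor_dup:
  assumes "x \<in> set R"
  shows "minor f (x # R) C = 0"
proof -
  obtain i where i: "i < length R" "R ! i = x" using assms by (auto simp: in_set_conv_nth)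
  show ?thesis
    unfolding minor_def
    by (rule det_identical_rows[where i = 0 and j = "Suc i" and n = "length (x # R)"])
       (use i in \<open>auto intro!: eq_vecI\<close>)
qed

lemma minor_scale_rows:
  assumes "length C = length R" "\<And>r c. r \<in> set R \<Longrightarrow> c \<in> set C \<Longrightarrow> f r c = u r * g r c"
  shows "minor f R C = prod_list (map u R) * minor g R C"
  using assms
proof (induction R arbitrary: C)
  case (Cons x R)
  show ?case
    unfolding minor_Cons[OF Cons.prems(1)[simplified]] sum_distrib_left
  proof (intro sum.cong refl)
    fix j assume j: "j \<in> {..<Suc (length R)}"
    have s: "set (take j C @ drop (Suc j) C) \<subseteq> set C"
      by (auto dest: in_set_takeD in_set_dropD)
    have "minor f R (take j C @ drop (Suc j) C) = prod_list (map u R) * minor g R (take j C @ drop (Suc j) C)"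
      using Cons.prems j s by (intro Cons.IH) auto
    moreover have "f x (C ! j) = u x * g x (C ! j)" using Cons.prems j by auto
    ultimately show "(-1) ^ j * f x (C ! j) * minor f R (take j C @ drop (Suc j) C) =
      prod_list (map u (x # R)) * ((-1) ^ j * g x (C ! j) * minor g R (take j C @ drop (Suc j) C))"
      by (simp add: algebra_simps)
  qed
qed simp

lemma poly_minor: "poly (minor f R C) t = minor (\<lambda>r c. poly (f r c) t) R C"
proof -
  interpret h: comm_ring_hom "\<lambda>q. poly q t" by standard auto
  show ?thesis unfolding minor_def h.hom_det[symmetric]
    by (intro arg_cong[of _ _ Determinant.det] eq_matI) auto
qed

text \<open>Desnanot--Jacobi: multiply the matrix by the identity whose first two columns are replaced by
  the first and the last column of the adjugate.\<close>

lemma desnanot_jacobi: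
  fixes f :: "nat \<Rightarrow> 'b \<Rightarrow> 'a::idom"
  assumes len: "length C = length R" and nz: "minor f (x # R @ [y]) (c # d # C) \<noteq> 0"
  shows "minor f (x # R) (c # C) * minor f (R @ [y]) (d # C)
       - minor f (x # R) (d # C) * minor f (R @ [y]) (c # C)
       = minor f (x # R @ [y]) (c # d # C) * minor f R C"
proof -
  define m where "m = length R"
  define A where "A = mat (m+2) (m+2) (\<lambda>(i, j). f ((x # R @ [y]) ! i) ((c # d # C) ! j))"
  have A: "A \<in> carrier_mat (m+2) (m+2)" by (simp add: A_def)
  have detA: "Determinant.det A = minor f (x # R @ [y]) (c # d # C)"
    by (simp add: minor_def A_def m_def)
  define D where "D = Determinant.det A"
  define J where "J = adj_mat A"
  have J: "J \<in> carrier_mat (m+2) (m+2)" and AJ: "A * J = D \<cdot>\<^sub>m 1\<^sub>m (m+2)"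
    using adj_mat[OF A] by (auto simp: J_def D_def)
  define B where "B = mat (m+2) (m+2) (\<lambda>(i, j). if j = 0 then J $$ (i, 0) else
       if j = 1 then J $$ (i, m+1) else if i = j then 1 else 0)"
  have B: "B \<in> carrier_mat (m+2) (m+2)" by (simp add: B_def)
  \<comment> \<open>As \<open>J\<close> is the adjugate, \<open>A\<close> maps its first and last
    columns to \<open>D\<close> times unit vectors; the other columns of \<open>B\<close> are unit
    vectors and reproduce columns of \<open>A\<close>.\<close>
  define E where "E = mat (m+2) (m+2) (\<lambda>(i, j). if j = 0 then (if i = 0 then D else 0) else
       if j = 1 then (if i = m+1 then D else 0) else A $$ (i, j))"
  have E: "E \<in> carrier_mat (m+2) (m+2)" by (simp add: E_def)
  have AJij: "(\<Sum>k<m+2. A $$ (i, k) * J $$ (k, j)) = (if i = j then D else 0)" if "i < m+2" "j < m+2" for i j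
    using arg_cong[OF AJ, of "\<lambda>M. M $$ (i, j)"] that A J
    by (simp add: scalar_prod_def lessThan_atLeast0)
  have AB: "A * B = E"
  proof (rule eq_matI)
    fix i j assume ij: "i < dim_row E" "j < dim_col E"
    hence ij: "i < m+2" "j < m+2" by (auto simp: E_def)
    have "(A * B) $$ (i, j) = (\<Sum>k<m+2. A $$ (i, k) * B $$ (k, j))"
      using A B ij by (simp add: scalar_prod_def lessThan_atLeast0)
    also have "\<dots> = E $$ (i, j)"
    proof (cases "j = 0 \<or> j = 1")
      case True
      thus ?thesis using ij AJij[of i 0] AJij[of i "m+1"] by (auto simp: B_def E_def)
    next
      case False
      have "(\<Sum>k<m+2. A $$ (i, k) * B $$ (k, j)) = (\<Sum>k<m+2. if k = j then A $$ (i, k) else 0)"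
        using False ij by (intro sum.cong) (auto simp: B_def)
      also have "\<dots> = A $$ (i, j)" using ij by (simp add: sum.delta)
      finally show ?thesis using False ij by (simp add: E_def)
    qed
    finally show "(A * B) $$ (i, j) = E $$ (i, j)" .
  qed (use A B E in auto)
  have detE: "Determinant.det E = (-1) ^ m * D * D * minor f R C"
  proof -
    have "Determinant.det E = (\<Sum>i<m+2. E $$ (i, 0) * cofactor E i 0)"
      by (rule laplace_expansion_column[OF E]) simp
    also have "\<dots> = (\<Sum>i<m+2. if i = 0 then D * cofactor E 0 0 else 0)"
      by (intro sum.cong) (auto simp: E_def)
    also have "\<dots> = D * Determinant.det (mat_delete E 0 0)" by (simp add: cofactor_def)
    finally have 1: "Determinant.det E = D * Determinant.det (mat_delete E 0 0)" .
    define E' where "E' = mat_delete E 0 0"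
    have E'_eq: "E' = mat (m+1) (m+1) (\<lambda>(i, j). if j = 0 then (if i = m then D else 0) else A $$ (Suc i, Suc j))"
      unfolding E'_def mat_delete_def by (intro eq_matI) (auto simp: E_def)
    have E': "E' \<in> carrier_mat (m+1) (m+1)" by (simp add: E'_eq)
    have "Determinant.det E' = (\<Sum>i<m+1. E' $$ (i, 0) * cofactor E' i 0)"
      by (rule laplace_expansion_column[OF E']) simp
    also have "\<dots> = (\<Sum>i<m+1. if i = m then D * cofactor E' m 0 else 0)"
      by (intro sum.cong) (auto simp: E'_eq)
    also have "\<dots> = D * ((-1) ^ m * Determinant.det (mat_delete E' m 0))" by (simp add: cofactor_def)
    also have "mat_delete E' m 0 = mat m m (\<lambda>(i, j). f (R ! i) (C ! j))"
      unfolding mat_delete_def by (intro eq_matI) (auto simp: E'_eq A_def nth_append m_def)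
    also have "Determinant.det \<dots> = minor f R C" by (simp add: minor_def m_def)
    finally show ?thesis using 1 by (simp add: E'_def)
  qed
  have detB: "Determinant.det B = J $$ (0, 0) * J $$ (1, m+1) - J $$ (0, m+1) * J $$ (1, 0)"
  proof -
    let ?b1 = "mat 2 2 (\<lambda>(i, j). if j = 0 then J $$ (i, 0) else J $$ (i, m+1))"
    let ?b3 = "mat m 2 (\<lambda>(i, j). if j = 0 then J $$ (i+2, 0) else J $$ (i+2, m+1))"
    have "B = four_block_mat ?b1 (0\<^sub>m 2 m) ?b3 (1\<^sub>m m)"
    proof (rule eq_matI)
      have aux: "Suc (Suc (i - Suc (Suc 0))) = i" if "\<not> i < Suc (Suc 0)" for i using that by auto
      fix i j assume "i < dim_row (four_block_mat ?b1 (0\<^sub>m 2 m) ?b3 (1\<^sub>m m))"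
        "j < dim_col (four_block_mat ?b1 (0\<^sub>m 2 m) ?b3 (1\<^sub>m m))"
      thus "B $$ (i, j) = four_block_mat ?b1 (0\<^sub>m 2 m) ?b3 (1\<^sub>m m) $$ (i, j)"
        by (cases "i < 2") (auto simp: B_def numeral_2_eq_2 aux)
    qed (auto simp: B_def)
    hence "Determinant.det B = Determinant.det ?b1 * Determinant.det (1\<^sub>m m)"
      using det_four_block_mat_upper_right_zero[of ?b1 2 "0\<^sub>m 2 m" m ?b3 "1\<^sub>m m"] by simp
    also have "Determinant.det ?b1 = J $$ (0, 0) * J $$ (1, m+1) - J $$ (0, m+1) * J $$ (1, 0)"
    proof -
      have b: "?b1 \<in> carrier_mat 2 2" by simp
      show ?thesis
        using laplace_expansion_column[OF b, of 0]
        by (simp add: numeral_2_eq_2 cofactor_def mat_delete_def det_single algebra_simps)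
    qed
    finally show ?thesis by simp
  qed
  have Jc: "J $$ (i, j) = (-1) ^ (i+j) * Determinant.det (mat_delete A j i)" if "i < m+2" "j < m+2" for i j
    using that A by (simp add: J_def adj_mat_def cofactor_def add.commute)
  have d1: "mat_delete A 0 0 = mat (m+1) (m+1) (\<lambda>(i, j). f ((R @ [y]) ! i) ((d # C) ! j))"
    unfolding mat_delete_def by (intro eq_matI) (auto simp: A_def)
  have d2: "mat_delete A 0 1 = mat (m+1) (m+1) (\<lambda>(i, j). f ((R @ [y]) ! i) ((c # C) ! j))"
    unfolding mat_delete_def by (intro eq_matI) (auto simp: A_def nth_Cons')
  have d3: "mat_delete A (m+1) 0 = mat (m+1) (m+1) (\<lambda>(i, j). f ((x # R) ! i) ((d # C) ! j))"
    unfolding mat_delete_def by (intro eq_matI) (auto simp: A_def nth_append m_def nth_Cons')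
  have d4: "mat_delete A (m+1) 1 = mat (m+1) (m+1) (\<lambda>(i, j). f ((x # R) ! i) ((c # C) ! j))"
    unfolding mat_delete_def by (intro eq_matI) (auto simp: A_def nth_append m_def nth_Cons')
  have e1: "Determinant.det (mat_delete A 0 0) = minor f (R @ [y]) (d # C)"
    unfolding d1 by (simp add: minor_def m_def)
  have e2: "Determinant.det (mat_delete A 0 (Suc 0)) = minor f (R @ [y]) (c # C)"
    unfolding d2[unfolded One_nat_def] by (simp add: minor_def m_def)
  have e3: "Determinant.det (mat_delete A (Suc m) 0) = minor f (x # R) (d # C)"
    unfolding d3[unfolded Suc_eq_plus1[symmetric]] by (simp add: minor_def m_def)
  have e4: "Determinant.det (mat_delete A (Suc m) (Suc 0)) = minor f (x # R) (c # C)"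
    using d4 by (simp add: minor_def m_def)
  \<comment> \<open>Cancelling \<open>D\<close> in \<open>det A * det B = det E\<close> is where the
    nonvanishing of the large minor enters.\<close>
  have "D * Determinant.det B = D * ((-1) ^ m * D * minor f R C)"
    using det_mult[OF A B] unfolding AB detE D_def[symmetric] by (simp only: mult_ac)
  moreover have "D \<noteq> 0" using nz by (simp add: D_def detA)
  ultimately have "Determinant.det B = (-1) ^ m * D * minor f R C"
    using mult_left_cancel by blast
  hence "(-1) ^ m * (minor f (x # R) (c # C) * minor f (R @ [y]) (d # C)
       - minor f (x # R) (d # C) * minor f (R @ [y]) (c # C)) = (-1) ^ m * (D * minor f R C)"
    unfolding detB using Jc[of 0 0] Jc[of 1 "m+1"] Jc[of 0 "m+1"] Jc[of 1 0]
    by (simp add: e1 e2 e3 e4 algebra_simps)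
  hence "minor f (x # R) (c # C) * minor f (R @ [y]) (d # C)
       - minor f (x # R) (d # C) * minor f (R @ [y]) (c # C) = D * minor f R C"
    by simp
  thus ?thesis by (simp add: D_def detA)
qed

subsection \<open>The reduced recurrence\<close>

lemma sum_const_poly: "(\<Sum>j<m. [:f j:]) = [:\<Sum>j<(m::nat). f j:]"
  by (induction m) auto

lemma minus_one_power_poly: "(-1) ^ j = [:(-1) ^ j :: real:]"
  by (induction j) (simp_all add: pCons_one)

locale two_diagonal =
  fixes p n :: nat and a :: "nat \<Rightarrow> real"
  assumes a_pos: "a j > 0"
begin

text \<open>The coefficients w_s. The value at \<open>s = n\<close> is 0: row \<open>n + 1\<close>
  already belongs to the free initial rows, whereas u_(n+1) = 0 for the inverse, so the step from
  \<open>n\<close> to \<open>n + 1\<close> has to be cut.\<close>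

definition walk :: "nat \<Rightarrow> real poly" where
  "walk s = (if s = n then 0 else if (p + 1) dvd (n - s) then [:0, 1:] else 1)"

text \<open>Rows \<open>n + 1, ..., n + p + 1\<close> are initial data, taken from rows
  \<open>0, ..., p\<close> of \<open>B\<close>. Leaving \<open>B\<close> free allows a totally
  positive perturbation; the actual inverse is recovered from a diagonal \<open>B\<close>, which
  replaces the unit inhomogeneity of its recurrence.\<close>

function row :: "(nat \<Rightarrow> nat \<Rightarrow> real) \<Rightarrow> real \<Rightarrow> nat \<Rightarrow> nat \<Rightarrow> real poly" where
  "row B \<theta> s c = (if n < s then [:B (s - Suc n) c:]
     else walk s * row B \<theta> (Suc s) c + smult (\<theta> * a s) (row B \<theta> (s + p + 1) c))"
  by pat_completeness auto
termination by (relation "measure (\<lambda>(B, \<theta>, s, c). Suc n - s)") auto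

declare row.simps [simp del]

lemma row_base: "n < s \<Longrightarrow> row B \<theta> s c = [:B (s - Suc n) c:]"
  by (simp add: row.simps)

lemma row_step: "s \<le> n \<Longrightarrow> row B \<theta> s c =
    walk s * row B \<theta> (Suc s) c + smult (\<theta> * a s) (row B \<theta> (s + p + 1) c)"
  by (subst row.simps) simp

lemma walk_eval_nonneg: "t \<ge> 0 \<Longrightarrow> poly (walk s) t \<ge> 0"
  by (simp add: walk_def)

text \<open>From row \<open>s\<close> on, all distances to \<open>n\<close> are below
  \<open>p\<close>; none is a positive multiple of \<open>p + 1\<close>, so no factor
  \<open>t\<close> occurs.\<close>

lemma row_const: "n < s + p \<Longrightarrow> \<exists>x. row B \<theta> s c = [:x:]"
proof (induction B \<theta> s c rule: row.induct)
  case (1 B \<theta> s c)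
  show ?case
  proof (cases "n < s")
    case True thus ?thesis by (simp add: row_base)
  next
    case False
    have "\<not> (p + 1) dvd (n - s)" if "s \<noteq> n"
      using that False 1(3) by (auto dest: dvd_imp_le)
    hence w: "\<exists>y. walk s = [:y:]" by (auto simp: walk_def one_pCons)
    obtain x1 where "row B \<theta> (Suc s) c = [:x1:]" using 1 False by auto
    moreover obtain x2 where "row B \<theta> (s + p + 1) c = [:x2:]" using 1 False by auto
    ultimately show ?thesis using w False by (auto simp: row_step)
  qed
qed

abbreviation W :: "(nat \<Rightarrow> nat \<Rightarrow> real) \<Rightarrow> real \<Rightarrow> nat list \<Rightarrow> nat list \<Rightarrow> real poly" where
  "W B \<theta> \<equiv> minor (row B \<theta>)"

text \<open>Linearity in the first row, then rotation of the row that jumped: its sign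
  \<open>(-1) ^ length S\<close> cancels \<theta>, so all coefficients are nonnegative for
  \<open>t \<ge> 0\<close>. The first term disappears when the walk would repeat a row.\<close>

lemma W_Cons:
  assumes "m \<le> n" "length C = Suc (length S)" "\<theta> * (-1) ^ length S = 1"
  shows "W B \<theta> (m # S) C =
    (if Suc m \<in> set S then 0 else walk m * W B \<theta> (Suc m # S) C) + smult (a m) (W B \<theta> (S @ [m + p + 1]) C)"
proof -
  have "W B \<theta> (m # S) C = walk m * W B \<theta> (Suc m # S) C + [:\<theta> * a m:] * W B \<theta> ((m + p + 1) # S) C"
    by (rule minor_linear) (use assms row_step in auto)
  also have "W B \<theta> ((m + p + 1) # S) C = (-1) ^ length S * W B \<theta> (S @ [m + p + 1]) C"
    by (rule minor_rotate) (use assms in auto)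
  also have "(-1) ^ length S = [:(-1) ^ length S :: real:]"
    by (rule minus_one_power_poly)
  also have "[:\<theta> * a m:] * ([:(-1) ^ length S:] * W B \<theta> (S @ [m + p + 1]) C)
      = smult ((\<theta> * (-1) ^ length S) * a m) (W B \<theta> (S @ [m + p + 1]) C)"
    by (simp add: mult_ac)
  also have "\<dots> = smult (a m) (W B \<theta> (S @ [m + p + 1]) C)" using assms(3) by simp
  finally show ?thesis by (simp add: minor_dup)
qed

lemma W_const:
  assumes "\<forall>x\<in>set R. n < x + p" "length C = length R"
  shows "\<exists>x. W B \<theta> R C = [:x:]"
  using assms
proof (induction R arbitrary: C)
  case (Cons x R)
  obtain u where u: "\<And>c. row B \<theta> x c = [:u c:]"
    using row_const[of x B \<theta>] Cons.prems by (metis list.set_intros(1))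
  have "\<exists>v. W B \<theta> R (take j C @ drop (Suc j) C) = [:v:]" if "j < Suc (length R)" for j
    using that Cons.prems by (intro Cons.IH) auto
  then obtain v where v: "\<And>j. j < Suc (length R) \<Longrightarrow> W B \<theta> R (take j C @ drop (Suc j) C) = [:v j:]"
    by metis
  have one: "(-1) ^ j = [:(-1) ^ j :: real:]" for j :: nat
    by (rule minus_one_power_poly)
  have "W B \<theta> (x # R) C = (\<Sum>j<Suc (length R). [:(-1) ^ j * u (C ! j) * v j:])"
    unfolding minor_Cons[OF Cons.prems(2)[simplified]]
  proof (intro sum.cong refl)
    fix j assume "j \<in> {..<Suc (length R)}"
    hence "j < Suc (length R)" by simp
    show "(-1) ^ j * row B \<theta> x (C ! j) * W B \<theta> R (take j C @ drop (Suc j) C)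
        = [:(-1) ^ j * u (C ! j) * v j:]"
      unfolding u v[OF \<open>j < Suc (length R)\<close>] one[of j] by (simp add: mult_ac)
  qed
  also have "\<dots> = [:\<Sum>j<Suc (length R). (-1) ^ j * u (C ! j) * v j:]"
    by (rule sum_const_poly)
  finally show ?case by blast
qed (auto simp: one_pCons)

text \<open>A class of row lists closed under walks and jumps. The window of length
  \<open>p + 1\<close> ensures that a first row jumping by \<open>p + 1\<close> lands behind all
  others; \<open>n + p + 1\<close> is the last initial row.\<close>

definition adm :: "nat list \<Rightarrow> bool" where
  "adm R \<longleftrightarrow> sorted_wrt (<) R \<and> (\<forall>x\<in>set R. x \<le> n + p + 1 \<and> x \<le> hd R + p)"

lemma adm_walk:
  assumes "adm (m # S)" "m \<le> n" "Suc m \<notin> set S"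
  shows "adm (Suc m # S)"
proof -
  have "Suc m < x" if "x \<in> set S" for x
    using that assms by (metis Suc_lessI adm_def sorted_wrt.simps(2))
  thus ?thesis using assms by (auto simp: adm_def)
qed

lemma adm_jump:
  assumes "adm (m # S)" "m \<le> n"
  shows "adm (S @ [m + p + 1])"
  using assms by (cases S) (fastforce simp: adm_def sorted_wrt_append)+

text \<open>Termination measure of the recurrence: a walk lowers it by 1, a jump of a row
  \<open>m \<le> n\<close> by \<open>p + 1\<close>.\<close>

definition gap :: "nat list \<Rightarrow> nat" where
  "gap R = sum_list (map (\<lambda>x. n + p + 1 - x) R)"

lemma adm_induct [consumes 1, case_names base step]:
  assumes "adm R"
    and "\<And>R. adm R \<Longrightarrow> (\<forall>x\<in>set R. n < x) \<Longrightarrow> P R"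
    and "\<And>m S. adm (m # S) \<Longrightarrow> m \<le> n \<Longrightarrow> (Suc m \<notin> set S \<Longrightarrow> P (Suc m # S)) \<Longrightarrow> P (S @ [m + p + 1])
      \<Longrightarrow> P (m # S)"
  shows "P R"
  using assms(1)
proof (induction R rule: measure_induct_rule[where f = gap])
  case (less R)
  show ?case
  proof (cases "\<forall>x\<in>set R. n < x")
    case True thus ?thesis using assms(2) less by blast
  next
    case False
    then obtain m S where R: "R = m # S" by (cases R) auto
    have m: "m \<le> n" using False less.prems by (auto simp: R adm_def)
    show ?thesis unfolding R
    proof (rule assms(3))
      show "P (Suc m # S)" if "Suc m \<notin> set S"
        using less.prems m that by (intro less.IH) (auto simp: R gap_def adm_walk)
      show "P (S @ [m + p + 1])"
        using less.prems m adm_jump by (intro less.IH) (auto simp: R gap_def)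
    qed (use less.prems m R in auto)
  qed
qed

definition pos_base :: "(nat \<Rightarrow> nat \<Rightarrow> real) \<Rightarrow> nat list \<Rightarrow> bool" where
  "pos_base B C \<longleftrightarrow> (\<forall>R. sorted_wrt (<) R \<and> set R \<subseteq> {..p} \<and> length R = length C \<longrightarrow> minor B R C > 0)"

text \<open>In \<open>W_Cons\<close> the walk term is nonnegative and the jump term strictly
  positive, since \<open>a m > 0\<close>; so positivity is inherited from the initial minors even
  where a weight vanishes.\<close>

lemma W_pos:
  assumes "adm R" "length R = length C" "\<theta> = - ((-1) ^ length C)" "pos_base B C" "t \<ge> 0"
  shows "poly (W B \<theta> R C) t > 0"
  using assms(1,2)
proof (induction R rule: adm_induct)
  case (base R)
  let ?R = "map (\<lambda>s. s - Suc n) R"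
  have "poly (W B \<theta> R C) t = minor (\<lambda>s. B (s - Suc n)) R C"
    unfolding poly_minor using base by (intro minor_cong) (auto simp: row_base)
  also have "\<dots> = minor B ?R C"
    unfolding minor_def by (intro arg_cong[of _ _ Determinant.det] eq_matI) auto
  also have "\<dots> > 0"
  proof -
    have "sorted_wrt (<) ?R"
      unfolding sorted_wrt_map
      by (rule sorted_wrt_mono_rel[of R "(<)"]) (use base in \<open>auto simp: adm_def\<close>)
    moreover have "set ?R \<subseteq> {..p}" using base by (auto simp: adm_def)
    ultimately show ?thesis using assms(4) base by (auto simp: pos_base_def)
  qed
  finally show ?case .
next
  case (step m S)
  have l: "length C = Suc (length S)" using step by simp
  have th: "\<theta> * (-1) ^ length S = 1" using assms(3) l by (simp flip: power_mult_distrib)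
  have "poly (W B \<theta> (S @ [m + p + 1]) C) t > 0" using step by simp
  moreover have "poly (walk m) t * poly (W B \<theta> (Suc m # S) C) t \<ge> 0" if "Suc m \<notin> set S"
    using step that assms walk_eval_nonneg by (intro mult_nonneg_nonneg) (auto intro: less_imp_le)
  ultimately show ?case
    using a_pos[of m] by (auto simp: W_Cons[OF step(2) l th] intro!: add_nonneg_pos)
qed

text \<open>The sign picked up by row \<open>s\<close> when \<theta> and \<open>t\<close> are both
  negated: it changes with each jump, which compensates \<theta>, and with each weight
  \<open>t\<close> that is crossed.\<close>

definition flip_sign :: "nat \<Rightarrow> real" where
  "flip_sign s = (if n < s then 1 else - ((-1) ^ ((n - s) div (p + 1))))"

lemma flip_sign_cases: "flip_sign s = 1 \<or> flip_sign s = -1"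
  by (cases "even ((n - s) div (p + 1))") (auto simp: flip_sign_def)

lemma div_diff_Suc:
  assumes "s < n"
  shows "(n - s) div (p + 1) = (n - Suc s) div (p + 1) + (if (p + 1) dvd (n - s) then 1 else 0)"
proof -
  have "n - s = Suc (n - Suc s)" using assms by simp
  thus ?thesis using div_Suc[of "n - Suc s" "p + 1"] by (simp add: dvd_eq_mod_eq_0)
qed

lemma flip_sign_Suc:
  assumes "s < n"
  shows "flip_sign (Suc s) = (if (p + 1) dvd (n - s) then - flip_sign s else flip_sign s)"
proof -
  have "\<not> n < s" "\<not> n < Suc s" using assms by auto
  thus ?thesis unfolding flip_sign_def div_diff_Suc[OF assms] by (cases "(p + 1) dvd (n - s)") simp_all
qed

lemma flip_sign_jump:
  assumes "s \<le> n"
  shows "flip_sign (s + p + 1) = - flip_sign s"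
proof (cases "s + p + 1 \<le> n")
  case True
  have "(n - s) div (p + 1) = Suc ((n - (s + p + 1)) div (p + 1))"
    using True by (subst le_div_geq) auto
  thus ?thesis using assms True by (simp add: flip_sign_def)
qed (use assms in \<open>simp add: flip_sign_def\<close>)

lemma row_flip: "poly (row B \<theta> s c) t = flip_sign s * poly (row B (-\<theta>) s c) (-t)"
proof (induction B \<theta> s c rule: row.induct)
  case (1 B \<theta> s c)
  show ?case
  proof (cases "n < s")
    case True thus ?thesis by (simp add: row_base flip_sign_def)
  next
    case False
    have IH1: "poly (row B \<theta> (Suc s) c) t = flip_sign (Suc s) * poly (row B (-\<theta>) (Suc s) c) (-t)"
      and IH2: "poly (row B \<theta> (s+p+1) c) t = - flip_sign s * poly (row B (-\<theta>) (s+p+1) c) (-t)"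
      using 1 False flip_sign_jump[of s] by auto
    have w: "poly (walk s) t * flip_sign (Suc s) = flip_sign s * poly (walk s) (-t)"
      using False flip_sign_Suc[of s] by (auto simp: walk_def)
    have "poly (row B \<theta> s c) t = poly (walk s) t * flip_sign (Suc s) * poly (row B (-\<theta>) (Suc s) c) (-t)
        + \<theta> * a s * (- flip_sign s * poly (row B (-\<theta>) (s+p+1) c) (-t))"
      using False by (simp only: row_step poly_add poly_mult poly_smult IH1 IH2 not_less mult.assoc)
    also have "\<dots> = flip_sign s * poly (row B (-\<theta>) s c) (-t)"
      using False unfolding w by (simp add: row_step algebra_simps)
    finally show ?thesis .
  qed
qed

text \<open>It gives signs at negative \<open>t\<close> for minors whose size has the wrong parity
  for \<theta>: their size fits \<open>-\<theta>\<close>, and \<open>W_pos\<close> applies at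
  \<open>-t > 0\<close>.\<close>

lemma W_flip:
  assumes "length C = length R"
  shows "poly (W B \<theta> R C) t = prod_list (map flip_sign R) * poly (W B (-\<theta>) R C) (-t)"
  unfolding poly_minor using assms by (intro minor_scale_rows row_flip)

end

section \<open>Comparison of growth and of degrees\<close>

text \<open>A degree bound in a form that passes through the recurrence: for nonnegative polynomials
  such inequalities add up term by term, while degrees of sums would require excluding
  cancellation.\<close>

definition dominated :: "nat \<Rightarrow> real poly \<Rightarrow> real poly \<Rightarrow> bool" where
  "dominated e A B \<longleftrightarrow> (\<exists>c>0. \<forall>t\<ge>1. poly A t \<le> c * t ^ e * poly B t)"

lemma dominatedI: "c > 0 \<Longrightarrow> (\<And>t. t \<ge> 1 \<Longrightarrow> poly A t \<le> c * t ^ e * poly B t) \<Longrightarrow> dominated e A B"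
  unfolding dominated_def by blast

lemma dominated_add:
  assumes "dominated e A B" "dominated e A' B'"
    and "\<And>t. t \<ge> 1 \<Longrightarrow> poly B t \<ge> 0" "\<And>t. t \<ge> 1 \<Longrightarrow> poly B' t \<ge> 0"
  shows "dominated e (A + A') (B + B')"
proof -
  obtain c c' where c: "c > 0" "\<And>t. t \<ge> 1 \<Longrightarrow> poly A t \<le> c * t ^ e * poly B t"
    and c': "c' > 0" "\<And>t. t \<ge> 1 \<Longrightarrow> poly A' t \<le> c' * t ^ e * poly B' t"
    using assms(1,2) unfolding dominated_def by blast
  show ?thesis
  proof (rule dominatedI[of "max c c'"])
    fix t :: real assume t: "t \<ge> 1"
    have "c * t ^ e * poly B t \<le> max c c' * t ^ e * poly B t"
      using t assms(3) by (intro mult_right_mono) auto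
    moreover have "c' * t ^ e * poly B' t \<le> max c c' * t ^ e * poly B' t"
      using t assms(4) by (intro mult_right_mono) auto
    ultimately show "poly (A + A') t \<le> max c c' * t ^ e * poly (B + B') t"
      using c(2)[OF t] c'(2)[OF t] by (simp add: algebra_simps)
  qed (use c in auto)
qed

lemma dominated_trans_le:
  assumes "dominated e A B" "k > 0" "\<And>t. t \<ge> 1 \<Longrightarrow> k * poly B t \<le> poly B' t"
  shows "dominated e A B'"
proof -
  obtain c where c: "c > 0" "\<And>t. t \<ge> 1 \<Longrightarrow> poly A t \<le> c * t ^ e * poly B t"
    using assms(1) unfolding dominated_def by blast
  show ?thesis
  proof (rule dominatedI[of "c / k"])
    fix t :: real assume t: "t \<ge> 1"
    have "c * t ^ e * poly B t = c / k * t ^ e * (k * poly B t)" using assms(2) by simp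
    also have "\<dots> \<le> c / k * t ^ e * poly B' t"
      using t c assms by (intro mult_left_mono) auto
    finally show "poly A t \<le> c / k * t ^ e * poly B' t" using c(2)[OF t] by linarith
  qed (use c assms in auto)
qed

lemma dominated_mult:
  assumes "dominated e A B" "\<And>t. t \<ge> 1 \<Longrightarrow> poly M t \<ge> 0"
  shows "dominated e (M * A) (M * B)"
proof -
  obtain c where c: "c > 0" "\<And>t. t \<ge> 1 \<Longrightarrow> poly A t \<le> c * t ^ e * poly B t"
    using assms(1) unfolding dominated_def by blast
  show ?thesis
  proof (rule dominatedI[OF c(1)])
    fix t :: real assume t: "t \<ge> 1"
    have "poly M t * poly A t \<le> poly M t * (c * t ^ e * poly B t)"
      using t c assms by (intro mult_left_mono) auto
    thus "poly (M * A) t \<le> c * t ^ e * poly (M * B) t" by (simp add: algebra_simps)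
  qed
qed

lemma dominated_smult:
  assumes "dominated e A B" "k > 0" shows "dominated e (smult k A) (smult k B)"
  using dominated_mult[of e A B "[:k:]"] assms by simp

lemma dominated_smult_left:
  assumes "dominated e A B" "k > 0" shows "dominated e (smult k A) B"
  by (rule dominated_trans_le[OF dominated_smult[OF assms], of "1/k"]) (use assms in auto)

lemma dominated_raise:
  assumes "dominated e A B" "\<And>t. t \<ge> 1 \<Longrightarrow> poly M t \<le> t ^ d" "\<And>t. t \<ge> 1 \<Longrightarrow> poly A t \<ge> 0"
    "\<And>t. t \<ge> 1 \<Longrightarrow> poly B t \<ge> 0" "d + e \<le> e'"
  shows "dominated e' (M * A) B"
proof -
  obtain c where c: "c > 0" "\<And>t. t \<ge> 1 \<Longrightarrow> poly A t \<le> c * t ^ e * poly B t"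
    using assms(1) unfolding dominated_def by blast
  show ?thesis
  proof (rule dominatedI[OF c(1)])
    fix t :: real assume t: "t \<ge> 1"
    have "poly M t * poly A t \<le> t ^ d * poly A t"
      using t assms by (intro mult_right_mono) auto
    also have "\<dots> \<le> t ^ d * (c * t ^ e * poly B t)"
      using t c by (intro mult_left_mono) auto
    also have "\<dots> = c * (t ^ (d + e) * poly B t)" by (simp add: power_add)
    also have "\<dots> \<le> c * (t ^ e' * poly B t)"
      using t c assms by (intro mult_left_mono mult_right_mono power_increasing) auto
    finally show "poly (M * A) t \<le> c * t ^ e' * poly B t" by (simp add: mult.assoc)
  qed
qed

text \<open>If the degree of \<open>A\<close> were larger, \<open>A - c t^e B\<close> would keep the
  leading coefficient of \<open>A\<close>, which is positive because \<open>A\<close> is, and would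
  be positive for large \<open>t\<close>.\<close>

lemma dominated_degree:
  assumes dom: "dominated e A B" and pos: "\<And>t. t \<ge> 1 \<Longrightarrow> poly A t > 0"
  shows "degree A \<le> degree B + e"
proof (rule ccontr)
  assume *: "\<not> ?thesis"
  obtain c where c: "c > 0" "\<And>t. t \<ge> 1 \<Longrightarrow> poly A t \<le> c * t ^ e * poly B t"
    using dom unfolding dominated_def by blast
  have A0: "A \<noteq> 0" using pos[of 1] by auto
  have lcA: "lead_coeff A > 0"
  proof (rule ccontr)
    assume "\<not> lead_coeff A > 0"
    hence "lead_coeff (-A) > 0" using A0 by (simp add: less_le)
    from poly_pinfty_gt_lc[OF this] obtain N where N: "\<And>x. x \<ge> N \<Longrightarrow> poly (-A) x \<ge> lead_coeff (-A)" by blast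
    have "poly (-A) (max N 1) > 0" using N[of "max N 1"] \<open>lead_coeff (-A) > 0\<close> by linarith
    thus False using pos[of "max N 1"] by auto
  qed
  define D where "D = A - smult c (monom 1 e * B)"
  have "degree (smult c (monom 1 e * B)) \<le> degree B + e"
    by (rule order.trans[OF degree_smult_le]) (rule order.trans[OF degree_mult_le], simp add: degree_monom_eq)
  hence lt: "degree (smult c (monom 1 e * B)) < degree A" using * by linarith
  have degD: "degree D = degree A"
    unfolding D_def diff_conv_add_uminus using lt by (intro degree_add_eq_left) auto
  have "coeff D (degree A) = lead_coeff A"
    unfolding D_def coeff_diff coeff_eq_0[OF lt] by simp
  hence "lead_coeff D > 0" using lcA degD by simp
  from poly_pinfty_gt_lc[OF this] obtain N where N: "\<And>x. x \<ge> N \<Longrightarrow> poly D x \<ge> lead_coeff D" by blast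
  have "poly D (max N 1) > 0" using N[of "max N 1"] \<open>lead_coeff D > 0\<close> by linarith
  thus False using c(2)[of "max N 1"] by (simp add: D_def poly_monom mult_ac)
qed

section \<open>Growth of the minors when a block of rows is shifted\<close>

context two_diagonal
begin

lemma gap_shift:
  assumes "v \<le> n" "j > 0"
  shows "gap [v+p+1..<v+p+1+j] < gap [v..<v+j]"
proof -
  have le: "gap [v+p+1..<v+p+1+j] \<le> gap [v..<v+j]" for v j
    by (induction j) (auto simp: gap_def intro!: add_mono)
  obtain i where i: "j = Suc i" using assms by (cases j) auto
  have "[v+p+1..<v+p+1+j] = (v+p+1) # [Suc v+p+1..<Suc v+p+1+i]" "[v..<v+j] = v # [Suc v..<Suc v+i]"
    by (simp_all add: i upt_conv_Cons del: upt_Suc)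
  thus ?thesis using le[of "Suc v" i] assms by (simp add: gap_def del: upt_Suc)
qed

lemma adm_subset:
  assumes "adm U" "sorted_wrt (<) R" "set R \<subseteq> set U"
  shows "adm R"
proof (cases R)
  case (Cons r R')
  have "hd U \<le> r" using assms Cons by (cases U) (auto simp: adm_def)
  thus ?thesis using assms Cons by (fastforce simp: adm_def)
qed (simp add: adm_def)

lemma walk_bound:
  "t \<ge> 1 \<Longrightarrow> s \<le> n \<Longrightarrow> poly (walk s) t \<le> t ^ (if s < n \<and> s mod (p + 1) = n mod (p + 1) then 1 else 0)"
proof -
  assume t: "t \<ge> 1" and s: "s \<le> n"
  have "s mod (p + 1) = n mod (p + 1)" if "(p + 1) dvd (n - s)" "s < n"
    using that by (metis less_imp_le mod_eq_dvd_iff_nat)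
  thus ?thesis using t s unfolding walk_def by (cases "s < n") auto
qed

text \<open>The coefficients of the recurrence do not depend on the columns, so the comparison is
  inherited from the initial case, where both minors are positive constants. It yields equal
  degrees.\<close>

lemma W_comparable:
  assumes "adm R" "length R = length C" "length R = length C'" "\<theta> = - ((-1) ^ length C)"
    and pb: "pos_base B C" "pos_base B C'"
  shows "dominated 0 (W B \<theta> R C) (W B \<theta> R C')"
  using assms(1-3)
proof (induction R rule: adm_induct)
  case (base R)
  have cn: "\<forall>x\<in>set R. n < x + p" using base(2) by auto
  obtain x y where xy: "W B \<theta> R C = [:x:]" "W B \<theta> R C' = [:y:]"
    using W_const[OF cn] base(3,4) by metis
  have "x > 0" using W_pos[OF base(1,3) assms(4) pb(1), of 1] xy by simp
  moreover have "y > 0" using W_pos[OF base(1,4) _ pb(2), of \<theta> 1] assms(4) base xy by simp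
  ultimately show ?case by (intro dominatedI[of "x/y"]) (auto simp: xy)
next
  case (step m S)
  have l: "length C = Suc (length S)" "length C' = Suc (length S)" using step by auto
  have th: "\<theta> * (-1) ^ length S = 1" using assms(4) l by (simp flip: power_mult_distrib)
  have th': "\<theta> = - ((-1) ^ length C')" using assms(4) l by simp
  have aj: "adm (S @ [m + p + 1])" using adm_jump step by blast
  have p2: "poly (W B \<theta> (S @ [m + p + 1]) C') t \<ge> 0" if "t \<ge> 1" for t
    using W_pos[OF aj _ th' pb(2), of t] l that by simp
  have d2: "dominated 0 (smult (a m) (W B \<theta> (S @ [m+p+1]) C)) (smult (a m) (W B \<theta> (S @ [m+p+1]) C'))"
    using step a_pos by (intro dominated_smult) auto
  show ?case
  proof (cases "Suc m \<in> set S")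
    case True
    thus ?thesis using d2 by (simp add: W_Cons[OF step(2) l(1) th] W_Cons[OF step(2) l(2) th])
  next
    case False
    have aw: "adm (Suc m # S)" using adm_walk step False by blast
    have "dominated 0 (walk m * W B \<theta> (Suc m # S) C) (walk m * W B \<theta> (Suc m # S) C')"
      using step False by (intro dominated_mult walk_eval_nonneg) auto
    moreover have "poly (walk m * W B \<theta> (Suc m # S) C') t \<ge> 0" if "t \<ge> 1" for t
      using W_pos[OF aw _ th' pb(2), of t] l that walk_eval_nonneg[of t m] by simp
    ultimately show ?thesis using d2 p2 a_pos[of m] False
      by (auto simp: W_Cons[OF step(2) l(1) th] W_Cons[OF step(2) l(2) th] intro!: dominated_add)
  qed
qed

text \<open>In a run of consecutive rows the first cannot walk, its neighbour being occupied; hence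
  the rows before \<open>v + i\<close> jump one after the other, and \<open>c\<close> is the product
  of their coefficients \<open>a\<close>.\<close>

lemma W_jumps:
  assumes "length C = i + length S + 1" "\<theta> = - ((-1) ^ length C)" "v + i \<le> n"
  shows "\<exists>c>0. W B \<theta> ([v..<v+i] @ (v+i) # S) C = smult c (W B \<theta> ((v+i) # S @ [v+p+1..<v+p+1+i]) C)"
  using assms
proof (induction i arbitrary: v S)
  case (Suc i)
  let ?R = "[Suc v..<Suc v+i] @ (Suc v+i) # S"
  have l: "length C = Suc (length ?R)" using Suc.prems by simp
  have th: "\<theta> * (-1) ^ length ?R = 1" using Suc.prems(2) l by (simp flip: power_mult_distrib)
  have e: "[v..<v + Suc i] = v # [Suc v..<Suc v + i]" by (subst upt_conv_Cons) auto
  have "Suc v \<in> set ?R" by (cases i) auto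
  hence "W B \<theta> ([v..<v+Suc i] @ (v+Suc i) # S) C = smult (a v) (W B \<theta> ([Suc v..<Suc v+i] @ (Suc v+i) # (S @ [v+p+1])) C)"
    using W_Cons[of v C ?R \<theta> B] Suc.prems l th unfolding e by simp
  moreover obtain c where "c > 0" "W B \<theta> ([Suc v..<Suc v+i] @ (Suc v+i) # (S @ [v+p+1])) C
      = smult c (W B \<theta> ((Suc v+i) # (S @ [v+p+1]) @ [Suc v+p+1..<Suc v+p+1+i]) C)"
    using Suc.IH[of "S @ [v+p+1]" "Suc v"] Suc.prems by auto
  moreover have "(S @ [v+p+1]) @ [Suc v+p+1..<Suc v+p+1+i] = S @ [v+p+1..<v+p+1+Suc i]"
    by (subst (2) upt_conv_Cons) auto
  ultimately show ?case using a_pos[of v] by (intro exI[of _ "a v * c"]) auto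
qed (auto intro: exI[of _ 1])

text \<open>Records whether the block meets the residue class of the indices with weight
  \<open>t\<close>. Using residues, without the bound \<open>n\<close>, makes it invariant under
  shifts by \<open>p + 1\<close>; a block of length at most \<open>p + 1\<close> meets the class at
  most once.\<close>

definition edge :: "nat \<Rightarrow> nat \<Rightarrow> nat" where
  "edge v j = (if \<exists>u\<in>{v..<v+j}. u mod (p + 1) = n mod (p + 1) then 1 else 0)"

lemma edge_shift: "edge (v + p + 1) j = edge v j"
proof -
  have "(\<exists>u\<in>{v+p+1..<v+p+1+j}. u mod (p+1) = n mod (p+1)) \<longleftrightarrow> (\<exists>u\<in>{v..<v+j}. u mod (p+1) = n mod (p+1))"
  proof safe
    fix u assume "u \<in> {v+p+1..<v+p+1+j}" "u mod (p+1) = n mod (p+1)"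
    thus "\<exists>u\<in>{v..<v+j}. u mod (p+1) = n mod (p+1)"
      by (intro bexI[of _ "u - (p+1)"]) (auto simp: le_mod_geq)
  next
    fix u assume "u \<in> {v..<v+j}" "u mod (p+1) = n mod (p+1)"
    thus "\<exists>u\<in>{v+p+1..<v+p+1+j}. u mod (p+1) = n mod (p+1)"
      by (intro bexI[of _ "u + (p+1)"]) (auto simp del: add_Suc_right)
  qed
  thus ?thesis by (simp add: edge_def)
qed

text \<open>The \<open>j + 1 \<le> p\<close> rows of the block have different residues, so a factor
  \<open>t\<close> from the last row excludes one from the rows before it.\<close>

lemma edge_last:
  assumes "j < p"
  shows "(if v + j < n \<and> (v + j) mod (p + 1) = n mod (p + 1) then 1 else 0) + edge v j \<le> edge v (Suc j)"
proof -
  have F: False if "(v + j) mod (p + 1) = n mod (p + 1)" "u \<in> {v..<v+j}" "u mod (p + 1) = n mod (p + 1)" for u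
  proof -
    have "(p + 1) dvd (v + j - u)" using that by (metis atLeastLessThan_iff less_imp_le mod_eq_dvd_iff_nat)
    thus False using that assms by (auto dest: dvd_imp_le)
  qed
  have "edge v j = 0" if "(v + j) mod (p + 1) = n mod (p + 1)"
  proof -
    have "\<not> (\<exists>u\<in>{v..<v+j}. u mod (p + 1) = n mod (p + 1))" using F[OF that] by blast
    thus ?thesis unfolding edge_def by (rule if_not_P)
  qed
  moreover have "edge v (Suc j) = 1" if "(v + j) mod (p + 1) = n mod (p + 1)"
    unfolding edge_def using that by (intro if_P bexI[of _ "v + j"]) auto
  moreover have "edge v j \<le> edge v (Suc j)" by (auto simp: edge_def)
  ultimately show ?thesis by auto
qed

text \<open>Say that row \<open>v\<close> walks in the first term of \<open>W_Cons\<close> and jumps in the second. Only the last row of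
  the block \<open>v, \<dots>, v + j - 1\<close> can walk; after all the others have jumped the block reappears \<open>p + 1\<close>
  further on, either with its full length or, if its last row walked, with one row less. Each walk
  made in this way uses a different residue class, so at most one of them contributes a factor \<open>t\<close>.\<close>

lemma block_dominated:
  assumes "adm (L @ [v..<v+j+1] @ H)" "length C = length L + j + length H"
    "\<theta> = - ((-1) ^ length C)" "pos_base B C"
  shows "dominated (edge v j) (W B \<theta> (L @ [v..<v+j] @ H) C) (W B \<theta> (L @ [v+1..<v+j+1] @ H) C)"
  using assms(1,2)
\<comment> \<open>The induction is on the union of the two row lists: the first one omits
  \<open>v + j\<close>, the second \<open>v\<close>.\<close>
proof (induction "L @ [v..<v+j+1] @ H" arbitrary: L v j H rule: measure_induct_rule[where f = gap])
  case (less L v j H)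
  note admU = less.prems(1) and len = less.prems(2)
  let ?e = "edge v j"
  have WP: "poly (W B \<theta> R C) t > 0" if "adm R" "length R = length C" "t \<ge> 1" for R t
    using W_pos[OF that(1,2) assms(3,4)] that by simp
  have srt: "sorted_wrt (<) (L @ [v..<v+j+1] @ H)" using admU by (simp add: adm_def)
  have adm_old: "adm (L @ [v..<v+j] @ H)"
    by (rule adm_subset[OF admU]) (use srt in \<open>auto simp: sorted_wrt_append\<close>)
  have adm_new: "adm (L @ [v+1..<v+j+1] @ H)"
    by (rule adm_subset[OF admU]) (use srt in \<open>auto simp: sorted_wrt_append\<close>)
  \<comment> \<open>Either the lists coincide, or only constant weights follow, or a row in front of
    the block can be expanded on both sides, or the block itself comes first.\<close>
  consider (zero) "j = 0" | (const) "j > 0" "\<forall>x\<in>set (L @ [v..<v+j+1] @ H). n < x + p"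
    | (head) b L' where "j > 0" "L = b # L'" "b \<le> n" | (block) "j > 0" "L = []" "v + j \<le> n"
  proof (cases L)
    case (Cons b L')
    show ?thesis
    proof (cases "b \<le> n")
      case False
      have "b \<le> x" if "x \<in> set (L @ [v..<v+j+1] @ H)" for x
        using srt that Cons by (auto intro: less_imp_le)
      hence "\<forall>x\<in>set (L @ [v..<v+j+1] @ H). n < x + p" using False by fastforce
      thus ?thesis using that by blast
    qed (use that Cons in blast)
  next
    case Nil
    show ?thesis
    proof (cases "v + j \<le> n")
      case False
      have "hd (L @ [v..<v+j+1] @ H) = v" by (simp add: Nil hd_append del: upt_Suc)
      moreover have "v + j \<in> set (L @ [v..<v+j+1] @ H)" by simp
      ultimately have "v + j \<le> v + p" using admU unfolding adm_def by metis
      moreover have "v \<le> x" if "x \<in> set (L @ [v..<v+j+1] @ H)" for x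
        using srt that Nil by (auto simp: sorted_wrt_append)
      ultimately have "\<forall>x\<in>set (L @ [v..<v+j+1] @ H). n < x + p" using False by fastforce
      thus ?thesis using that by blast
    qed (use that Nil in blast)
  qed
  thus ?case
  proof cases
    case zero
    show ?thesis by (rule dominatedI[of 1]) (use zero in \<open>auto simp: edge_def\<close>)
  next
    case const
    have "\<forall>x\<in>set (L @ [v..<v+j] @ H). n < x + p" "\<forall>x\<in>set (L @ [v+1..<v+j+1] @ H). n < x + p"
      using const by auto
    moreover have "length C = length (L @ [v..<v+j] @ H)" "length C = length (L @ [v+1..<v+j+1] @ H)"
      using len by auto
    ultimately obtain x y where xy: "W B \<theta> (L @ [v..<v+j] @ H) C = [:x:]" "W B \<theta> (L @ [v+1..<v+j+1] @ H) C = [:y:]"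
      using W_const by meson
    have pos: "x > 0" "y > 0" using WP[OF adm_old, of 1] WP[OF adm_new, of 1] const len xy by auto
    show ?thesis
    proof (rule dominatedI[of "x/y"])
      fix t :: real assume "t \<ge> 1"
      hence "x * 1 \<le> x * t ^ ?e" using pos by (intro mult_left_mono one_le_power) auto
      thus "poly (W B \<theta> (L @ [v..<v+j] @ H) C) t \<le> x / y * t ^ ?e * poly (W B \<theta> (L @ [v+1..<v+j+1] @ H) C) t"
        using pos xy by simp
    qed (use pos in auto)
  next
    case (head b L')
    define S where "S = L' @ [v..<v+j] @ H"
    define S' where "S' = L' @ [v+1..<v+j+1] @ H"
    have l: "length C = Suc (length S)" "length C = Suc (length S')"
      using len head by (auto simp: S_def S'_def)
    have th: "\<theta> * (-1) ^ length S = 1" "\<theta> * (-1) ^ length S' = 1"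
      using assms(3) l by (simp_all flip: power_mult_distrib)
    have srt': "\<forall>x\<in>set (L' @ [v..<v+j+1] @ H). b < x" using srt head by simp
    have adm_new': "adm (b # S')" and adm_old': "adm (b # S)"
      using adm_new adm_old head by (auto simp: S_def S'_def)
    have jd: "dominated ?e (smult (a b) (W B \<theta> (S @ [b+p+1]) C)) (smult (a b) (W B \<theta> (S' @ [b+p+1]) C))"
    proof -
      have u: "adm (L' @ [v..<v+j+1] @ H @ [b+p+1])"
        using adm_jump[of b "L' @ [v..<v+j+1] @ H"] admU head by simp
      have "dominated ?e (W B \<theta> (L' @ [v..<v+j] @ H @ [b+p+1]) C) (W B \<theta> (L' @ [v+1..<v+j+1] @ H @ [b+p+1]) C)"
        using u len head by (intro less.hyps) (auto simp: gap_def)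
      thus ?thesis using a_pos by (intro dominated_smult) (auto simp: S_def S'_def)
    qed
    have jp: "poly (smult (a b) (W B \<theta> (S' @ [b+p+1]) C)) t \<ge> 0" if "t \<ge> 1" for t
      using WP[OF adm_jump[OF adm_new' head(3)] _ that] l a_pos[of b] by simp
    have eqo: "W B \<theta> (L @ [v..<v+j] @ H) C = W B \<theta> (b # S) C"
      and eqn: "W B \<theta> (L @ [v+1..<v+j+1] @ H) C = W B \<theta> (b # S') C"
      by (simp_all add: S_def S'_def head)
    have wp: "poly (walk b * W B \<theta> (Suc b # S') C) t \<ge> 0" if "t \<ge> 1" "Suc b \<notin> set S'" for t
      using WP[OF adm_walk[OF adm_new' head(3) that(2)] _ that(1)] l walk_eval_nonneg[of t b] that by simp
    show ?thesis
    \<comment> \<open>The row after \<open>b\<close> may be occupied in the first list alone, by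
      \<open>v\<close>; then the right side merely gains a nonnegative term. It is never occupied in
      the second list alone.\<close>
    proof (cases "Suc b \<in> set S")
      case True
      have "dominated ?e (0 + smult (a b) (W B \<theta> (S @ [b+p+1]) C))
          ((if Suc b \<in> set S' then 0 else walk b * W B \<theta> (Suc b # S') C) + smult (a b) (W B \<theta> (S' @ [b+p+1]) C))"
        by (rule dominated_add[OF _ jd _ jp]) (use wp in \<open>auto intro!: dominatedI[of 1]\<close>)
      thus ?thesis unfolding eqo eqn W_Cons[OF head(3) l(1) th(1)] W_Cons[OF head(3) l(2) th(2)]
        using True by simp
    next
      case False
      hence nv: "Suc b \<noteq> v" using head by (auto simp: S_def)
      have nS': "Suc b \<notin> set S'"
      proof
        assume "Suc b \<in> set S'"
        with False have "Suc b \<in> {v+1..<v+j+1}" by (auto simp: S_def S'_def)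
        moreover have "b < v" using bspec[OF srt', of v] head(1) by simp
        ultimately show False using nv by auto
      qed
      have nU: "Suc b \<notin> set (L' @ [v..<v+j+1] @ H)"
        using nS' nv head by (auto simp: S'_def)
      have u: "adm ((Suc b # L') @ [v..<v+j+1] @ H)"
        using adm_walk[of b "L' @ [v..<v+j+1] @ H"] admU head nU by simp
      have "dominated ?e (W B \<theta> ((Suc b # L') @ [v..<v+j] @ H) C) (W B \<theta> ((Suc b # L') @ [v+1..<v+j+1] @ H) C)"
        using u len head by (intro less.hyps) (auto simp: gap_def)
      hence "dominated ?e (walk b * W B \<theta> (Suc b # S) C) (walk b * W B \<theta> (Suc b # S') C)"
        by (intro dominated_mult walk_eval_nonneg) (auto simp: S_def S'_def)
      hence "dominated ?e (walk b * W B \<theta> (Suc b # S) C + smult (a b) (W B \<theta> (S @ [b+p+1]) C))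
          (walk b * W B \<theta> (Suc b # S') C + smult (a b) (W B \<theta> (S' @ [b+p+1]) C))"
        by (rule dominated_add[OF _ jd _ jp]) (use wp nS' in auto)
      thus ?thesis unfolding eqo eqn W_Cons[OF head(3) l(1) th(1)] W_Cons[OF head(3) l(2) th(2)]
        using False nS' by simp
    qed
  next
    case block
    then obtain i where i: "j = Suc i" by (cases j) auto
    define v' where "v' = v + p + 1"
    define S1 where "S1 = H @ [v'..<v'+i]"
    define S2 where "S2 = H @ [v'+1..<v'+1+i]"
    have hdU: "hd (L @ [v..<v+j+1] @ H) = v" by (simp add: block hd_append del: upt_Suc)
    have win: "x \<le> v + p" if "x \<in> set (L @ [v..<v+j+1] @ H)" for x
      using admU hdU that unfolding adm_def by metis
    have jp: "j \<le> p" using win[of "v + j"] by simp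
    have "v + j < x" if "x \<in> set H" for x
      using srt that by (auto simp: sorted_wrt_append)
    moreover have "x < v'" if "x \<in> set H" for x
      using win[of x] that by (simp add: v'_def)
    ultimately have H: "\<forall>x\<in>set H. v + j < x \<and> x < v'" by blast
    have srtH: "sorted_wrt (<) H" using srt by (simp add: sorted_wrt_append)
    have l: "length C = Suc (length S1)" "length C = Suc (length S2)" "length C = i + length H + 1"
      using len block by (auto simp: S1_def S2_def i)
    have th: "\<theta> * (-1) ^ length S1 = 1" "\<theta> * (-1) ^ length S2 = 1"
      using assms(3) l by (simp_all flip: power_mult_distrib)
    have U1: "adm (((v+j) # H) @ [v'..<v'+i+1])"
      using H srtH jp block by (auto simp: adm_def sorted_wrt_append v'_def i)
    have U2: "adm (H @ [v'..<v'+j+1])"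
      using H srtH jp block by (cases H) (auto simp: adm_def sorted_wrt_append v'_def hd_append)
    have admB1: "adm ((v+j) # S2)"
      using H srtH jp block by (auto simp: adm_def sorted_wrt_append v'_def i S2_def)
    have admA1: "adm ((v+j) # S1)"
      using H srtH jp block by (auto simp: adm_def sorted_wrt_append v'_def i S1_def)
    have jB: "S2 @ [v + j + p + 1] = H @ [v'+1..<v'+j+1]"
      by (simp add: S2_def v'_def i)
    have jA: "S1 @ [v + i + p + 1] = H @ [v'..<v'+j]"
      by (simp add: S1_def v'_def i)
    have admB2: "adm (H @ [v'+1..<v'+j+1])"
      using adm_jump[OF admB1 block(3)] jB by simp
    \<comment> \<open>All rows of the block but the last have jumped. In the old list row
      \<open>v + i\<close> then walks, giving \<open>A1\<close>, or jumps, giving \<open>A2\<close>;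
      \<open>B1\<close> is the new list after the forced jumps, and \<open>B2\<close> arises from it
      by a jump of row \<open>v + j\<close>. \<open>A1\<close> is compared with \<open>B1\<close>
      and \<open>A2\<close> with \<open>B2\<close>.\<close>
    define A1 where "A1 = W B \<theta> ((v+j) # S1) C"
    define A2 where "A2 = W B \<theta> (H @ [v'..<v'+j]) C"
    define B1 where "B1 = W B \<theta> ((v+j) # S2) C"
    define B2 where "B2 = W B \<theta> (H @ [v'+1..<v'+j+1]) C"
    have pB1: "poly B1 t > 0" if "t \<ge> 1" for t
      unfolding B1_def using WP[OF admB1 _ that] l by simp
    have pA1: "poly A1 t > 0" if "t \<ge> 1" for t
      unfolding A1_def using WP[OF admA1 _ that] l by simp
    obtain c1 where c1: "c1 > 0" "W B \<theta> ([v..<v+i] @ (v+i) # H) C = smult c1 (W B \<theta> ((v+i) # H @ [v+p+1..<v+p+1+i]) C)"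
      using W_jumps[of C i H \<theta> v B] l assms(3) block i by auto
    obtain c2 where c2: "c2 > 0" "W B \<theta> ([v+1..<v+1+i] @ (v+1+i) # H) C = smult c2 (W B \<theta> ((v+1+i) # H @ [v+1+p+1..<v+1+p+1+i]) C)"
      using W_jumps[of C i H \<theta> "v+1" B] l assms(3) block i by auto
    have new: "W B \<theta> (L @ [v+1..<v+j+1] @ H) C = smult c2 B1"
      using c2(2) by (simp add: B1_def S2_def v'_def block i)
    have nS1: "Suc (v + i) \<notin> set S1" using H jp by (auto simp: S1_def v'_def i)
    have old: "W B \<theta> (L @ [v..<v+j] @ H) C = smult c1 (walk (v + i) * A1 + smult (a (v + i)) A2)"
    proof -
      have "W B \<theta> (L @ [v..<v+j] @ H) C = smult c1 (W B \<theta> ((v+i) # S1) C)"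
        using c1(2) by (simp add: S1_def v'_def block i)
      also have "W B \<theta> ((v+i) # S1) C = walk (v + i) * A1 + smult (a (v + i)) A2"
        unfolding A1_def A2_def jA[symmetric]
        using W_Cons[of "v+i" C S1 \<theta> B] block i l th nS1 by simp
      finally show ?thesis .
    qed
    have B1B2: "a (v + j) * poly B2 t \<le> poly B1 t" if "t \<ge> 1" for t
    proof -
      have "poly (walk (v+j) * W B \<theta> (Suc (v+j) # S2) C) t \<ge> 0" if "Suc (v + j) \<notin> set S2"
        using WP[OF adm_walk[OF admB1 block(3) that] _ \<open>t \<ge> 1\<close>] l walk_eval_nonneg[of t "v+j"] \<open>t \<ge> 1\<close> by simp
      thus ?thesis
        using W_Cons[OF block(3) l(2) th(2), of B] jB by (auto simp: B1_def B2_def)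
    qed
    have IH1: "dominated (edge v' i) A1 B1"
    proof -
      have "dominated (edge v' i) (W B \<theta> (((v+j) # H) @ [v'..<v'+i] @ []) C)
          (W B \<theta> (((v+j) # H) @ [v'+1..<v'+i+1] @ []) C)"
      proof (rule less.hyps)
        have "gap [v'..<v'+j] < gap [v..<v+j]" unfolding v'_def using block by (intro gap_shift) auto
        thus "gap (((v+j) # H) @ [v'..<v'+i+1] @ []) < gap (L @ [v..<v+j+1] @ H)"
          by (simp add: gap_def block(2) i)
        show "adm (((v+j) # H) @ [v'..<v'+i+1] @ [])" using U1 by simp
      qed (use l in simp)
      thus ?thesis by (simp add: A1_def B1_def S1_def S2_def del: upt_Suc)
    qed
    have IH2: "dominated (edge v' j) A2 B2"
    proof -
      have "dominated (edge v' j) (W B \<theta> (H @ [v'..<v'+j] @ []) C) (W B \<theta> (H @ [v'+1..<v'+j+1] @ []) C)"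
      proof (rule less.hyps)
        have "gap [v'..<v'+(j+1)] < gap [v..<v+(j+1)]" unfolding v'_def using block by (intro gap_shift) auto
        thus "gap (H @ [v'..<v'+j+1] @ []) < gap (L @ [v..<v+j+1] @ H)"
          by (simp add: gap_def block(2) del: upt_Suc)
        show "adm (H @ [v'..<v'+j+1] @ [])" using U2 by simp
      qed (use l i in simp)
      thus ?thesis by (simp add: A2_def B2_def del: upt_Suc)
    qed
    \<comment> \<open>A factor \<open>t\<close> from the walk uses the residue of row
      \<open>v + i\<close>, which the remaining block of length \<open>i\<close> does not contain;
      so the exponents add up to at most \<open>edge v j\<close>.\<close>
    have d1: "dominated ?e (walk (v + i) * A1) B1"
    proof (rule dominated_raise[OF IH1 walk_bound])
      show "(if v + i < n \<and> (v + i) mod (p + 1) = n mod (p + 1) then 1 else 0) + edge v' i \<le> ?e"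
        unfolding v'_def edge_shift i using edge_last[of i v] jp i by simp
    qed (use pA1 pB1 block i in \<open>auto intro: less_imp_le\<close>)
    have d2: "dominated ?e (smult (a (v + i)) A2) B1"
      using IH2 B1B2 a_pos edge_shift[of v j]
      by (intro dominated_smult_left) (auto simp: v'_def intro: dominated_trans_le)
    have "dominated ?e (walk (v + i) * A1 + smult (a (v + i)) A2) (B1 + B1)"
      by (rule dominated_add[OF d1 d2]) (use pB1 in \<open>auto intro: less_imp_le\<close>)
    hence "dominated ?e (walk (v + i) * A1 + smult (a (v + i)) A2) (smult c2 B1)"
      by (rule dominated_trans_le[of _ _ _ "c2/2"]) (use c2 pB1 in auto)
    thus ?thesis unfolding old new using c1 by (intro dominated_smult_left)
  qed
qed

end

subsection \<open>Strict interlacing\<close>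

text \<open>Exactly the first \<open>i\<close> factors are negative. Here and below a zero is
  encoded by its negative, so that lists of zeros are positive and increasing.\<close>

lemma prod_list_sign:
  fixes xs :: "real list"
  assumes "i \<le> length xs" "\<And>j. j < i \<Longrightarrow> xs ! j < u" "\<And>j. i \<le> j \<Longrightarrow> j < length xs \<Longrightarrow> u < xs ! j"
  shows "(-1) ^ i * (\<Prod>x\<leftarrow>xs. - u + x) > 0"
  using assms
proof (induction xs arbitrary: i)
  case (Cons x xs)
  show ?case
  proof (cases i)
    case 0
    have "(-1) ^ 0 * (\<Prod>x\<leftarrow>xs. - u + x) > 0"
      by (rule Cons.IH) (use Cons.prems(3)[of "Suc j" for j] 0 in auto)
    thus ?thesis using Cons.prems(3)[of 0] 0 by simp
  next
    case (Suc i')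
    have 1: "(-1) ^ i' * (\<Prod>x\<leftarrow>xs. - u + x) > 0"
      by (rule Cons.IH) (use Cons.prems(2)[of "Suc j" for j] Cons.prems(3)[of "Suc j" for j] Cons.prems(1) Suc in auto)
    have "u - x > 0" using Cons.prems(2)[of 0] Suc by simp
    from mult_pos_pos[OF this 1] have "0 < (u - x) * ((-1) ^ i' * (\<Prod>x\<leftarrow>xs. - u + x))" .
    also have "(u - x) * ((-1) ^ i' * (\<Prod>x\<leftarrow>xs. - u + x)) = (-1) ^ i * (\<Prod>x\<leftarrow>x # xs. - u + x)"
      by (simp add: Suc algebra_simps)
    finally show ?thesis .
  qed
qed simp

lemma opposite_signs:
  fixes s x y :: real
  assumes "s * s = 1" "s * x > 0" "s * y < 0"
  shows "x * y < 0"
proof -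
  have "(s * x) * (s * y) < 0" using assms(2,3) by (rule mult_pos_neg)
  moreover have "(s * x) * (s * y) = (s * s) * (x * y)" by (simp only: mult_ac)
  ultimately show ?thesis using assms(1) by simp
qed

lemma degree_prod_linear: "degree (\<Prod>x\<leftarrow>xs. [:x, 1::real:]) = length xs"
  and lead_coeff_prod_linear: "lead_coeff (\<Prod>x\<leftarrow>xs. [:x, 1::real:]) = 1"
proof -
  have "degree (\<Prod>x\<leftarrow>xs. [:x, 1::real:]) = length xs \<and> lead_coeff (\<Prod>x\<leftarrow>xs. [:x, 1::real:]) = 1"
  proof (induction xs)
    case (Cons x xs)
    have "(\<Prod>x\<leftarrow>xs. [:x, 1::real:]) \<noteq> 0" using Cons by auto
    hence "degree (\<Prod>x\<leftarrow>x # xs. [:x, 1::real:]) = length (x # xs)"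
      using Cons degree_mult_eq[of "[:x, 1:]" "\<Prod>x\<leftarrow>xs. [:x, 1::real:]"]
      by (simp del: mult_pCons_left)
    moreover have "lead_coeff (\<Prod>x\<leftarrow>x # xs. [:x, 1::real:]) = 1"
      unfolding list.map prod_list.Cons lead_coeff_mult conjunct2[OF Cons.IH] by simp
    ultimately show ?case by blast
  qed simp
  thus "degree (\<Prod>x\<leftarrow>xs. [:x, 1::real:]) = length xs"
    "lead_coeff (\<Prod>x\<leftarrow>xs. [:x, 1::real:]) = 1" by auto
qed

lemma poly_prod_linear: "poly (\<Prod>x\<leftarrow>xs. [:x, 1::real:]) t = (\<Prod>x\<leftarrow>xs. t + x)"
  by (induction xs) (auto simp: algebra_simps)

lemma split_by_roots:
  fixes F :: "real poly"
  assumes "degree F = length ys" "distinct ys" "\<And>y. y \<in> set ys \<Longrightarrow> poly F (-y) = 0"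
  shows "F = smult (lead_coeff F) (\<Prod>y\<leftarrow>ys. [:y, 1:])"
proof (rule ccontr)
  let ?Q = "smult (lead_coeff F) (\<Prod>y\<leftarrow>ys. [:y, 1:])"
  assume "F \<noteq> ?Q"
  hence nz: "F - ?Q \<noteq> 0" by simp
  have le: "degree (F - ?Q) \<le> length ys"
    using assms(1) by (intro degree_diff_le) (auto simp: degree_prod_linear)
  have "coeff (F - ?Q) (length ys) = 0"
    using assms(1) lead_coeff_prod_linear[of ys] by (simp add: degree_prod_linear)
  hence "degree (F - ?Q) \<noteq> length ys" using nz by (metis leading_coeff_0_iff)
  hence lt: "degree (F - ?Q) < length ys" using le by simp
  have "(\<lambda>y. -y) ` set ys \<subseteq> {x. poly (F - ?Q) x = 0}"
  proof safe
    fix y assume y: "y \<in> set ys"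
    have "(\<Prod>x\<leftarrow>ys. - y + x) = 0" using y by (induction ys) auto
    thus "poly (F - ?Q) (-y) = 0" using assms(3)[OF y] by (simp add: poly_prod_linear)
  qed
  hence "card ((\<lambda>y. -y) ` set ys) \<le> card {x. poly (F - ?Q) x = 0}"
    using poly_roots_finite[OF nz] by (intro card_mono)
  also have "card ((\<lambda>y. -y) ` set ys) = length ys"
    using assms(2) by (subst card_image) (auto simp: distinct_card inj_on_def)
  finally show False using card_poly_roots_bound[OF nz] lt by simp
qed

lemma lead_coeff_pos:
  fixes F :: "real poly"
  assumes "\<And>t. t \<ge> 0 \<Longrightarrow> poly F t > 0"
  shows "lead_coeff F > 0"
proof (rule ccontr)
  assume n: "\<not> lead_coeff F > 0"
  have "F \<noteq> 0" using assms[of 0] by auto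
  hence l: "lead_coeff (-F) > 0" using n by (simp add: less_le)
  from poly_pinfty_gt_lc[OF l] obtain N where N: "\<And>x. x \<ge> N \<Longrightarrow> poly (-F) x \<ge> lead_coeff (-F)" by blast
  have "poly (-F) (max N 0) > 0" using N[of "max N 0"] l by linarith
  thus False using assms[of "max N 0"] by simp
qed

lemma sign_at_minus_infinity:
  fixes F :: "real poly"
  assumes "lead_coeff F > 0"
  shows "\<exists>u>v. (-1) ^ degree F * poly F (-u) > 0"
proof -
  define G where "G = smult ((-1) ^ degree F) (pcompose F [:0, -1:])"
  have "lead_coeff G = lead_coeff F"
    by (simp add: G_def lead_coeff_comp flip: power_mult_distrib mult.assoc)
  hence l: "lead_coeff G > 0" using assms by simp
  from poly_pinfty_gt_lc[OF l] obtain N where N: "\<And>x. x \<ge> N \<Longrightarrow> poly G x \<ge> lead_coeff G" by blast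
  have "poly G (max N (v + 1)) > 0" using N[of "max N (v+1)"] l by linarith
  thus ?thesis by (intro exI[of _ "max N (v+1)"]) (auto simp: G_def poly_pcompose)
qed

lemma sign_change_root:
  fixes F :: "real poly"
  assumes "u < v" "poly F (-u) * poly F (-v) < 0"
  shows "\<exists>r>u. r < v \<and> poly F (-r) = 0"
proof -
  have "\<exists>x. -v < x \<and> x < -u \<and> poly F x = 0"
    using assms poly_IVT[of "-v" "-u" F] by (auto simp: mult.commute)
  then obtain x where "-v < x" "x < -u" "poly F x = 0" by blast
  thus ?thesis by (intro exI[of _ "-x"]) auto
qed

text \<open>The alternating signs force a zero between consecutive sample points, hence
  \<open>degree F \<ge> length us - 1\<close>. If the degree equals \<open>length us\<close>, the
  sign at minus infinity supplies one more zero behind the last point. So all zeros are real, simple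
  and located.\<close>

lemma alternation_roots:
  fixes F :: "real poly" and us :: "real list"
  assumes us: "sorted_wrt (<) us" "\<And>i. i < length us \<Longrightarrow> (-1) ^ i * poly F (- (us ! i)) > 0"
    and deg: "degree F \<le> length us" and lc: "lead_coeff F > 0"
  obtains ys where "sorted_wrt (<) ys" "length ys = degree F"
    "F = smult (lead_coeff F) (\<Prod>y\<leftarrow>ys. [:y, 1:])"
    "\<And>i. i < length ys \<Longrightarrow> us ! i < ys ! i"
    "\<And>i. i < length ys \<Longrightarrow> Suc i < length us \<Longrightarrow> ys ! i < us ! Suc i"
proof -
  let ?m = "length us"
  have sq: "(-1::real) ^ i * (-1) ^ i = 1" for i by (simp flip: power_mult_distrib)
  have le: "us ! i \<le> us ! j" if "i \<le> j" "j < ?m" for i j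
    using sorted_wrt_nth_less[OF us(1), of i j] that by (cases "i = j") auto
  have inner: "\<exists>r>us ! i. r < us ! Suc i \<and> poly F (-r) = 0" if "Suc i < ?m" for i
  proof (rule sign_change_root)
    show "us ! i < us ! Suc i" using us(1) that by (simp add: sorted_wrt_nth_less)
    show "poly F (- (us ! i)) * poly F (- (us ! Suc i)) < 0"
      by (rule opposite_signs[OF sq[of i]]) (use us(2)[of i] us(2)[of "Suc i"] that in auto)
  qed
  have last: "\<exists>r>us ! i. poly F (-r) = 0" if "degree F = Suc i" "Suc i = ?m" for i
  proof -
    obtain u where u: "u > us ! i" "(-1) ^ degree F * poly F (-u) > 0"
      using sign_at_minus_infinity[OF lc] by blast
    have "(-1) ^ i * poly F (-u) < 0" using u(2) by (simp add: that(1))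
    moreover have "(-1) ^ i * poly F (- (us ! i)) > 0" using us(2) that(2) by simp
    ultimately have "poly F (- (us ! i)) * poly F (-u) < 0"
      using opposite_signs[OF sq] by blast
    thus ?thesis using sign_change_root[OF u(1)] by blast
  qed
  have ge: "?m \<le> Suc (degree F)"
  proof (rule ccontr)
    assume *: "\<not> ?thesis"
    obtain r where r: "\<And>i. Suc i < ?m \<Longrightarrow> us ! i < r i \<and> r i < us ! Suc i \<and> poly F (- r i) = 0"
      using inner by metis
    have mono: "r i < r j" if "i < j" "Suc j < ?m" for i j
    proof -
      have "us ! Suc i \<le> us ! j"
        using le[of "Suc i" j] that by simp
      thus ?thesis using r[of i] r[of j] that by force
    qed
    have "inj_on (\<lambda>i. - r i) {..<?m - 1}"
      by (rule linorder_inj_onI') (use mono in force)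
    hence "?m - 1 = card ((\<lambda>i. - r i) ` {..<?m - 1})" by (simp add: card_image)
    also have "\<dots> \<le> card {x. poly F x = 0}"
    proof (rule card_mono)
      show "finite {x. poly F x = 0}" using lc by (intro poly_roots_finite) auto
    qed (use r in auto)
    also have "\<dots> \<le> degree F" using lc by (intro card_poly_roots_bound) auto
    finally show False using * by linarith
  qed
  have "\<exists>r>us ! i. (Suc i < ?m \<longrightarrow> r < us ! Suc i) \<and> poly F (-r) = 0" if "i < degree F" for i
  proof (cases "Suc i < ?m")
    case True
    from inner[OF this] show ?thesis by blast
  next
    case False
    hence d: "degree F = Suc i" "Suc i = ?m" using that deg by auto
    from last[OF this] obtain r where "r > us ! i" "poly F (-r) = 0" by blast
    thus ?thesis using d by (intro exI[of _ r]) simp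
  qed
  hence "\<forall>i. \<exists>r. i < degree F \<longrightarrow> us ! i < r \<and> (Suc i < ?m \<longrightarrow> r < us ! Suc i) \<and> poly F (-r) = 0"
    by blast
  from choice[OF this] obtain r where
    r: "\<And>i. i < degree F \<Longrightarrow> us ! i < r i \<and> (Suc i < ?m \<longrightarrow> r i < us ! Suc i) \<and> poly F (- r i) = 0"
    by blast
  have mono: "r i < r j" if "i < j" "j < degree F" for i j
  proof -
    have "us ! Suc i \<le> us ! j"
      using le[of "Suc i" j] that deg by simp
    thus ?thesis using r[of i] r[of j] that deg by force
  qed
  let ?ys = "map r [0..<degree F]"
  have srt: "sorted_wrt (<) ?ys"
    unfolding sorted_wrt_iff_nth_less using mono by simp
  show thesis
  proof (rule that[of ?ys])
    show "F = smult (lead_coeff F) (\<Prod>y\<leftarrow>?ys. [:y, 1:])"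
      by (rule split_by_roots) (use r srt strict_sorted_iff in auto)
  qed (use r srt in auto)
qed

text \<open>Interlacing is encoded by the signs of \<open>G\<close> at the zeros of
  \<open>F\<close>, which a determinantal identity can control. As \<open>G\<close> is positive at
  0, the sign at the first zero of \<open>F\<close> already forces a zero of \<open>G\<close> of
  smaller modulus.\<close>

definition interlaced_at :: "real list \<Rightarrow> real poly \<Rightarrow> real poly \<Rightarrow> bool" where
  "interlaced_at xs F G \<longleftrightarrow> sorted_wrt (<) xs \<and> (\<forall>x\<in>set xs. x > 0) \<and>
     F = smult (lead_coeff F) (\<Prod>x\<leftarrow>xs. [:x, 1:]) \<and> degree F = length xs \<and> degree G = length xs \<and>
     (\<forall>t\<ge>0. poly F t > 0 \<and> poly G t > 0) \<and>
     (\<forall>i<length xs. (-1) ^ Suc i * poly G (- (xs ! i)) > 0)"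

text \<open>The inequality \<open>wr\<close> is used twice: at the zeros of \<open>F'\<close> it
  turns the signs of \<open>G'\<close> into signs of \<open>F\<close>, which locates the zeros of
  \<open>F\<close>; at these it turns the signs of \<open>F'\<close> into signs of
  \<open>G\<close>.\<close>

lemma interlaced_at_step:
  fixes F G F' G' :: "real poly" and \<sigma> :: real
  assumes il: "interlaced_at xs F' G'"
    and pos: "\<And>t. t \<ge> 0 \<Longrightarrow> poly F t > 0" "\<And>t. t \<ge> 0 \<Longrightarrow> poly G t > 0"
    and deg: "degree G = degree F" "degree F \<le> length xs + (if \<sigma> = -1 then 1 else 0)"
    and \<sigma>: "\<sigma> = 1 \<or> \<sigma> = -1"
    and wr: "\<And>t. t < 0 \<Longrightarrow> \<sigma> * (poly G t * poly F' t - poly F t * poly G' t) > 0"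
  shows "\<exists>ys. interlaced_at ys F G"
proof -
  note il = il[unfolded interlaced_at_def]
  \<comment> \<open>For \<open>\<sigma> = -1\<close> the sign of \<open>F\<close> at the first zero
    of \<open>F'\<close> is negative, so 0, where \<open>F\<close> is positive, serves as a further
    sample point and makes room for one more zero.\<close>
  define us where "us = (if \<sigma> = -1 then 0 # xs else xs)"
  define e :: nat where "e = (if \<sigma> = -1 then 1 else 0)"
  have e: "\<sigma> = (-1) ^ e" using \<sigma> by (auto simp: e_def)
  have lc: "lead_coeff F > 0" "lead_coeff F' > 0"
    by (rule lead_coeff_pos; use pos(1) il in blast)+
  have srt: "sorted_wrt (<) us" using il by (auto simp: us_def)
  have nonneg: "us ! i \<ge> 0" if "i < length us" for i
  proof -
    have "\<forall>x\<in>set us. x \<ge> 0" using il by (auto simp: us_def intro: less_imp_le)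
    thus ?thesis using that by simp
  qed
  have root: "poly F' (- (xs ! i)) = 0" if "i < length xs" for i
  proof -
    have "xs ! i \<in> set xs" using that by simp
    hence "(\<Prod>x\<leftarrow>xs. - (xs ! i) + x) = 0" by (induction xs) auto
    moreover have "poly F' (- (xs ! i)) = poly (smult (lead_coeff F') (\<Prod>x\<leftarrow>xs. [:x, 1:])) (- (xs ! i))"
      using il by metis
    ultimately show ?thesis by (simp add: poly_prod_linear)
  qed
  have sgnF: "(-1) ^ (i + e) * poly F (- (xs ! i)) > 0" if i: "i < length xs" for i
  proof -
    have "- (xs ! i) < 0" using il i by auto
    from wr[OF this] have 1: "\<sigma> * (- (poly F (- (xs ! i)) * poly G' (- (xs ! i)))) > 0"
      using root[OF i] by simp
    have 2: "(-1) ^ Suc i * poly G' (- (xs ! i)) > 0" using il i by blast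
    have "((-1) ^ (i + e) * poly F (- (xs ! i))) * (((-1) ^ Suc i * poly G' (- (xs ! i))) ^ 2)
        = (\<sigma> * (- (poly F (- (xs ! i)) * poly G' (- (xs ! i))))) * ((-1) ^ Suc i * poly G' (- (xs ! i)))"
    proof -
      have "((-1::real) ^ Suc i) ^ 2 = 1" by (simp flip: power_mult)
      thus ?thesis unfolding e by (simp add: power_add power2_eq_square algebra_simps)
    qed
    also have "\<dots> > 0" using 1 2 by (rule mult_pos_pos)
    finally show ?thesis by (rule zero_less_mult_pos2[OF _ zero_less_power[OF 2]])
  qed
  have alt: "(-1) ^ i * poly F (- (us ! i)) > 0" if "i < length us" for i
  proof (cases "\<sigma> = -1")
    case True
    thus ?thesis using that pos(1)[of 0] sgnF[of "i - 1"]
      by (cases i) (auto simp: us_def e_def)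
  next
    case False
    thus ?thesis using that sgnF[of i] by (auto simp: us_def e_def)
  qed
  have "degree F \<le> length us" using deg by (auto simp: us_def)
  from alternation_roots[OF srt alt this lc(1)] obtain ys where
    ys: "sorted_wrt (<) ys" "length ys = degree F" "F = smult (lead_coeff F) (\<Prod>y\<leftarrow>ys. [:y, 1:])"
      "\<And>i. i < length ys \<Longrightarrow> us ! i < ys ! i"
      "\<And>i. i < length ys \<Longrightarrow> Suc i < length us \<Longrightarrow> ys ! i < us ! Suc i" by blast
  have len: "length ys \<le> length us" using ys(2) \<open>degree F \<le> length us\<close> by simp
  have ypos: "ys ! i > 0" if "i < length ys" for i
    using ys(4)[OF that] nonneg[of i] that len by linarith
  have sgnF': "(-1) ^ (Suc i + e) * poly F' (- (ys ! i)) > 0" if i: "i < length ys" for i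
  proof -
    have iu: "i < length us" using i len by simp
    have lo: "us ! j \<le> us ! i" if "j \<le> i" for j
      using sorted_wrt_nth_less[OF srt, of j i] that iu by (cases "j = i") auto
    have hi: "us ! Suc i \<le> us ! j" if "Suc i \<le> j" "j < length us" for j
      using sorted_wrt_nth_less[OF srt, of "Suc i" j] that by (cases "Suc i = j") auto
    \<comment> \<open>The points of \<open>xs\<close> below \<open>ys ! i\<close> number
      \<open>i + 1\<close>, less one if \<open>us\<close> starts with the additional 0.\<close>
    have 1: "(-1) ^ (Suc i - e) * (\<Prod>x\<leftarrow>xs. - (ys ! i) + x) > 0"
    proof (rule prod_list_sign)
      show "Suc i - e \<le> length xs" using iu by (auto simp: e_def us_def)
      show "xs ! j < ys ! i" if "j < Suc i - e" for j
        using lo[of "j + e"] ys(4)[OF i] that by (auto simp: us_def e_def split: if_splits)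
      show "ys ! i < xs ! j" if "Suc i - e \<le> j" "j < length xs" for j
        using hi[of "j + e"] ys(5)[OF i] that \<sigma> by (auto simp: us_def e_def split: if_splits)
    qed
    have 2: "(-1::real) ^ (Suc i - e) = (-1) ^ (Suc i + e)" by (auto simp: e_def)
    have 3: "poly F' (- (ys ! i)) = lead_coeff F' * (\<Prod>x\<leftarrow>xs. - (ys ! i) + x)"
      using il poly_prod_linear by (metis poly_smult)
    from mult_pos_pos[OF lc(2) 1] show ?thesis unfolding 2 3 by (simp only: mult.left_commute)
  qed
  have sgnG: "(-1) ^ Suc i * poly G (- (ys ! i)) > 0" if i: "i < length ys" for i
  proof -
    have "poly F (- (ys ! i)) = 0"
    proof -
      have "ys ! i \<in> set ys" using i by simp
      hence "(\<Prod>x\<leftarrow>ys. - (ys ! i) + x) = 0" by (induction ys) auto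
      moreover have "poly F (- (ys ! i)) = poly (smult (lead_coeff F) (\<Prod>x\<leftarrow>ys. [:x, 1:])) (- (ys ! i))"
        using ys(3) by metis
      ultimately show ?thesis by (simp add: poly_prod_linear)
    qed
    moreover have "- (ys ! i) < 0" using ypos[OF i] by simp
    ultimately have 1: "\<sigma> * (poly G (- (ys ! i)) * poly F' (- (ys ! i))) > 0"
      using wr[of "- (ys ! i)"] by simp
    have 2: "(-1) ^ (Suc i + e) * poly F' (- (ys ! i)) > 0" using sgnF'[OF i] .
    have "((-1) ^ Suc i * poly G (- (ys ! i))) * (((-1) ^ (Suc i + e) * poly F' (- (ys ! i))) ^ 2)
        = (\<sigma> * (poly G (- (ys ! i)) * poly F' (- (ys ! i)))) * ((-1) ^ (Suc i + e) * poly F' (- (ys ! i)))"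
    proof -
      have s: "((-1::real) ^ e) ^ 2 = 1" "((-1::real) ^ Suc i) ^ 2 = 1"
        by (simp_all flip: power_mult)
      thus ?thesis unfolding e by (simp add: power_add power2_eq_square algebra_simps)
    qed
    also have "\<dots> > 0" using 1 2 by (rule mult_pos_pos)
    finally show ?thesis by (rule zero_less_mult_pos2[OF _ zero_less_power[OF 2]])
  qed
  have "\<forall>x\<in>set ys. x > 0" using ypos by (auto simp: in_set_conv_nth)
  thus ?thesis using ys(1-3) deg(1) pos sgnG unfolding interlaced_at_def by metis
qed

section \<open>Interlacing of the minors of the recurrence\<close>

context two_diagonal
begin

text \<open>Since \<open>j \<le> p\<close>, exactly one multiple of \<open>p + 1\<close> is crossed,
  so the quotient drops by one. This ties the possible growth of the degree to the sign \<sigma> of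
  the interlacing step.\<close>

lemma flip_sign_edge:
  assumes "s + j \<le> n" "j \<le> p" "edge s j = 1"
  shows "flip_sign (s + j) = - flip_sign s"
proof -
  obtain u where u: "s \<le> u" "u < s + j" "u mod (p + 1) = n mod (p + 1)"
    using assms(3) by (auto simp: edge_def split: if_splits)
  have "(p + 1) dvd (n - u)" using u assms(1) by (metis mod_eq_dvd_iff_nat less_imp_le less_le_trans)
  then obtain q where q: "n - u = (p + 1) * q" by blast
  have "q \<noteq> 0" using q u assms by (auto intro!: gr0I)
  then obtain q' where q': "q = Suc q'" by (cases q) auto
  have "n - s = (u - s) + q * (p + 1)" using q u assms by (simp add: mult.commute)
  moreover have "u - s < p + 1" using u assms by simp
  ultimately have 1: "(n - s) div (p + 1) = q" by (intro div_nat_eqI) (auto simp: algebra_simps)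
  define r where "r = p + 1 - (s + j - u)"
  have "n - (s + j) = r + q' * (p + 1)"
    using q u assms q' by (simp add: r_def algebra_simps)
  moreover have "r < p + 1" using u assms by (simp add: r_def)
  ultimately have 2: "(n - (s + j)) div (p + 1) = q'" by (intro div_nat_eqI) (auto simp: algebra_simps)
  show ?thesis using assms(1) unfolding flip_sign_def 1 2 by (simp add: q')
qed

lemma adm_upt: "s + j \<le> n + 1 \<Longrightarrow> j \<le> p + 1 \<Longrightarrow> adm [s..<s+j]"
  by (cases j) (auto simp: adm_def hd_upt simp del: upt_Suc)

text \<open>Downward induction on \<open>s\<close>: near \<open>n\<close> both minors are positive
  constants without zeros; each step to a smaller \<open>s\<close> is
  \<open>interlaced_at_step\<close>, with the columns \<open>d\<close> and \<open>c\<close> for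
  \<open>F\<close> and \<open>G\<close>.\<close>

lemma interlaced_minors:
  assumes k: "k + 1 \<le> p" and s: "s + k \<le> n" and \<theta>: "\<theta> = (-1) ^ k" and C: "length C = k"
    and pb: "pos_base B (c # C)" "pos_base B (d # C)" "pos_base B (c # d # C)" "pos_base B C"
  shows "\<exists>xs. interlaced_at xs (W B \<theta> [s..<s+k+1] (d # C)) (W B \<theta> [s..<s+k+1] (c # C))"
  using s
proof (induction "n - s" arbitrary: s rule: less_induct)
  case less
  define F where "F = (\<lambda>s. W B \<theta> [s..<s+k+1] (d # C))"
  define G where "G = (\<lambda>s. W B \<theta> [s..<s+k+1] (c # C))"
  have \<theta>1: "\<theta> = - ((-1) ^ length (c # C))" "\<theta> = - ((-1) ^ length (d # C))"
    and \<theta>2: "-\<theta> = - ((-1) ^ length (c # d # C))" "-\<theta> = - ((-1) ^ length C)"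
    using \<theta> C by simp_all
  have adm: "adm [s..<s+k+1]" using less.prems k adm_upt[of s "k+1"] by (simp del: upt_Suc)
  have pos: "poly (F s) t > 0" "poly (G s) t > 0" if "t \<ge> 0" for t
    using W_pos[OF adm _ \<theta>1(2) pb(2) that] W_pos[OF adm _ \<theta>1(1) pb(1) that] C
    by (simp_all add: F_def G_def del: upt_Suc)
  show ?case unfolding F_def[symmetric, THEN fun_cong] G_def[symmetric, THEN fun_cong]
  proof (cases "n < s + p")
    case True
    have "\<forall>x\<in>set [s..<s+k+1]. n < x + p" using True by auto
    then obtain x y where xy: "F s = [:x:]" "G s = [:y:]"
      using W_const[of "[s..<s+k+1]" "d # C" B \<theta>] W_const[of "[s..<s+k+1]" "c # C" B \<theta>] C
      by (auto simp: F_def G_def simp del: upt_Suc)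
    hence "interlaced_at [] (F s) (G s)"
      using pos pos_le_divide_eq by (auto simp: interlaced_at_def)
    thus "\<exists>xs. interlaced_at xs (F s) (G s)" ..
  next
    case False
    have "n - (s + 1) < n - s" "s + 1 + k \<le> n" using False k by auto
    from less.hyps[OF this] obtain xs where xs: "interlaced_at xs (F (s + 1)) (G (s + 1))"
      by (auto simp: F_def G_def simp del: upt_Suc)
    have sk: "s + k + 1 \<le> n" using False k by simp
    \<comment> \<open>The sign of the Desnanot-Jacobi product for \<open>t < 0\<close>: the common
      rows contribute their signs twice, leaving those of the first row \<open>s\<close> and the new
      last row \<open>s + k + 1\<close>.\<close>
    define \<sigma> where "\<sigma> = flip_sign s * flip_sign (s + k + 1)"
    have \<sigma>: "\<sigma> = 1 \<or> \<sigma> = -1"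
      using flip_sign_cases[of s] flip_sign_cases[of "s+k+1"] by (auto simp: \<sigma>_def)
    show "\<exists>xs. interlaced_at xs (F s) (G s)"
    proof (rule interlaced_at_step[OF xs pos _ _ \<sigma>])
      show "degree (G s) = degree (F s)"
      proof (rule antisym)
        have "dominated 0 (G s) (F s)"
          unfolding F_def G_def using adm C \<theta>1 pb
          by (intro W_comparable) (auto simp del: upt_Suc)
        thus "degree (G s) \<le> degree (F s)" using dominated_degree[of 0] pos by force
        have "dominated 0 (F s) (G s)"
          unfolding F_def G_def using adm C \<theta>1 pb
          by (intro W_comparable) (auto simp del: upt_Suc)
        thus "degree (F s) \<le> degree (G s)" using dominated_degree[of 0] pos by force
      qed
      have "dominated (edge s (k+1)) (W B \<theta> ([] @ [s..<s+(k+1)] @ []) (d # C)) (W B \<theta> ([] @ [s+1..<s+(k+1)+1] @ []) (d # C))"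
        by (rule block_dominated)
           (use adm_upt[of s "k+2"] sk k C \<theta>1 pb in \<open>auto simp del: upt_Suc\<close>)
      hence "dominated (edge s (k+1)) (F s) (F (s + 1))" by (simp add: F_def add.assoc del: upt_Suc)
      hence "degree (F s) \<le> degree (F (s + 1)) + edge s (k+1)"
        by (rule dominated_degree) (use pos in simp)
      moreover have "edge s (k+1) \<le> (if \<sigma> = -1 then 1 else 0)"
      proof (cases "edge s (k+1) = 1")
        case True
        hence "flip_sign (s + (k + 1)) = - flip_sign s" using flip_sign_edge[of s "k+1"] sk k by simp
        hence "\<sigma> = -1" using flip_sign_cases[of s] by (auto simp: \<sigma>_def add.assoc)
        thus ?thesis using True by simp
      next
        case False
        hence "edge s (k+1) = 0" unfolding edge_def by (metis (full_types))
        thus ?thesis by simp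
      qed
      ultimately show "degree (F s) \<le> length xs + (if \<sigma> = -1 then 1 else 0)"
        using xs by (simp add: interlaced_at_def)
    next
      fix t :: real assume t: "t < 0"
      define f where "f = (\<lambda>r c. poly (row B \<theta> r c) t)"
      define R where "R = [s+1..<s+k+1]"
      have R1: "[s..<s+k+1] = s # R" "[s+1..<s+1+k+1] = R @ [s+k+1]"
        and R2: "[s..<s+(k+2)] = s # R @ [s+k+1]"
        by (simp_all add: R_def upt_conv_Cons)
      have ev: "poly (F s) t = minor f (s # R) (d # C)" "poly (G s) t = minor f (s # R) (c # C)"
        "poly (F (s+1)) t = minor f (R @ [s+k+1]) (d # C)" "poly (G (s+1)) t = minor f (R @ [s+k+1]) (c # C)"
        unfolding F_def G_def R1 poly_minor f_def by simp_all
      \<comment> \<open>The minors of sizes \<open>k + 2\<close> and \<open>k\<close> on the right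
        of the identity; both sizes fit \<open>-\<theta>\<close>, so they are evaluated through
        \<open>W_flip\<close> at \<open>-t > 0\<close>.\<close>
      define X where "X = minor f (s # R @ [s+k+1]) (c # d # C)"
      define Y where "Y = minor f R C"
      have lens: "length R = k" by (simp add: R_def)
      have aR2: "adm (s # R @ [s+k+1])" unfolding R2[symmetric] by (rule adm_upt) (use sk k in auto)
      have aR: "adm R" using adm_upt[of "s+1" k] sk k by (simp add: R_def del: upt_Suc)
      have X: "X = prod_list (map flip_sign (s # R @ [s+k+1])) * poly (W B (-\<theta>) (s # R @ [s+k+1]) (c # d # C)) (-t)"
        unfolding X_def f_def poly_minor[symmetric] by (rule W_flip) (simp add: C lens)
      have Y: "Y = prod_list (map flip_sign R) * poly (W B (-\<theta>) R C) (-t)"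
        unfolding Y_def f_def poly_minor[symmetric] by (rule W_flip) (simp add: C lens)
      have Xp: "poly (W B (-\<theta>) (s # R @ [s+k+1]) (c # d # C)) (-t) > 0"
        by (rule W_pos[OF aR2 _ \<theta>2(1) pb(3)]) (use C lens t in auto)
      have Yp: "poly (W B (-\<theta>) R C) (-t) > 0"
        by (rule W_pos[OF aR _ \<theta>2(2) pb(4)]) (use C lens t in auto)
      define \<pi> where "\<pi> = prod_list (map flip_sign R)"
      have "\<pi> = 1 \<or> \<pi> = -1" unfolding \<pi>_def
      proof (induction R)
        case (Cons x R)
        thus ?case using flip_sign_cases[of x] by auto
      qed simp
      hence pp: "\<pi> * \<pi> = 1" by auto
      have ss: "\<sigma> * \<sigma> = 1" using \<sigma> by auto
      have "\<pi> \<noteq> 0" "\<sigma> \<noteq> 0" using pp ss by auto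
      moreover have "X = \<sigma> * \<pi> * poly (W B (-\<theta>) (s # R @ [s+k+1]) (c # d # C)) (-t)"
        unfolding X by (simp add: \<sigma>_def \<pi>_def mult_ac)
      ultimately have "X \<noteq> 0" using Xp by simp
      hence dj: "poly (G s) t * poly (F (s+1)) t - poly (F s) t * poly (G (s+1)) t = X * Y"
        unfolding ev X_def Y_def by (intro desnanot_jacobi) (simp_all add: C lens)
      have "X * Y = (\<sigma> * (\<pi> * \<pi>)) * (poly (W B (-\<theta>) (s # R @ [s+k+1]) (c # d # C)) (-t) * poly (W B (-\<theta>) R C) (-t))"
        unfolding X Y by (simp add: \<sigma>_def \<pi>_def mult_ac)
      hence "\<sigma> * (X * Y) = (\<sigma> * \<sigma>) * (poly (W B (-\<theta>) (s # R @ [s+k+1]) (c # d # C)) (-t) * poly (W B (-\<theta>) R C) (-t))"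
        by (simp only: pp mult_1_right mult.assoc)
      also have "\<dots> > 0" using Xp Yp by (simp only: ss) simp
      finally show "\<sigma> * (poly (G s) t * poly (F (s+1)) t - poly (F s) t * poly (G (s+1)) t) > 0"
        unfolding dj .
    qed
  qed
qed

end

subsection \<open>Totally positive initial rows and the limit\<close>

lemma minor_scale_cols:
  assumes "length C = length R" "\<And>r c. r \<in> set R \<Longrightarrow> c \<in> set C \<Longrightarrow> f r c = v c * g r c"
  shows "minor f R C = prod_list (map v C) * minor g R C"
  using assms
proof (induction R arbitrary: C)
  case (Cons x R)
  show ?case
    unfolding minor_Cons[OF Cons.prems(1)[simplified]] sum_distrib_left
  proof (intro sum.cong refl)
    fix j assume "j \<in> {..<Suc (length R)}"
    hence j: "j < length C" using Cons.prems by simp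
    have s: "set (take j C @ drop (Suc j) C) \<subseteq> set C"
      by (auto dest: in_set_takeD in_set_dropD)
    have "minor f R (take j C @ drop (Suc j) C)
        = prod_list (map v (take j C @ drop (Suc j) C)) * minor g R (take j C @ drop (Suc j) C)"
      using Cons.prems j s by (intro Cons.IH) auto
    moreover have "f x (C ! j) = v (C ! j) * g x (C ! j)" using Cons.prems j by auto
    moreover have "prod_list (map v C) = v (C ! j) * prod_list (map v (take j C @ drop (Suc j) C))"
      by (subst (1) id_take_nth_drop[OF j]) (simp add: mult_ac)
    ultimately show "(-1) ^ j * f x (C ! j) * minor f R (take j C @ drop (Suc j) C) =
      prod_list (map v C) * ((-1) ^ j * g x (C ! j) * minor g R (take j C @ drop (Suc j) C))"
      by (simp add: algebra_simps)
  qed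
qed simp

lemma minor_tendsto:
  fixes f :: "'m \<Rightarrow> nat \<Rightarrow> 'b \<Rightarrow> real"
  assumes "length C = length R" "\<And>r c. ((\<lambda>m. f m r c) \<longlongrightarrow> g r c) A"
  shows "((\<lambda>m. minor (f m) R C) \<longlongrightarrow> minor g R C) A"
  using assms(1)
proof (induction R arbitrary: C)
  case (Cons x R)
  show ?case unfolding minor_Cons[OF Cons.prems[simplified]]
    by (intro tendsto_sum tendsto_mult tendsto_const assms(2) Cons.IH) (use Cons.prems in auto)
qed simp

text \<open>The exponent of \<open>q\<close> in the diagonal product of the generalized Vandermonde
  matrix with entries \<open>q ^ (r * c)\<close>.\<close>

definition dot :: "nat list \<Rightarrow> nat list \<Rightarrow> nat" where
  "dot R C = (\<Sum>i<length R. R ! i * C ! i)"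

text \<open>A rearrangement inequality. If the smallest row \<open>x\<close> is paired with
  \<open>C ! j\<close> and the others stay in order, passing from \<open>j\<close> to
  \<open>j + 1\<close> exchanges the partners of \<open>x\<close> and \<open>R ! j\<close>, which
  lowers the sum.\<close>

lemma dot_delete_less:
  assumes R: "sorted_wrt (<) (x # R)" and C: "sorted_wrt (<) C" "length C = Suc (length R)"
    and j: "0 < j" "j \<le> length R"
  shows "x * C ! j + dot R (take j C @ drop (Suc j) C) < dot (x # R) C"
proof -
  define h where "h = (\<lambda>j. x * C ! j + (\<Sum>i<length R. R ! i * (if i < j then C ! i else C ! Suc i)))"
  have h: "x * C ! j + dot R (take j C @ drop (Suc j) C) = h j" if "j \<le> length R" for j
    unfolding h_def dot_def using that C(2) by (auto simp: nth_delete intro!: sum.cong)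
  have step: "h (Suc j) < h j" if j: "j < length R" for j
  proof -
    let ?S = "{..<length R} - {j}"
    have split: "(\<Sum>i<length R. R ! i * (if i < j' then C ! i else C ! Suc i))
       = R ! j * (if j < j' then C ! j else C ! Suc j) + (\<Sum>i\<in>?S. R ! i * (if i < j' then C ! i else C ! Suc i))" for j'
      using j by (subst sum.remove[of _ j]) auto
    have same: "(\<Sum>i\<in>?S. R ! i * (if i < Suc j then C ! i else C ! Suc i)) = (\<Sum>i\<in>?S. R ! i * (if i < j then C ! i else C ! Suc i))"
      by (intro sum.cong) auto
    have "x < R ! j" using R j by simp
    moreover have "C ! j < C ! Suc j" using sorted_wrt_nth_less[OF C(1), of j "Suc j"] C(2) j by simp
    ultimately have "x * C ! Suc j + R ! j * C ! j < x * C ! j + R ! j * C ! Suc j"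
    proof -
      obtain u v where u: "R ! j = x + Suc u" "C ! Suc j = C ! j + Suc v"
        using \<open>x < R ! j\<close> \<open>C ! j < C ! Suc j\<close> by (metis add_Suc_right less_imp_Suc_add)
      show ?thesis unfolding u by (simp add: algebra_simps)
    qed
    thus ?thesis unfolding h_def split same by simp
  qed
  have "h j < h 0" if "0 < j" "j \<le> length R" for j
    using that
  proof (induction j)
    case (Suc j)
    thus ?case using step[of j] by (cases "j = 0") (auto simp: Suc_le_eq)
  qed simp
  moreover have "h 0 = dot (x # R) C"
    by (simp add: h_def dot_def lessThan_Suc_eq_insert_0 sum.reindex comp_def)
  ultimately show ?thesis using j h by simp
qed

text \<open>In the expansion along the first row the term \<open>j = 0\<close> has the largest
  exponent and the others are negligible for large \<open>q\<close>; induction handles the smaller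
  minors.\<close>

lemma generalized_vandermonde_asymp:
  assumes "sorted_wrt (<) R" "sorted_wrt (<) C" "length C = length R"
  shows "((\<lambda>q :: real. minor (\<lambda>r c. q ^ (r * c)) R C / q ^ dot R C) \<longlongrightarrow> 1) at_top"
  using assms
proof (induction R arbitrary: C)
  case Nil
  thus ?case by (simp add: dot_def)
next
  case (Cons x R)
  let ?C = "\<lambda>j. take j C @ drop (Suc j) C"
  let ?e = "\<lambda>j. x * C ! j + dot R (?C j)"
  let ?D = "dot (x # R) C"
  have lt: "?e j < ?D" if "0 < j" "j < Suc (length R)" for j
    using dot_delete_less[of x R C j] Cons.prems that by simp
  have e0: "?e 0 = ?D"
    using Cons.prems(3) by (cases C) (simp_all add: dot_def lessThan_Suc_eq_insert_0 sum.reindex comp_def)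
  have IH: "((\<lambda>q :: real. minor (\<lambda>r c. q ^ (r * c)) R (?C j) / q ^ dot R (?C j)) \<longlongrightarrow> 1) at_top"
    if "j < Suc (length R)" for j
  proof (rule Cons.IH)
    show "sorted_wrt (<) (?C j)"
    proof -
      have "sorted_wrt (<) (take j C @ drop j C)" using Cons.prems(2) by simp
      moreover have "set (drop (Suc j) C) \<subseteq> set (drop j C)" by (rule set_drop_subset_set_drop) simp
      ultimately show ?thesis
        using sorted_wrt_drop[OF Cons.prems(2), of "Suc j"] unfolding sorted_wrt_append by blast
    qed
  qed (use Cons.prems that in auto)
  have pow: "((\<lambda>q :: real. q ^ ?e j / q ^ ?D) \<longlongrightarrow> (if j = 0 then 1 else 0)) at_top" if j: "j < Suc (length R)" for j
  proof (cases "j = 0")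
    case True
    have "eventually (\<lambda>q :: real. q ^ ?e j / q ^ ?D = 1) at_top"
      using eventually_gt_at_top[of 0] by eventually_elim (simp add: True e0[simplified])
    thus ?thesis using True by (simp add: tendsto_eventually)
  next
    case False
    define i where "i = ?D - ?e j"
    have i: "?D = ?e j + i" "i > 0" using lt[of j] False j by (auto simp: i_def)
    have "((\<lambda>q :: real. inverse (q ^ i)) \<longlongrightarrow> 0) at_top"
      using i(2) by (intro tendsto_inverse_0_at_top filterlim_pow_at_top filterlim_ident) auto
    moreover have "eventually (\<lambda>q :: real. inverse (q ^ i) = q ^ ?e j / q ^ ?D) at_top"
      using eventually_gt_at_top[of 0] by eventually_elim (simp add: i(1) power_add field_simps)
    ultimately show ?thesis using False by (simp add: tendsto_cong)
  qed
  have "((\<lambda>q :: real. \<Sum>j<Suc (length R). (-1) ^ j * (q ^ ?e j / q ^ ?D) *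
      (minor (\<lambda>r c. q ^ (r * c)) R (?C j) / q ^ dot R (?C j)))
      \<longlongrightarrow> (\<Sum>j<Suc (length R). (-1) ^ j * (if j = 0 then 1 else 0) * 1)) at_top"
    by (intro tendsto_sum tendsto_mult tendsto_const pow IH) auto
  also have "(\<Sum>j<Suc (length R). (-1) ^ j * (if j = 0 then 1 else 0) * 1) = (1 :: real)"
    by (simp add: lessThan_Suc_eq_insert_0 sum.reindex)
  finally show ?case
  proof (rule Lim_transform_eventually)
    show "eventually (\<lambda>q :: real. (\<Sum>j<Suc (length R). (-1) ^ j * (q ^ ?e j / q ^ ?D) *
      (minor (\<lambda>r c. q ^ (r * c)) R (?C j) / q ^ dot R (?C j)))
      = minor (\<lambda>r c. q ^ (r * c)) (x # R) C / q ^ ?D) at_top"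
      using eventually_gt_at_top[of 0]
    proof eventually_elim
      fix q :: real assume "q > 0"
      show "(\<Sum>j<Suc (length R). (-1) ^ j * (q ^ ?e j / q ^ ?D) *
          (minor (\<lambda>r c. q ^ (r * c)) R (?C j) / q ^ dot R (?C j)))
        = minor (\<lambda>r c. q ^ (r * c)) (x # R) C / q ^ ?D"
        unfolding minor_Cons[OF Cons.prems(3)[simplified]] sum_divide_distrib
        using \<open>q > 0\<close> by (intro sum.cong refl) (simp add: power_add)
    qed
  qed
qed

context two_diagonal
begin

text \<open>Apart from the factor \<open>1 / a\<close>, the entry is \<open>y\<close> to the power \<open>- (d - c)\<^sup>2\<close>; written as below it is
  visibly a generalized Vandermonde matrix in \<open>y\<^sup>2\<close> up to row and column scalings.\<close>

definition base :: "real \<Rightarrow> nat \<Rightarrow> nat \<Rightarrow> real" where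
  "base y d c = (y\<^sup>2) ^ (d * c) / (y ^ (d * d) * y ^ (c * c)) / a (n + d - p)"

text \<open>The entry \<open>1 / a\<close> inverts the coefficient met when row
  \<open>n + d - p\<close> jumps to the initial row \<open>n + d + 1\<close>, so the diagonal matrix
  yields unit entries up to \<theta>. Truncated subtraction only substitutes index 0, where
  \<open>a\<close> is positive as well.\<close>

definition base_lim :: "nat \<Rightarrow> nat \<Rightarrow> real" where
  "base_lim d c = (if d = c then 1 / a (n + d - p) else 0)"

lemma base_tendsto: "((\<lambda>y. base y d c) \<longlongrightarrow> base_lim d c) at_top"
proof -
  \<comment> \<open>With truncated subtraction at least one of the two products is 0, so the
    exponent is the square of the distance of \<open>d\<close> and \<open>c\<close>.\<close>
  have "eventually (\<lambda>y. base y d c = inverse (y ^ ((d - c) * (d - c) + (c - d) * (c - d))) / a (n + d - p)) at_top"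
    using eventually_gt_at_top[of 0]
  proof eventually_elim
    fix y :: real assume y: "y > 0"
    have "d * d + c * c = 2 * (d * c) + ((d - c) * (d - c) + (c - d) * (c - d))"
    proof (cases "d \<le> c")
      case True
      then obtain e where "c = d + e" by (metis le_iff_add)
      thus ?thesis by (simp add: algebra_simps)
    next
      case False
      then obtain e where "d = c + e" by (metis le_iff_add linear)
      thus ?thesis by (simp add: algebra_simps)
    qed
    hence "y ^ (d * d) * y ^ (c * c) = (y\<^sup>2) ^ (d * c) * y ^ ((d - c) * (d - c) + (c - d) * (c - d))"
      by (metis power_add power_mult)
    thus "base y d c = inverse (y ^ ((d - c) * (d - c) + (c - d) * (c - d))) / a (n + d - p)"
      using y by (simp add: base_def field_simps)
  qed
  moreover have "((\<lambda>y :: real. inverse (y ^ ((d - c) * (d - c) + (c - d) * (c - d))) / a (n + d - p)) \<longlongrightarrow> base_lim d c) at_top"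
  proof (cases "d = c")
    case False
    hence "(d - c) * (d - c) + (c - d) * (c - d) > 0" by auto
    hence "((\<lambda>y :: real. inverse (y ^ ((d - c) * (d - c) + (c - d) * (c - d))) / a (n + d - p)) \<longlongrightarrow> 0 / a (n + d - p)) at_top"
      using a_pos[of "n + d - p"]
      by (intro tendsto_divide tendsto_inverse_0_at_top filterlim_pow_at_top filterlim_ident tendsto_const) auto
    thus ?thesis using False by (simp add: base_lim_def)
  qed (simp add: base_lim_def)
  ultimately show ?thesis by (simp add: tendsto_cong)
qed

text \<open>Positive row and column scalings reduce each minor to a generalized Vandermonde minor in
  \<open>q = y^2\<close>, positive for large \<open>q\<close>; there are finitely many row lists, so
  one threshold serves all.\<close>

lemma eventually_pos_base:
  assumes "sorted_wrt (<) C"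
  shows "eventually (\<lambda>y. pos_base (base y) C) at_top"
proof -
  let ?RS = "{R. sorted_wrt (<) R \<and> set R \<subseteq> {..p} \<and> length R = length C}"
  have "finite ?RS"
    by (rule finite_subset[OF _ finite_lists_length_eq[of "{..p}" "length C"]]) auto
  moreover have "eventually (\<lambda>y. minor (base y) R C > 0) at_top" if R: "R \<in> ?RS" for R
  proof -
    have "((\<lambda>q :: real. minor (\<lambda>r c. q ^ (r * c)) R C / q ^ dot R C) \<longlongrightarrow> 1) at_top"
      using R assms by (intro generalized_vandermonde_asymp) auto
    hence "eventually (\<lambda>q :: real. minor (\<lambda>r c. q ^ (r * c)) R C / q ^ dot R C > 0) at_top"
      by (rule order_tendstoD) simp
    moreover have "filterlim (\<lambda>y :: real. y\<^sup>2) at_top at_top"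
      by (intro filterlim_pow_at_top filterlim_ident) simp
    ultimately have "eventually (\<lambda>y :: real. minor (\<lambda>r c. (y\<^sup>2) ^ (r * c)) R C / (y\<^sup>2) ^ dot R C > 0) at_top"
      by (rule eventually_compose_filterlim)
    thus ?thesis using eventually_gt_at_top[of 0]
    proof eventually_elim
      fix y :: real assume y: "minor (\<lambda>r c. (y\<^sup>2) ^ (r * c)) R C / (y\<^sup>2) ^ dot R C > 0" "y > 0"
      hence "minor (\<lambda>r c. (y\<^sup>2) ^ (r * c)) R C > 0" by (simp add: zero_less_divide_iff)
      moreover have "minor (base y) R C = prod_list (map (\<lambda>d. 1 / (y ^ (d * d) * a (n + d - p))) R)
          * minor (\<lambda>d c. (y\<^sup>2) ^ (d * c) / y ^ (c * c)) R C"
        by (rule minor_scale_rows) (use R in \<open>auto simp: base_def\<close>)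
      moreover have "minor (\<lambda>d c. (y\<^sup>2) ^ (d * c) / y ^ (c * c)) R C
          = prod_list (map (\<lambda>c. 1 / y ^ (c * c)) C) * minor (\<lambda>d c. (y\<^sup>2) ^ (d * c)) R C"
        by (rule minor_scale_cols) (use R in auto)
      moreover have "prod_list (map h X) > 0" if "\<And>x. h x > 0" for h :: "nat \<Rightarrow> real" and X
        using that by (induction X) auto
      ultimately show "minor (base y) R C > 0" using y(2) a_pos by simp
    qed
  qed
  ultimately have "eventually (\<lambda>y. \<forall>R\<in>?RS. minor (base y) R C > 0) at_top"
    by (intro eventually_ball_finite ballI)
  thus ?thesis by eventually_elim (auto simp: pos_base_def)
qed

lemma row_tendsto:
  assumes "\<And>d c. ((\<lambda>y. B y d c) \<longlongrightarrow> B' d c) A"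
  shows "((\<lambda>y. poly (row (B y) \<theta> s c) t) \<longlongrightarrow> poly (row B' \<theta> s c) t) A"
proof (induction "Suc n - s" arbitrary: s rule: less_induct)
  case less
  show ?case
  proof (cases "n < s")
    case True
    thus ?thesis using assms by (simp add: row_base)
  next
    case False
    have "((\<lambda>y. poly (walk s) t * poly (row (B y) \<theta> (Suc s) c) t + \<theta> * a s * poly (row (B y) \<theta> (s + p + 1) c) t)
        \<longlongrightarrow> poly (walk s) t * poly (row B' \<theta> (Suc s) c) t + \<theta> * a s * poly (row B' \<theta> (s + p + 1) c) t) A"
      using False by (intro tendsto_add tendsto_mult tendsto_const less.hyps) auto
    thus ?thesis using False by (simp add: row_step)
  qed
qed

end

text \<open>The factor \<open>1 - \<alpha> + \<alpha> t\<close> with \<open>\<alpha> \<in> [0, 1]\<close> stands for the zero \<open>t = -(1 - \<alpha>) / \<alpha>\<close>, and for a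
  zero at infinity if \<open>\<alpha> = 0\<close>. In these coordinates the condition is stable under limits.\<close>

definition weakly_interlaced :: "nat \<Rightarrow> real poly \<Rightarrow> real poly \<Rightarrow> bool" where
  "weakly_interlaced N F G \<longleftrightarrow> (\<exists>\<alpha> \<gamma>. (\<forall>i<N. 0 \<le> \<alpha> i \<and> \<alpha> i \<le> \<gamma> i \<and> \<gamma> i \<le> 1) \<and>
     (\<forall>i. Suc i < N \<longrightarrow> \<gamma> (Suc i) \<le> \<alpha> i) \<and>
     (\<forall>t. poly F t = poly F 1 * (\<Prod>i<N. 1 - \<alpha> i + \<alpha> i * t)) \<and>
     (\<forall>t. poly G t = poly G 1 * (\<Prod>i<N. 1 - \<gamma> i + \<gamma> i * t)))"

text \<open>A factor \<open>t + x\<close> is \<open>(1 + x) * (1 - \<alpha> + \<alpha> * t)\<close>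
  with \<open>\<alpha> = 1 / (1 + x)\<close>. The normalised factors are 1 at \<open>t = 1\<close>,
  so the constant is \<open>poly F 1\<close>; indices beyond the degree carry
  \<open>\<alpha> = 0\<close>.\<close>

lemma poly_normal_form:
  fixes F :: "real poly"
  assumes F: "F = smult c (\<Prod>x\<leftarrow>xs. [:x, 1:])" and pos: "\<And>i. i < length xs \<Longrightarrow> xs ! i > 0"
    and N: "length xs \<le> N" and \<alpha>: "\<And>i. \<alpha> i = (if i < length xs then 1 / (1 + xs ! i) else 0)"
  shows "poly F t = poly F 1 * (\<Prod>i<N. 1 - \<alpha> i + \<alpha> i * t)"
proof -
  have "(\<Prod>x\<leftarrow>xs. t + x) = (\<Prod>i<length xs. t + xs ! i)" for t
    by (simp add: prod.list_conv_set_nth lessThan_atLeast0)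
  hence F': "poly F t = c * (\<Prod>i<length xs. t + xs ! i)" for t
    unfolding F poly_smult poly_prod_linear by simp
  have "(\<Prod>i<N. 1 - \<alpha> i + \<alpha> i * t) = (\<Prod>i<length xs. 1 - \<alpha> i + \<alpha> i * t)"
    using N by (intro prod.mono_neutral_right) (auto simp: \<alpha>)
  also have "(\<Prod>i<length xs. 1 + xs ! i) * \<dots> = (\<Prod>i<length xs. t + xs ! i)"
    unfolding prod.distrib[symmetric]
  proof (intro prod.cong refl)
    fix i assume "i \<in> {..<length xs}"
    hence i: "i < length xs" "1 + xs ! i \<noteq> 0" using pos[of i] by auto
    define x where "x = xs ! i"
    have "(1 + x) * (1 - 1 / (1 + x) + 1 / (1 + x) * t) = t + x"
      using i(2) unfolding x_def[symmetric] by (simp add: divide_simps)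
    thus "(1 + xs ! i) * (1 - \<alpha> i + \<alpha> i * t) = t + xs ! i"
      using i(1) by (simp add: \<alpha> x_def)
  qed
  finally show ?thesis by (simp add: F' mult.assoc)
qed

text \<open>Sampling \<open>G\<close> at 0 and at the zeros of \<open>F\<close> locates the zeros of
  \<open>G\<close> between these points; \<open>1 / (1 + x)\<close> then reverses the order.\<close>

lemma interlaced_at_imp_weakly:
  assumes il: "interlaced_at xs F G" and N: "length xs \<le> N"
  shows "weakly_interlaced N F G"
proof -
  note il = il[unfolded interlaced_at_def]
  have srt: "sorted_wrt (<) (0 # xs)" using il by auto
  have alt: "(-1) ^ i * poly G (- ((0 # xs) ! i)) > 0" if "i < length (0 # xs)" for i
    using il that by (cases i) auto
  have lcG: "lead_coeff G > 0" by (rule lead_coeff_pos) (use il in blast)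
  have dG: "degree G \<le> length (0 # xs)" using il by simp
  obtain ys where ys: "sorted_wrt (<) ys" "length ys = degree G"
    "G = smult (lead_coeff G) (\<Prod>y\<leftarrow>ys. [:y, 1:])"
    "\<And>i. i < length ys \<Longrightarrow> (0 # xs) ! i < ys ! i"
    "\<And>i. i < length ys \<Longrightarrow> Suc i < length (0 # xs) \<Longrightarrow> ys ! i < (0 # xs) ! Suc i"
    using alternation_roots[OF srt alt dG lcG] by blast
  have len: "length ys = length xs" using ys(2) il by simp
  have yx: "ys ! i < xs ! i" if "i < length xs" for i using ys(5)[of i] that len by simp
  have xy: "xs ! i < ys ! Suc i" if "Suc i < length xs" for i using ys(4)[of "Suc i"] that len by simp
  have xpos: "xs ! i > 0" if "i < length xs" for i using il that by simp
  have ypos: "ys ! i > 0" if "i < length ys" for i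
    using ys(4)[OF that] xpos[of "i - 1"] that len by (cases i) auto
  define \<alpha> where "\<alpha> = (\<lambda>i. if i < length xs then 1 / (1 + xs ! i) else 0)"
  define \<gamma> where "\<gamma> = (\<lambda>i. if i < length ys then 1 / (1 + ys ! i) else 0)"
  have "0 \<le> \<alpha> i \<and> \<alpha> i \<le> \<gamma> i \<and> \<gamma> i \<le> 1" for i
    using xpos[of i] ypos[of i] yx[of i] len by (auto simp: \<alpha>_def \<gamma>_def intro!: divide_left_mono mult_pos_pos)
  moreover have "\<gamma> (Suc i) \<le> \<alpha> i" for i
  proof (cases "Suc i < length xs")
    case True
    thus ?thesis using xpos[of i] ypos[of "Suc i"] xy[of i] len
      by (auto simp: \<alpha>_def \<gamma>_def intro!: divide_left_mono mult_pos_pos)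
  next
    case False
    thus ?thesis using xpos[of i] len by (auto simp: \<alpha>_def \<gamma>_def)
  qed
  moreover have "poly F t = poly F 1 * (\<Prod>i<N. 1 - \<alpha> i + \<alpha> i * t)" for t
    by (rule poly_normal_form) (use il xpos N in \<open>auto simp: \<alpha>_def\<close>)
  moreover have "poly G t = poly G 1 * (\<Prod>i<N. 1 - \<gamma> i + \<gamma> i * t)" for t
    by (rule poly_normal_form[OF ys(3)]) (use ypos N len in \<open>auto simp: \<gamma>_def\<close>)
  ultimately show ?thesis unfolding weakly_interlaced_def by blast
qed

lemma bounded_convergent_subsequence:
  fixes f :: "nat \<Rightarrow> nat \<Rightarrow> real"
  assumes "\<And>m i. i < N \<Longrightarrow> 0 \<le> f m i \<and> f m i \<le> 1"
  shows "\<exists>r. strict_mono (r :: nat \<Rightarrow> nat) \<and> (\<forall>i<N. convergent (\<lambda>m. f (r m) i))"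
  using assms
proof (induction N)
  case 0
  show ?case by (intro exI[of _ id]) (auto simp: strict_mono_def)
next
  case (Suc N)
  obtain r where r: "strict_mono (r :: nat \<Rightarrow> nat)" "\<And>i. i < N \<Longrightarrow> convergent (\<lambda>m. f (r m) i)"
    using Suc.IH Suc.prems by (metis less_SucI)
  obtain r' where r': "strict_mono (r' :: nat \<Rightarrow> nat)" "monoseq (\<lambda>m. f (r (r' m)) N)"
    using seq_monosub[of "\<lambda>m. f (r m) N"] by auto
  have "Bseq (\<lambda>m. f (r (r' m)) N)"
    by (rule BseqI'[of _ 1]) (use Suc.prems[of N] in auto)
  hence N: "convergent (\<lambda>m. f (r (r' m)) N)" using r'(2) by (rule Bseq_monoseq_convergent)
  have "convergent (\<lambda>m. f (r (r' m)) i)" if "i < N" for i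
    using convergent_subseq_convergent[OF r(2)[OF that] r'(1)] by (simp add: comp_def)
  hence "\<forall>i<Suc N. convergent (\<lambda>m. f (r (r' m)) i)" using N by (auto simp: less_Suc_eq)
  moreover have "strict_mono (\<lambda>m. r (r' m))" using r(1) r'(1) by (auto simp: strict_mono_def)
  ultimately show ?case by (intro exI[of _ "\<lambda>m. r (r' m)"]) auto
qed

text \<open>The parameters lie in the compact interval \<open>[0, 1]\<close> and all conditions are
  closed, so a convergent subsequence suffices. The number \<open>N\<close> of factors has to be the
  same for all \<open>m\<close>.\<close>

lemma weakly_interlaced_limit:
  fixes F :: "real poly" and f g :: "nat \<Rightarrow> real poly"
  assumes il: "\<And>m. weakly_interlaced N (f m) (g m)"
    and lim: "\<And>t. (\<lambda>m. poly (f m) t) \<longlonglongrightarrow> poly F t" "\<And>t. (\<lambda>m. poly (g m) t) \<longlonglongrightarrow> poly G t"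
  shows "weakly_interlaced N F G"
proof -
  define P where "P = (\<lambda>m (\<alpha> :: nat \<Rightarrow> real) \<gamma>. (\<forall>i<N. 0 \<le> \<alpha> i \<and> \<alpha> i \<le> \<gamma> i \<and> \<gamma> i \<le> 1) \<and>
     (\<forall>i. Suc i < N \<longrightarrow> \<gamma> (Suc i) \<le> \<alpha> i) \<and>
     (\<forall>t. poly (f m) t = poly (f m) 1 * (\<Prod>i<N. 1 - \<alpha> i + \<alpha> i * t)) \<and>
     (\<forall>t. poly (g m) t = poly (g m) 1 * (\<Prod>i<N. 1 - \<gamma> i + \<gamma> i * t)))"
  have "\<forall>m. \<exists>\<alpha> \<gamma>. P m \<alpha> \<gamma>"
    using il unfolding P_def weakly_interlaced_def by blast
  then obtain \<alpha> \<gamma> where P: "\<And>m. P m (\<alpha> m) (\<gamma> m)" by metis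
  have ag: "0 \<le> \<alpha> m i \<and> \<alpha> m i \<le> \<gamma> m i \<and> \<gamma> m i \<le> 1" if "i < N" for m i
    using P[of m] that unfolding P_def by blast
  have ag2: "\<gamma> m (Suc i) \<le> \<alpha> m i" if "Suc i < N" for m i
    using P[of m] that unfolding P_def by blast
  have agf: "poly (f m) t = poly (f m) 1 * (\<Prod>i<N. 1 - \<alpha> m i + \<alpha> m i * t)" for m t
    using P[of m] unfolding P_def by blast
  have agg: "poly (g m) t = poly (g m) 1 * (\<Prod>i<N. 1 - \<gamma> m i + \<gamma> m i * t)" for m t
    using P[of m] unfolding P_def by blast
  \<comment> \<open>Both parameter families are joined, so that a single subsequence serves
    them.\<close>
  define h where "h = (\<lambda>m i. if i < N then \<alpha> m i else \<gamma> m (i - N))"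
  have "0 \<le> h m i \<and> h m i \<le> 1" if "i < 2 * N" for m i
  proof (cases "i < N")
    case True
    thus ?thesis using ag[of i m] by (auto simp: h_def)
  next
    case False
    hence "i - N < N" using that by simp
    from ag[OF this, of m] show ?thesis using False by (simp add: h_def)
  qed
  then obtain r where r: "strict_mono (r :: nat \<Rightarrow> nat)" "\<And>i. i < 2 * N \<Longrightarrow> convergent (\<lambda>m. h (r m) i)"
    using bounded_convergent_subsequence[of "2 * N" h] by blast
  have "convergent (\<lambda>m. \<alpha> (r m) i)" "convergent (\<lambda>m. \<gamma> (r m) i)" if "i < N" for i
    using r(2)[of i] r(2)[of "i + N"] that by (auto simp: h_def)
  moreover define A where "A = (\<lambda>i. lim (\<lambda>m. \<alpha> (r m) i))"
  moreover define C where "C = (\<lambda>i. lim (\<lambda>m. \<gamma> (r m) i))"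
  ultimately have conv: "(\<lambda>m. \<alpha> (r m) i) \<longlonglongrightarrow> A i" "(\<lambda>m. \<gamma> (r m) i) \<longlonglongrightarrow> C i"
    if "i < N" for i using that by (simp_all add: convergent_LIMSEQ_iff)
  have sub: "(\<lambda>m. poly (f (r m)) t) \<longlonglongrightarrow> poly F t" "(\<lambda>m. poly (g (r m)) t) \<longlonglongrightarrow> poly G t" for t
    using LIMSEQ_subseq_LIMSEQ[OF lim(1) r(1)] LIMSEQ_subseq_LIMSEQ[OF lim(2) r(1)]
    by (simp_all add: comp_def)
  have "0 \<le> A i \<and> A i \<le> C i \<and> C i \<le> 1" if "i < N" for i
    using ag[OF that] LIMSEQ_le_const[OF conv(1)[OF that], of 0]
      LIMSEQ_le[OF conv(1)[OF that] conv(2)[OF that]] LIMSEQ_le_const2[OF conv(2)[OF that], of 1] by blast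
  moreover have "C (Suc i) \<le> A i" if "Suc i < N" for i
    using LIMSEQ_le[OF conv(2)[OF that] conv(1)[of i]] ag2[OF that] that by auto
  moreover have "poly F t = poly F 1 * (\<Prod>i<N. 1 - A i + A i * t)" for t
  proof (rule LIMSEQ_unique[OF sub(1)])
    have "(\<lambda>m. poly (f (r m)) 1 * (\<Prod>i<N. 1 - \<alpha> (r m) i + \<alpha> (r m) i * t))
        \<longlonglongrightarrow> poly F 1 * (\<Prod>i<N. 1 - A i + A i * t)"
      by (intro tendsto_mult tendsto_prod tendsto_add tendsto_diff tendsto_const sub conv) auto
    thus "(\<lambda>m. poly (f (r m)) t) \<longlonglongrightarrow> poly F 1 * (\<Prod>i<N. 1 - A i + A i * t)"
      by (simp only: agf[symmetric])
  qed
  moreover have "poly G t = poly G 1 * (\<Prod>i<N. 1 - C i + C i * t)" for t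
  proof (rule LIMSEQ_unique[OF sub(2)])
    have "(\<lambda>m. poly (g (r m)) 1 * (\<Prod>i<N. 1 - \<gamma> (r m) i + \<gamma> (r m) i * t))
        \<longlonglongrightarrow> poly G 1 * (\<Prod>i<N. 1 - C i + C i * t)"
      by (intro tendsto_mult tendsto_prod tendsto_add tendsto_diff tendsto_const sub conv) auto
    thus "(\<lambda>m. poly (g (r m)) t) \<longlonglongrightarrow> poly G 1 * (\<Prod>i<N. 1 - C i + C i * t)"
      by (simp only: agg[symmetric])
  qed
  ultimately show ?thesis unfolding weakly_interlaced_def by blast
qed

context two_diagonal
begin

lemma degree_row: "degree (row B \<theta> s c) \<le> Suc n"
proof -
  have "degree (row B \<theta> s c) \<le> Suc n - s"
  proof (induction B \<theta> s c rule: row.induct)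
    case (1 B \<theta> s c)
    show ?case
    proof (cases "n < s")
      case False
      have "degree (walk s * row B \<theta> (Suc s) c) \<le> 1 + (Suc n - Suc s)"
        using 1(1) False by (intro order.trans[OF degree_mult_le] add_mono) (auto simp: walk_def)
      moreover have "degree (smult (\<theta> * a s) (row B \<theta> (s + p + 1) c)) \<le> Suc n - (s + p + 1)"
        using 1(2) False by (intro order.trans[OF degree_smult_le]) auto
      ultimately show ?thesis using False
        by (simp only: row_step not_less) (intro degree_add_le; simp)
    qed (simp add: row_base)
  qed
  thus ?thesis by simp
qed

text \<open>The bound does not involve \<open>B\<close>, hence supplies a number of factors valid
  along the whole limit.\<close>

lemma degree_W: "degree (W B \<theta> R C) \<le> Suc n * length R"
  unfolding minor_def by (rule degree_det_le) (auto simp: degree_row)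

lemma weakly_interlaced_minors:
  assumes "k < l" "l \<le> p" "s + k \<le> n"
  shows "\<exists>N. weakly_interlaced N (W base_lim ((-1) ^ k) [s..<s+k+1] ((p - k) # [p-k+1..<p+1]))
     (W base_lim ((-1) ^ k) [s..<s+k+1] ((p - l) # [p-k+1..<p+1]))"
proof -
  let ?C = "[p-k+1..<p+1]"
  define N where "N = Suc n * (k + 1)"
  \<comment> \<open>\<open>interlaced_minors\<close> with \<open>c = p - l\<close> and
    \<open>d = p - k\<close> needs positivity for four column lists; all are increasing because
    \<open>k < l \<le> p\<close>.\<close>
  have ev: "eventually (\<lambda>y. pos_base (base y) ((p-l) # ?C) \<and> pos_base (base y) ((p-k) # ?C) \<and>
      pos_base (base y) ((p-l) # (p-k) # ?C) \<and> pos_base (base y) ?C) at_top"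
    by (intro eventually_conj eventually_pos_base) (use assms in \<open>auto simp del: upt_Suc\<close>)
  obtain y0 where y0: "\<And>y. y \<ge> y0 \<Longrightarrow> pos_base (base y) ((p-l) # ?C) \<and> pos_base (base y) ((p-k) # ?C) \<and>
      pos_base (base y) ((p-l) # (p-k) # ?C) \<and> pos_base (base y) ?C"
    using ev unfolding eventually_at_top_linorder by blast
  define y where "y = (\<lambda>m. max y0 (real m))"
  have y: "filterlim y at_top sequentially"
    unfolding y_def by (rule filterlim_at_top_mono[OF filterlim_real_sequentially]) auto
  have bt: "((\<lambda>m. base (y m) d c) \<longlonglongrightarrow> base_lim d c)" for d c
    using base_tendsto y by (rule filterlim_compose)
  have "weakly_interlaced N (W base_lim ((-1) ^ k) [s..<s+k+1] ((p - k) # ?C))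
     (W base_lim ((-1) ^ k) [s..<s+k+1] ((p - l) # ?C))"
  proof (rule weakly_interlaced_limit)
    fix m
    obtain xs where xs: "interlaced_at xs (W (base (y m)) ((-1) ^ k) [s..<s+k+1] ((p-k) # ?C))
        (W (base (y m)) ((-1) ^ k) [s..<s+k+1] ((p-l) # ?C))"
      using interlaced_minors[of k s "(-1) ^ k" ?C "base (y m)" "p - l" "p - k"] y0[of "y m"] assms
      by (auto simp: y_def simp del: upt_Suc)
    have "length xs \<le> N"
      using xs degree_W[of "base (y m)" "(-1) ^ k" "[s..<s+k+1]" "(p-k) # ?C"]
      by (simp add: interlaced_at_def N_def del: upt_Suc)
    with xs show "weakly_interlaced N (W (base (y m)) ((-1) ^ k) [s..<s+k+1] ((p-k) # ?C))
        (W (base (y m)) ((-1) ^ k) [s..<s+k+1] ((p-l) # ?C))"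
      by (rule interlaced_at_imp_weakly)
  next
    fix t
    have lens: "length ((p-k) # ?C) = length [s..<s+k+1]" "length ((p-l) # ?C) = length [s..<s+k+1]"
      using assms by (auto simp del: upt_Suc)
    show "(\<lambda>m. poly (W (base (y m)) ((-1) ^ k) [s..<s+k+1] ((p-k) # ?C)) t)
       \<longlonglongrightarrow> poly (W base_lim ((-1) ^ k) [s..<s+k+1] ((p-k) # ?C)) t"
      unfolding poly_minor by (intro minor_tendsto lens row_tendsto bt)
    show "(\<lambda>m. poly (W (base (y m)) ((-1) ^ k) [s..<s+k+1] ((p-l) # ?C)) t)
       \<longlonglongrightarrow> poly (W base_lim ((-1) ^ k) [s..<s+k+1] ((p-l) # ?C)) t"
      unfolding poly_minor by (intro minor_tendsto lens row_tendsto bt)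
  qed
  thus ?thesis by (rule exI)
qed

end

subsection \<open>Minors of the Hessenberg matrix\<close>

lemma pick_atLeastLessThan:
  assumes "i < n - k"
  shows "pick {k..<n} i = k + i"
proof -
  have "{b \<in> {k..<n}. b < k + i} = {k..<k + i}" using assms by auto
  hence "card {b \<in> {k..<n}. b < k + i} = i" by simp
  moreover have "k + i \<in> {k..<n}" using assms by simp
  ultimately show ?thesis using pick_card_in_set[of "k + i" "{k..<n}"] by simp
qed

lemma pick_image:
  assumes "finite J"
  shows "J \<subseteq> pick J ` {..<card J}"
proof
  fix v assume v: "v \<in> J"
  have "{b \<in> J. b < v} \<subset> J" using v by auto
  hence "card {b \<in> J. b < v} < card J" using assms by (intro psubset_card_mono)
  thus "v \<in> pick J ` {..<card J}"
    by (intro image_eqI[of _ _ "card {b \<in> J. b < v}"]) (use pick_card_in_set[OF v] in auto)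
qed

text \<open>Jacobi's formula with the selection made by \<pi>. Permute the columns of
  \<open>L\<close> and accordingly the rows of \<open>Z\<close>, and replace the first
  \<open>k\<close> rows of the former by unit rows: both this matrix and its product with the
  permuted \<open>Z\<close> are block triangular, and their determinants are read off.\<close>

lemma complementary_minor:
  fixes L Z :: "'a :: field mat"
  assumes L: "L \<in> carrier_mat (k + m) (k + m)" and Z: "Z \<in> carrier_mat (k + m) (k + m)"
    and LZ: "L * Z = 1\<^sub>m (k + m)" and detZ: "Determinant.det Z = 1"
    and \<pi>: "\<pi> permutes {0..<k + m}"
  shows "Determinant.det (mat m m (\<lambda>(i, j). L $$ (k + i, \<pi> (k + j)))) =
    signof \<pi> * Determinant.det (mat k k (\<lambda>(i, j). Z $$ (\<pi> i, j)))"
proof -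
  let ?N = "k + m"
  define M where "M = mat ?N ?N (\<lambda>(i, j). if i < k then (if i = j then 1 else 0) else L $$ (i, \<pi> j))"
  define Z' where "Z' = mat ?N ?N (\<lambda>(i, j). Z $$ (\<pi> i, j))"
  define E where "E = mat ?N ?N (\<lambda>(i, j). if i < k then Z' $$ (i, j) else (if i = j then 1 else 0))"
  have M: "M \<in> carrier_mat ?N ?N" and Z': "Z' \<in> carrier_mat ?N ?N" by (simp_all add: M_def Z'_def)
  have "M * Z' = E"
  proof (rule eq_matI)
    fix i j assume "i < dim_row E" "j < dim_col E"
    hence ij: "i < ?N" "j < ?N" by (auto simp: E_def)
    have MZ: "(M * Z') $$ (i, j) = (\<Sum>r\<in>{0..<?N}. M $$ (i, r) * Z' $$ (r, j))"
      using M Z' ij by (simp add: scalar_prod_def)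
    show "(M * Z') $$ (i, j) = E $$ (i, j)"
    proof (cases "i < k")
      case True
      have "(\<Sum>r\<in>{0..<?N}. M $$ (i, r) * Z' $$ (r, j)) = (\<Sum>r\<in>{0..<?N}. if i = r then Z' $$ (r, j) else 0)"
        using True ij by (intro sum.cong) (auto simp: M_def)
      thus ?thesis using True ij MZ by (simp add: E_def)
    next
      case False
      have "(\<Sum>r\<in>{0..<?N}. M $$ (i, r) * Z' $$ (r, j)) = (\<Sum>r\<in>{0..<?N}. L $$ (i, \<pi> r) * Z $$ (\<pi> r, j))"
        using False ij by (intro sum.cong) (auto simp: M_def Z'_def)
      also have "\<dots> = (\<Sum>r\<in>{0..<?N}. L $$ (i, r) * Z $$ (r, j))"
        by (rule sum.reindex_bij_betw[OF permutes_imp_bij[OF \<pi>]])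
      also have "\<dots> = (L * Z) $$ (i, j)" using L Z ij by (simp add: scalar_prod_def)
      finally show ?thesis using False ij MZ by (simp add: E_def LZ)
    qed
  qed (auto simp: M_def Z'_def E_def)
  hence prod: "Determinant.det M * Determinant.det Z' = Determinant.det E"
    using det_mult[OF M Z'] by simp
  have detZ': "Determinant.det Z' = signof \<pi>"
    using det_permute_rows[OF Z \<pi>] detZ by (simp add: Z'_def)
  let ?B = "mat m m (\<lambda>(i, j). L $$ (k + i, \<pi> (k + j)))"
  let ?T = "mat k k (\<lambda>(i, j). Z $$ (\<pi> i, j))"
  have "M = four_block_mat (1\<^sub>m k) (0\<^sub>m k m) (mat m k (\<lambda>(i, j). L $$ (k + i, \<pi> j))) ?B"
    by (rule eq_matI) (auto simp: M_def)
  hence "Determinant.det M = Determinant.det ?B"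
    using det_four_block_mat_upper_right_zero[of "1\<^sub>m k" k "0\<^sub>m k m" m "mat m k (\<lambda>(i, j). L $$ (k + i, \<pi> j))" ?B]
    by simp
  moreover have "E = four_block_mat ?T (mat k m (\<lambda>(i, j). Z $$ (\<pi> i, k + j))) (0\<^sub>m m k) (1\<^sub>m m)"
    by (rule eq_matI) (auto simp: E_def Z'_def)
  hence "Determinant.det E = Determinant.det ?T"
    using det_four_block_mat_lower_left_zero[of ?T k "mat k m (\<lambda>(i, j). Z $$ (\<pi> i, k + j))" m "0\<^sub>m m k" "1\<^sub>m m"]
    by simp
  ultimately have eq: "Determinant.det ?B * signof \<pi> = Determinant.det ?T" using prod detZ' by simp
  have sq: "signof \<pi> * signof \<pi> = (1 :: 'a)" by (cases "evenperm \<pi>") (auto simp: sign_def)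
  have "Determinant.det ?B = Determinant.det ?B * (signof \<pi> * signof \<pi>)" by (simp add: sq)
  also have "\<dots> = signof \<pi> * Determinant.det ?T" unfolding eq[symmetric] by (simp add: mult_ac)
  finally show ?thesis .
qed

section \<open>The inverse of the extended Hessenberg matrix\<close>

text \<open>The entry in row \<open>c\<close> and column \<open>s\<close> of the inverse of
  \<open>L\<close>. The case \<open>c < s\<close> expresses that the inverse is lower triangular and
  makes the recursion stop.\<close>

function sol :: "nat \<Rightarrow> (nat \<Rightarrow> real) \<Rightarrow> complex \<Rightarrow> nat \<Rightarrow> nat \<Rightarrow> complex" where
  "sol p a x s c = (if c < s then 0 else (if s = c then 1 else 0)
     + x * sol p a x (Suc s) c - of_real (a s) * sol p a x (s + p + 1) c)"
  by pat_completeness auto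
termination by (relation "measure (\<lambda>(p, a, x, s, c). Suc c - s)") auto

declare sol.simps [simp del]

lemma sol_0: "c < s \<Longrightarrow> sol p a x s c = 0"
  by (simp add: sol.simps)

lemma sol_rec: "sol p a x s c = (if s = c then 1 else 0)
     + x * sol p a x (Suc s) c - of_real (a s) * sol p a x (s + p + 1) c"
proof (cases "c < s")
  case False
  thus ?thesis by (subst sol.simps) simp
qed (simp add: sol_0)

lemma sol_same: "sol p a x s s = 1"
  by (subst sol_rec) (simp add: sol_0)

text \<open>Rows \<open>k, ..., n - 1\<close> of \<open>H - x\<close> are rows
  \<open>k + 1, ..., n\<close> of \<open>L\<close>, so the complementary rows are
  \<open>0, ..., k\<close>, and \<open>cs\<close> lists the columns of \<open>L\<close> outside
  \<open>J\<close>. The sign comes from the order of listing, hence does not depend on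
  \<open>x\<close>.\<close>

lemma hess_minor_eq_sol_minor:
  assumes p: "p \<ge> 1" and kn: "k \<le> n" and cs: "length cs = Suc k"
    and J: "J \<subseteq> {..<n}" "card J = n - k" and cover: "{..n} \<subseteq> set cs \<union> J"
  shows "\<exists>\<kappa> :: complex. (\<kappa> = 1 \<or> \<kappa> = -1) \<and> (\<forall>x.
    poly (Determinant.det (submatrix (hess_char p a n) {k..<n} J)) x = \<kappa> * minor (sol p a x) [0..<Suc k] cs)"
proof -
  let ?N = "Suc k + (n - k)"
  have N: "?N = Suc n" using kn by simp
  \<comment> \<open>Lists \<open>cs\<close> first and then \<open>J\<close> increasingly; by
    \<open>cover\<close> it is onto, hence a permutation by counting.\<close>
  define \<pi> where "\<pi> = (\<lambda>i. if i < Suc k then cs ! i else if i < ?N then pick J (i - Suc k) else i)"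
  have fJ: "finite J" using J(1) finite_subset by blast
  have img: "{0..<?N} \<subseteq> \<pi> ` {0..<?N}"
  proof
    fix v assume v: "v \<in> {0..<?N}"
    hence "v \<in> {..n}" using kn by simp
    hence "v \<in> set cs \<union> J" using cover by blast
    thus "v \<in> \<pi> ` {0..<?N}"
    proof
      assume "v \<in> set cs"
      then obtain i where "i < Suc k" "v = cs ! i" using cs by (metis in_set_conv_nth)
      thus ?thesis by (intro image_eqI[of _ _ i]) (auto simp: \<pi>_def)
    next
      assume "v \<in> J"
      then obtain i where "i < n - k" "v = pick J i" using pick_image[OF fJ] J(2) by auto
      thus ?thesis by (intro image_eqI[of _ _ "Suc k + i"]) (auto simp: \<pi>_def)
    qed
  qed
  have "card (\<pi> ` {0..<?N}) \<le> card {0..<?N}" by (rule card_image_le) simp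
  hence eq: "\<pi> ` {0..<?N} = {0..<?N}" using img by (metis card_seteq finite_atLeastLessThan finite_imageI)
  hence "inj_on \<pi> {0..<?N}" by (intro eq_card_imp_inj_on) auto
  hence perm: "\<pi> permutes {0..<?N}"
    using eq by (intro bij_imp_permutes) (auto simp: bij_betw_def \<pi>_def)
  have entry: "poly (hess_char p a n $$ (i, j)) x = of_real (hess p a i j) - (if i = j then x else 0)"
    if "i < n" "j < n" for i j x
    using that by (auto simp: hess_char_def)
  show ?thesis
  proof (intro exI conjI allI)
    show "(signof \<pi> :: complex) = 1 \<or> (signof \<pi> :: complex) = -1" by (simp add: sign_def)
    fix x :: complex
    define L where "L = mat ?N ?N (\<lambda>(i, j). if i = 0 then (if j = 0 then 1 else 0)
       else of_real (hess p a (i - 1) j) - (if i - 1 = j then x else 0))"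
    define Z where "Z = mat ?N ?N (\<lambda>(i, j). sol p a x j i)"
    have L: "L \<in> carrier_mat ?N ?N" and Z: "Z \<in> carrier_mat ?N ?N" by (simp_all add: L_def Z_def)
    have "Z * L = 1\<^sub>m ?N"
    proof (rule eq_matI)
      fix r c assume "r < dim_row (1\<^sub>m ?N)" "c < dim_col (1\<^sub>m ?N)"
      hence rc: "r < ?N" "c < ?N" by auto
      have "(Z * L) $$ (r, c) = (\<Sum>i\<in>{0..<?N}. sol p a x i r * L $$ (i, c))"
        using Z L rc by (simp add: scalar_prod_def Z_def)
      \<comment> \<open>Column \<open>c\<close> of \<open>L\<close> has the entries 1,
        \<open>-x\<close> and \<open>a c\<close> in rows \<open>c\<close>, \<open>c + 1\<close> and
        \<open>c + p + 1\<close>, which differ as \<open>p \<ge> 1\<close>.\<close>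
      also have "\<dots> = (\<Sum>i\<in>{0..<?N}. (if i = c then sol p a x i r else 0)
          + (if i = Suc c then - x * sol p a x i r else 0)
          + (if i = c + p + 1 then of_real (a c) * sol p a x i r else 0))"
        using rc p by (intro sum.cong refl) (auto simp: L_def hess_def)
      also have "\<dots> = sol p a x c r - x * sol p a x (Suc c) r + of_real (a c) * sol p a x (c + p + 1) r"
      proof -
        \<comment> \<open>Indices beyond the matrix may be included because \<open>sol\<close>
          vanishes there.\<close>
        have pick_sum: "(\<Sum>i\<in>{0..<?N}. if i = j then u * sol p a x i r else 0) = u * sol p a x j r" for u j
        proof (cases "j < ?N")
          case False
          hence "sol p a x j r = 0" using rc by (intro sol_0) linarith
          thus ?thesis using False by (subst sum.delta) auto
        qed (subst sum.delta, auto)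
        show ?thesis unfolding sum.distrib pick_sum pick_sum[of c 1, unfolded mult_1] by simp
      qed
      also have "\<dots> = (if r = c then 1 else 0)"
        by (subst sol_rec) auto
      finally show "(Z * L) $$ (r, c) = 1\<^sub>m ?N $$ (r, c)" using rc by simp
    qed (auto simp: Z_def L_def)
    hence LZ: "L * Z = 1\<^sub>m ?N" using mat_mult_left_right_inverse[OF Z L] by simp
    have detZ: "Determinant.det Z = 1"
    proof -
      have "Determinant.det Z = prod_list (diag_mat Z)"
        by (rule det_lower_triangular[OF _ Z]) (auto simp: Z_def sol_0)
      also have "diag_mat Z = map (\<lambda>i. 1) [0..<?N]"
        unfolding diag_mat_def using Z by (intro map_cong) (auto simp: Z_def sol_same)
      finally show ?thesis by (simp add: map_replicate_const)
    qed
    interpret h: comm_ring_hom "\<lambda>q. poly q x" by standard auto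
    let ?S = "submatrix (hess_char p a n) {k..<n} J"
    have dims: "{i. i < n \<and> i \<in> {k..<n}} = {k..<n}" "{j. j < n \<and> j \<in> J} = J" using J(1) by auto
    have pJ: "pick J j < n" if "j < n - k" for j
      using pick_in_set_le[of j J] that J by auto
    have dimH: "dim_row (hess_char p a n) = n" "dim_col (hess_char p a n) = n" by (auto simp: hess_char_def)
    have S: "?S = mat (n - k) (n - k) (\<lambda>(i, j). hess_char p a n $$ (k + i, pick J j))"
      unfolding submatrix_def dimH dims(1) dims(2) card_atLeastLessThan J(2)
      by (intro eq_matI) (auto simp: pick_atLeastLessThan)
    have "poly (Determinant.det ?S) x = Determinant.det (map_mat (\<lambda>q. poly q x) ?S)"
      by (simp add: h.hom_det)
    also have "map_mat (\<lambda>q. poly q x) ?S = mat (n - k) (n - k) (\<lambda>(i, j). L $$ (Suc k + i, \<pi> (Suc k + j)))"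
    proof (rule eq_matI)
      fix i j assume "i < dim_row (mat (n - k) (n - k) (\<lambda>(i, j). L $$ (Suc k + i, \<pi> (Suc k + j))))"
        "j < dim_col (mat (n - k) (n - k) (\<lambda>(i, j). L $$ (Suc k + i, \<pi> (Suc k + j))))"
      hence ij: "i < n - k" "j < n - k" by auto
      have "k + j < n" "k + i < n" using ij by simp_all
      with ij show "map_mat (\<lambda>q. poly q x) ?S $$ (i, j) = mat (n - k) (n - k) (\<lambda>(i, j). L $$ (Suc k + i, \<pi> (Suc k + j))) $$ (i, j)"
        using entry[of "k + i" "pick J j" x] pJ[OF ij(2)] \<open>k + j < n\<close> \<open>k + i < n\<close>
        by (simp add: S L_def \<pi>_def)
    qed (simp_all add: S)
    also have "Determinant.det \<dots> = signof \<pi> * Determinant.det (mat (Suc k) (Suc k) (\<lambda>(i, j). Z $$ (\<pi> i, j)))"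
      by (rule complementary_minor[OF L Z LZ detZ perm])
    also have "mat (Suc k) (Suc k) (\<lambda>(i, j). Z $$ (\<pi> i, j)) = transpose_mat (mat (Suc k) (Suc k) (\<lambda>(i, j). sol p a x i (cs ! j)))"
    proof (rule eq_matI)
      fix i j assume "i < dim_row (transpose_mat (mat (Suc k) (Suc k) (\<lambda>(i, j). sol p a x i (cs ! j))))"
        "j < dim_col (transpose_mat (mat (Suc k) (Suc k) (\<lambda>(i, j). sol p a x i (cs ! j))))"
      hence ij: "i < Suc k" "j < Suc k" by auto
      hence "\<pi> i \<in> \<pi> ` {0..<?N}" by auto
      hence "\<pi> i < ?N" unfolding eq by simp
      thus "mat (Suc k) (Suc k) (\<lambda>(i, j). Z $$ (\<pi> i, j)) $$ (i, j)
         = transpose_mat (mat (Suc k) (Suc k) (\<lambda>(i, j). sol p a x i (cs ! j))) $$ (i, j)"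
        using ij by (simp add: Z_def \<pi>_def)
    qed auto
    also have "Determinant.det \<dots> = Determinant.det (mat (Suc k) (Suc k) (\<lambda>(i, j). sol p a x i (cs ! j)))"
      by (rule det_transpose) auto
    also have "\<dots> = minor (sol p a x) [0..<Suc k] cs"
      unfolding minor_def by (intro arg_cong[of _ _ Determinant.det] eq_matI) (auto simp del: upt_Suc)
    finally show "poly (Determinant.det ?S) x = signof \<pi> * minor (sol p a x) [0..<Suc k] cs" .
  qed
qed

section \<open>Evaluation of real polynomials at complex points\<close>

definition ceval :: "real poly \<Rightarrow> complex \<Rightarrow> complex" where
  "ceval q w = poly (map_poly of_real q) w"

lemma ceval_pCons: "ceval (pCons c q) w = of_real c + w * ceval q w"
  by (simp add: ceval_def map_poly_pCons)

lemma ceval_0: "ceval 0 w = 0" by (simp add: ceval_def)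

lemma ceval_add: "ceval (q + r) w = ceval q w + ceval r w"
  by (induction q r rule: poly_induct2) (simp_all add: ceval_0 ceval_pCons algebra_simps)

lemma ceval_smult: "ceval (smult c q) w = of_real c * ceval q w"
  by (induction q) (simp_all add: ceval_0 ceval_pCons algebra_simps)

lemma ceval_mult: "ceval (q * r) w = ceval q w * ceval r w"
  by (induction q) (simp_all add: ceval_0 ceval_pCons ceval_add ceval_smult algebra_simps)

lemma ceval_1: "ceval 1 w = 1"
  unfolding one_pCons ceval_pCons ceval_0 by simp

lemma ceval_hom: "comm_ring_hom (\<lambda>q. ceval q w)"
  by standard (simp_all add: ceval_0 ceval_1 ceval_add ceval_mult)

lemma ceval_minor: "ceval (minor f R C) w = minor (\<lambda>r c. ceval (f r c) w) R C"
proof -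
  interpret h: comm_ring_hom "\<lambda>q. ceval q w" by (rule ceval_hom)
  show ?thesis unfolding minor_def h.hom_det[symmetric]
    by (intro arg_cong[of _ _ Determinant.det] eq_matI) auto
qed

lemma minor_map: "length C = length R \<Longrightarrow> minor f R (map g C) = minor (\<lambda>r c. f r (g c)) R C"
  unfolding minor_def by (intro arg_cong[of _ _ Determinant.det] eq_matI) auto

section \<open>From the inverse to the reduced recurrence\<close>

context two_diagonal
begin

text \<open>The power of \<open>x\<close> to be removed from row \<open>s\<close>. It grows by 1
  with each walk, absorbing the factor \<open>x\<close>, except where it falls from \<open>p\<close>
  to 0 and leaves a factor \<open>x ^ (p + 1)\<close>, which is \<open>t\<close> up to sign.\<close>

definition expo :: "nat \<Rightarrow> nat" where
  "expo s = p - (n - s) mod (p + 1)"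

text \<open>Each full period contributes \<open>-\<theta>\<close>, which cancels the sign of the
  weight \<open>- \<theta> * x ^ (p + 1)\<close> and turns the coefficient
  \<open>\<theta> * a s\<close> of a jump into \<open>- a s\<close>.\<close>

definition row_sign :: "real \<Rightarrow> nat \<Rightarrow> real" where
  "row_sign \<theta> s = \<theta> * (- \<theta>) ^ ((n - s) div (p + 1))"

text \<open>Both sides satisfy the same recurrence in \<open>s\<close>, compared separately for the
  walk and the jump. Multiplying by \<open>x ^ expo s\<close> instead of dividing keeps the identity
  valid at \<open>x = 0\<close>.\<close>

lemma sol_eq_row:
  assumes \<theta>: "\<theta> = 1 \<or> \<theta> = -1" and c: "n \<le> c + p" "c \<le> n" and s: "s \<le> n"
  shows "x ^ expo s * sol p a x s c =
    of_real (row_sign \<theta> s) * x ^ expo c * ceval (row base_lim \<theta> s (c + p - n)) (- of_real \<theta> * x ^ (p + 1))"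
  using s
proof (induction "n - s" arbitrary: s rule: less_induct)
  case less
  let ?w = "- of_real \<theta> * x ^ (p + 1)"
  let ?r = "\<lambda>s. ceval (row base_lim \<theta> s (c + p - n)) ?w"
  have \<theta>2: "\<theta> * \<theta> = 1" using \<theta> by auto
  have \<theta>2c: "complex_of_real \<theta> * complex_of_real \<theta> = 1" using \<theta>2 by (metis of_real_1 of_real_mult)
  have IH: "of_real (row_sign \<theta> s') * x ^ expo c * ?r s' = x ^ expo s' * sol p a x s' c" if "s < s'" "s' \<le> n" for s'
    using less.hyps[of s'] that by simp
  have walk: "of_real (row_sign \<theta> s) * x ^ expo c * (ceval (walk s) ?w * ?r (Suc s)) = x ^ expo s * (x * sol p a x (Suc s) c)"
  proof (cases "s = n")
    case True
    thus ?thesis using c by (simp add: walk_def ceval_0 sol_0)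
  next
    case False
    hence sn: "s < n" using less.prems by simp
    note IHS = IH[of "Suc s"]
    show ?thesis
    proof (cases "(p + 1) dvd (n - s)")
      case True
      have "(n - Suc s) mod (p + 1) = p"
      proof -
        obtain q where "n - s = (p + 1) * q" using True by blast
        moreover from this sn have "q \<noteq> 0" by (intro notI) simp
        ultimately obtain q' where "n - s = (p + 1) * Suc q'" by (cases q) auto
        hence "n - Suc s = p + q' * (p + 1)" using sn by (simp add: mult.commute)
        hence "(n - Suc s) mod (p + 1) = p mod (p + 1)" by (simp only: mod_mult_self1)
        thus ?thesis by simp
      qed
      hence e: "expo s = p" "expo (Suc s) = 0" using True by (simp_all add: expo_def dvd_eq_mod_eq_0)
      have rs: "row_sign \<theta> s = - \<theta> * row_sign \<theta> (Suc s)"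
        unfolding row_sign_def div_diff_Suc[OF sn] using True by simp
      have "ceval (walk s) ?w = ?w" using True sn by (simp add: walk_def ceval_pCons ceval_0)
      hence "of_real (row_sign \<theta> s) * x ^ expo c * (ceval (walk s) ?w * ?r (Suc s))
        = (of_real \<theta> * of_real \<theta>) * x ^ (p + 1) * (of_real (row_sign \<theta> (Suc s)) * x ^ expo c * ?r (Suc s))"
        unfolding rs by (simp add: mult_ac)
      also have "\<dots> = x ^ (p + 1) * (x ^ expo (Suc s) * sol p a x (Suc s) c)"
        unfolding \<theta>2c IHS[OF lessI Suc_leI[OF sn]] by simp
      finally show ?thesis by (simp add: e mult_ac)
    next
      case edge: False
      have m: "(n - s) mod (p + 1) = Suc ((n - Suc s) mod (p + 1))"
      proof -
        have "n - s = Suc (n - Suc s)" using sn by simp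
        thus ?thesis using mod_Suc[of "n - Suc s" "p + 1"] edge by (auto simp: dvd_eq_mod_eq_0)
      qed
      have lt: "(n - s) mod (p + 1) < p + 1" by simp
      have e: "expo (Suc s) = Suc (expo s)" unfolding expo_def m using lt[unfolded m] by arith
      have rs: "row_sign \<theta> s = row_sign \<theta> (Suc s)"
        unfolding row_sign_def div_diff_Suc[OF sn] using edge by simp
      have "ceval (walk s) ?w = 1" using edge sn by (simp add: walk_def ceval_1)
      hence "of_real (row_sign \<theta> s) * x ^ expo c * (ceval (walk s) ?w * ?r (Suc s))
        = of_real (row_sign \<theta> (Suc s)) * x ^ expo c * ?r (Suc s)" unfolding rs by simp
      also have "\<dots> = x ^ expo (Suc s) * sol p a x (Suc s) c" using IHS sn by simp
      finally show ?thesis by (simp add: e mult_ac)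
    qed
  qed
  have jump: "of_real (row_sign \<theta> s) * x ^ expo c * (of_real (\<theta> * a s) * ?r (s + p + 1))
     = x ^ expo s * ((if s = c then 1 else 0) - of_real (a s) * sol p a x (s + p + 1) c)"
  proof (cases "s + p + 1 \<le> n")
    case True
    have ne: "s \<noteq> c" using True c by simp
    have d: "(n - s) div (p + 1) = Suc ((n - (s + p + 1)) div (p + 1))"
      using True by (subst le_div_geq) auto
    have md: "(n - s) mod (p + 1) = (n - (s + p + 1)) mod (p + 1)"
      using True by (subst le_mod_geq) auto
    have e: "expo (s + p + 1) = expo s" unfolding expo_def md ..
    have rs: "row_sign \<theta> s = - \<theta> * row_sign \<theta> (s + p + 1)" unfolding row_sign_def d by simp
    have "of_real (row_sign \<theta> s) * x ^ expo c * (of_real (\<theta> * a s) * ?r (s + p + 1))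
      = - (of_real \<theta> * of_real \<theta>) * of_real (a s) * (of_real (row_sign \<theta> (s + p + 1)) * x ^ expo c * ?r (s + p + 1))"
      unfolding rs by (simp add: mult_ac)
    also have "\<dots> = - of_real (a s) * (x ^ expo s * sol p a x (s + p + 1) c)"
      unfolding \<theta>2c using IH[OF _ True] e by simp
    finally show ?thesis using ne by (simp add: mult_ac)
  next
    case False
    \<comment> \<open>The jump ends in an initial row; its diagonal entry \<open>1 / a c\<close>
      reproduces the unit term at \<open>s = c\<close>.\<close>
    have "row base_lim \<theta> (s + p + 1) (c + p - n) = [:base_lim (s + p - n) (c + p - n):]"
      using False by (subst row_base) auto
    hence r: "?r (s + p + 1) = of_real (if s = c then 1 / a c else 0)"
      using False c by (auto simp: base_lim_def ceval_pCons ceval_0)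
    have "(n - s) div (p + 1) = 0" using False by simp
    hence rs: "row_sign \<theta> s = \<theta>" by (simp add: row_sign_def)
    have "sol p a x (s + p + 1) c = 0" using False c by (intro sol_0) simp
    thus ?thesis unfolding r rs using \<theta>2c a_pos[of c] by (simp add: mult_ac)
  qed
  have "ceval (row base_lim \<theta> s (c + p - n)) ?w = ceval (walk s) ?w * ?r (Suc s) + of_real (\<theta> * a s) * ?r (s + p + 1)"
    using less.prems by (simp only: row_step ceval_add ceval_mult ceval_smult)
  hence "of_real (row_sign \<theta> s) * x ^ expo c * ?r s
     = x ^ expo s * (x * sol p a x (Suc s) c)
       + x ^ expo s * ((if s = c then 1 else 0) - of_real (a s) * sol p a x (s + p + 1) c)"
    by (simp only: distrib_left walk jump)
  also have "\<dots> = x ^ expo s * sol p a x s c"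
    by (subst (3) sol_rec) (simp add: algebra_simps)
  finally show ?case ..
qed

text \<open>Scaling by \<open>sol_eq_row\<close> puts the powers belonging to \<open>cs\<close> into
  the numerator and those of the rows into the denominator, whence an integer exponent and
  \<open>x \<noteq> 0\<close>.\<close>

lemma sol_minor_eq:
  assumes \<theta>: "\<theta> = 1 \<or> \<theta> = -1" and cs: "\<forall>c\<in>set cs. n \<le> c + p \<and> c \<le> n" "length cs = Suc k"
    and k: "k \<le> n" and x: "x \<noteq> 0"
  shows "minor (sol p a x) [0..<Suc k] cs =
    of_real (\<Prod>s\<leftarrow>[0..<Suc k]. row_sign \<theta> s) *
    x powi (int (\<Sum>c\<leftarrow>cs. expo c) - int (\<Sum>s\<leftarrow>[0..<Suc k]. expo s)) *
    ceval (W base_lim \<theta> [0..<Suc k] (map (\<lambda>c. c + p - n) cs)) (- of_real \<theta> * x ^ (p + 1))"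
proof -
  let ?w = "- of_real \<theta> * x ^ (p + 1)" and ?R = "[0..<Suc k]"
  define g where "g = (\<lambda>s c. ceval (row base_lim \<theta> s (c + p - n)) ?w)"
  have powprod: "prod_list (map (\<lambda>c. x ^ h c) X) = x ^ sum_list (map h X)" for h :: "nat \<Rightarrow> nat" and X
    by (induction X) (simp_all add: power_add)
  have quot: "prod_list (map (\<lambda>s. of_real (u s) / x ^ h s) X) = of_real (prod_list (map u X)) / x ^ sum_list (map h X)"
    for h :: "nat \<Rightarrow> nat" and u X
    by (induction X) (simp_all add: power_add)
  have "minor (sol p a x) ?R cs = prod_list (map (\<lambda>s. of_real (row_sign \<theta> s) / x ^ expo s) ?R) * minor (\<lambda>s c. x ^ expo c * g s c) ?R cs"
  proof (rule minor_scale_rows)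
    fix s c assume sc: "s \<in> set ?R" "c \<in> set cs"
    have "x ^ expo s * sol p a x s c = of_real (row_sign \<theta> s) * x ^ expo c * g s c"
      unfolding g_def using sc cs k by (intro sol_eq_row[OF \<theta>]) auto
    thus "sol p a x s c = of_real (row_sign \<theta> s) / x ^ expo s * (x ^ expo c * g s c)"
      using x by (simp add: field_simps)
  qed (use cs in simp)
  also have "minor (\<lambda>s c. x ^ expo c * g s c) ?R cs = prod_list (map (\<lambda>c. x ^ expo c) cs) * minor g ?R cs"
    by (rule minor_scale_cols) (use cs in auto)
  also have "minor g ?R cs = ceval (W base_lim \<theta> ?R (map (\<lambda>c. c + p - n) cs)) ?w"
    unfolding ceval_minor using cs by (subst minor_map) (auto simp: g_def simp del: upt_Suc)
  finally show ?thesis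
    unfolding powprod quot using x by (simp add: power_int_diff del: upt_Suc)
qed

lemma int_expo:
  assumes "s \<le> p" "s \<le> n"
  shows "int (expo s) = int s - int (n mod (p + 1)) - 1 + (if s \<le> n mod (p + 1) then int p + 1 else 0)"
proof -
  define j where "j = n mod (p + 1)"
  define q where "q = n div (p + 1)"
  have n: "n = q * (p + 1) + j" by (simp only: q_def j_def div_mult_mod_eq)
  have j: "j < p + 1" by (simp add: j_def)
  have "int (expo s) = int s - int j - 1 + (if s \<le> j then int p + 1 else 0)"
  proof (cases "s \<le> j")
    case True
    have "n - s = (j - s) + q * (p + 1)" using True n by simp
    hence "(n - s) mod (p + 1) = j - s" using j by (simp only: mod_mult_self1) simp
    thus ?thesis using True j by (simp add: expo_def)
  next
    case False
    have "q \<noteq> 0" using False n assms by (intro notI) simp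
    then obtain q' where q': "q = Suc q'" by (cases q) auto
    define r where "r = p + 1 + j - s"
    have "n - s = r + q' * (p + 1)" using n False assms by (simp add: q' r_def)
    moreover have "r < p + 1" using False by (simp add: r_def)
    ultimately have "(n - s) mod (p + 1) = r" by (simp only: mod_mult_self1) simp
    thus ?thesis using False j assms by (simp add: expo_def r_def)
  qed
  thus ?thesis by (simp only: j_def)
qed

text \<open>The origin of \<open>m_exp\<close>: the excess of the powers at the indices
  \<open>n - k, ..., n\<close> over those at \<open>0, ..., k\<close>. For the former
  \<open>expo (n - i) = p - i\<close>; the latter depend on \<open>n mod (p + 1)\<close>.\<close>

lemma sum_expo:
  assumes "k \<le> p" "k \<le> n"
  shows "(\<Sum>c\<leftarrow>[n-k..<Suc n]. expo c) = (\<Sum>s\<leftarrow>[0..<Suc k]. expo s) + m_exp p k n"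
proof -
  define j where "j = n mod (p + 1)"
  have jp: "j \<le> p" by (simp add: j_def less_Suc_eq_le[symmetric])
  have gauss: "2 * (\<Sum>s<Suc k. int s) = int k * (int k + 1)" by (induction k) (auto simp: algebra_simps)
  have "(\<Sum>c\<leftarrow>[n-k..<Suc n]. expo c) = (\<Sum>i<Suc k. expo (n - i))"
  proof -
    have "(\<Sum>c\<leftarrow>[n-k..<Suc n]. expo c) = (\<Sum>c\<in>{n-k..<Suc n}. expo c)" by (simp add: sum_list_distinct_conv_sum_set del: upt_Suc)
    also have "\<dots> = (\<Sum>i<Suc k. expo (n - i))"
      by (rule sum.reindex_bij_witness[of _ "\<lambda>i. n - i" "\<lambda>c. n - c"]) (use assms in auto)
    finally show ?thesis .
  qed
  hence "int (\<Sum>c\<leftarrow>[n-k..<Suc n]. expo c) = (\<Sum>i<Suc k. int p - int i)"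
    using assms by (simp add: expo_def of_nat_diff del: sum.lessThan_Suc)
  also have "\<dots> = int (Suc k) * int p - (\<Sum>s<Suc k. int s)" by (simp add: sum_subtractf)
  finally have top: "int (\<Sum>c\<leftarrow>[n-k..<Suc n]. expo c) = int (Suc k) * int p - (\<Sum>s<Suc k. int s)" .
  have "int (\<Sum>s\<leftarrow>[0..<Suc k]. expo s) = (\<Sum>s<Suc k. int (expo s))"
    by (simp add: sum_list_distinct_conv_sum_set lessThan_atLeast0 del: upt_Suc)
  also have "\<dots> = (\<Sum>s<Suc k. (int s - (int j + 1)) + (if s \<in> {..j} then int p + 1 else 0))"
    using assms by (intro sum.cong) (auto simp: int_expo j_def)
  also have "\<dots> = (\<Sum>s<Suc k. int s) - int (Suc k) * (int j + 1) + int (card ({..<Suc k} \<inter> {..j})) * (int p + 1)"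
    by (simp only: sum.distrib sum_subtractf sum.inter_restrict[symmetric] finite_lessThan sum_constant card_lessThan
        distrib_left mult_1_right)
  \<comment> \<open>Each \<open>s \<le> k\<close> with \<open>s \<le> j\<close> contributes an
    additional \<open>p + 1\<close>; their number is \<open>min k j + 1\<close>, which causes the
    two cases of \<open>m_exp\<close>.\<close>
  also have "{..<Suc k} \<inter> {..j} = {..min k j}" by auto
  finally have bot: "int (\<Sum>s\<leftarrow>[0..<Suc k]. expo s)
     = (\<Sum>s<Suc k. int s) - int (Suc k) * (int j + 1) + (int (min k j) + 1) * (int p + 1)" by simp
  have "int (m_exp p k n) = (if k \<le> j then (int j - int k) * (int k + 1) else (int k - int j) * (int p - int k))"
  proof (cases "k \<le> j")
    case True
    thus ?thesis unfolding m_exp_def Let_def j_def[symmetric]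
      by (simp only: if_True of_nat_mult of_nat_diff of_nat_add of_nat_1)
  next
    case False
    hence "j \<le> k" by simp
    thus ?thesis unfolding m_exp_def Let_def j_def[symmetric]
      using False assms(1) by (simp only: if_False of_nat_mult of_nat_diff)
  qed
  hence "int (\<Sum>c\<leftarrow>[n-k..<Suc n]. expo c) = int (\<Sum>s\<leftarrow>[0..<Suc k]. expo s) + int (m_exp p k n)"
    unfolding top bot using gauss by (auto simp: algebra_simps min_def)
  thus ?thesis by linarith
qed

end

section \<open>Zeros of the reduced polynomials\<close>

text \<open>As \<alpha> decreases, its positive entries form an initial segment; there the factor
  has a zero of modulus \<open>(1 - \<alpha> i) / \<alpha> i\<close>, increasing in
  \<open>i\<close>, and beyond it the factor is 1.\<close>

lemma zeros_of_factored:
  fixes s :: real and \<alpha> :: "nat \<Rightarrow> real"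
  assumes Q: "Q = smult c (\<Prod>i<N. [:of_real (1 - \<alpha> i), of_real (s * \<alpha> i):])" and c: "c \<noteq> 0"
    and s: "s = 1 \<or> s = -1"
    and \<alpha>: "\<And>i. i < N \<Longrightarrow> 0 \<le> \<alpha> i \<and> \<alpha> i \<le> 1" "\<And>i. Suc i < N \<Longrightarrow> \<alpha> (Suc i) \<le> \<alpha> i"
    and z: "zeros_by_modulus Q xs"
  shows "length xs \<le> N" "\<And>i. i < N \<Longrightarrow> \<alpha> i > 0 \<longleftrightarrow> i < length xs"
    "\<And>i. i < length xs \<Longrightarrow> cmod (xs ! i) = (1 - \<alpha> i) / \<alpha> i"
proof -
  define M where "M = card {i. i < N \<and> \<alpha> i > 0}"
  have mono: "\<alpha> j \<le> \<alpha> i" if "i \<le> j" "j < N" for i j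
    using that by (induction rule: dec_induct) (use \<alpha>(2) order.trans Suc_lessD in blast)+
  have seg: "{i. i < N \<and> \<alpha> i > 0} = {..<M}"
  proof -
    have "\<exists>m. {i. i < N \<and> \<alpha> i > 0} = {..<m}"
    proof (cases "\<exists>i. \<not> (i < N \<and> \<alpha> i > 0)")
      case True
      define m where "m = (LEAST i. \<not> (i < N \<and> \<alpha> i > 0))"
      have m: "\<not> (m < N \<and> \<alpha> m > 0)" using True unfolding m_def by (rule LeastI_ex)
      have "i < N \<and> \<alpha> i > 0" if "i < m" for i using not_less_Least that unfolding m_def by blast
      moreover have "i < m" if "i < N" "\<alpha> i > 0" for i
      proof (rule ccontr)
        assume "\<not> i < m"
        thus False using m mono[of m i] that by force
      qed
      ultimately show ?thesis by (intro exI[of _ m]) auto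
    qed auto
    thus ?thesis unfolding M_def by force
  qed
  have MN: "M \<le> N" unfolding M_def by (rule order.trans[OF card_mono[of "{..<N}"]]) auto
  define r where "r = (\<lambda>i. - of_real (s * ((1 - \<alpha> i) / \<alpha> i)) :: complex)"
  have nz: "[:of_real (1 - \<alpha> i), of_real (s * \<alpha> i) :: complex:] \<noteq> 0" for i
    using s by auto
  have single: "proots [:of_real (1 - \<alpha> i), of_real (s * \<alpha> i) :: complex:] = (if i < M then {#r i#} else {#})"
    if i: "i < N" for i
  proof (cases "i < M")
    case True
    hence pos: "\<alpha> i > 0" using seg by blast
    have eq: "[:of_real (1 - \<alpha> i), of_real (s * \<alpha> i) :: complex:] = smult (of_real (s * \<alpha> i)) [:- r i, 1:]"
      using s pos by (auto simp: r_def)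
    have "(of_real (s * \<alpha> i) :: complex) \<noteq> 0" using s pos by auto
    thus ?thesis unfolding eq using True by (subst proots_smult) auto
  next
    case False
    hence "\<not> \<alpha> i > 0" using seg i by blast
    hence "\<alpha> i = 0" using \<alpha>(1)[OF i] by simp
    thus ?thesis using False by simp
  qed
  have "mset xs = proots Q" using z by (simp add: zeros_by_modulus_def)
  also have "\<dots> = (\<Sum>i<N. proots [:of_real (1 - \<alpha> i), of_real (s * \<alpha> i) :: complex:])"
    unfolding Q using c nz by (subst proots_smult[OF c]) (subst proots_prod, auto)
  also have "\<dots> = (\<Sum>i<N. if i < M then {#r i#} else {#})" using single by (intro sum.cong) auto
  also have "\<dots> = (\<Sum>i<M. {#r i#})" using MN by (intro sum.mono_neutral_cong_right) auto
  also have "\<dots> = mset (map r [0..<M])" by (induction M) auto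
  finally have ms: "mset xs = mset (map r [0..<M])" .
  have cm: "cmod (r i) = (1 - \<alpha> i) / \<alpha> i" if "i < M" for i
  proof -
    have "i < N" "\<alpha> i > 0" using that seg by blast+
    thus ?thesis using \<alpha>(1)[of i] s by (auto simp: r_def norm_divide norm_mult simp flip: of_real_diff of_real_divide)
  qed
  have srt: "sorted (map cmod (map r [0..<M]))"
    unfolding sorted_iff_nth_mono
  proof (intro allI impI)
    fix i j assume ij: "i \<le> j" "j < length (map cmod (map r [0..<M]))"
    hence "i < M" "j < M" by auto
    moreover have "\<alpha> j > 0" "\<alpha> j \<le> \<alpha> i" using mono[OF ij(1)] \<open>j < M\<close> seg by blast+
    moreover from this have "(1 - \<alpha> i) / \<alpha> i \<le> (1 - \<alpha> j) / \<alpha> j" by (simp add: field_simps)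
    ultimately show "map cmod (map r [0..<M]) ! i \<le> map cmod (map r [0..<M]) ! j" by (simp add: cm)
  qed
  \<comment> \<open>Zeros of equal modulus may be listed in any order, so only the lists of moduli
    are identified: both are sorted and have the same multiset.\<close>
  have eq: "map cmod xs = map cmod (map r [0..<M])"
  proof -
    have "mset (map cmod xs) = mset (map cmod (map r [0..<M]))" using ms by (metis mset_map)
    thus ?thesis using srt z unfolding zeros_by_modulus_def by (metis properties_for_sort)
  qed
  hence len: "length xs = M" using map_eq_imp_length_eq by fastforce
  thus "length xs \<le> N" using MN by simp
  show "\<alpha> i > 0 \<longleftrightarrow> i < length xs" if "i < N" for i using seg that len by blast
  show "cmod (xs ! i) = (1 - \<alpha> i) / \<alpha> i" if "i < length xs" for i
    using arg_cong[OF eq, of "\<lambda>l. l ! i"] that len cm[of i] by simp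
qed

lemma ceval_factored:
  assumes "\<And>t. poly F t = poly F 1 * (\<Prod>i<N. 1 - \<alpha> i + \<alpha> i * t)"
  shows "K * ceval F (of_real s * w) =
    poly (smult (K * of_real (poly F 1)) (\<Prod>i<N. [:of_real (1 - \<alpha> i), of_real (s * \<alpha> i):])) w"
proof -
  have "F = smult (poly F 1) (\<Prod>i<N. [:1 - \<alpha> i, \<alpha> i:])"
    unfolding poly_eq_poly_eq_iff[symmetric]
  proof
    fix t
    show "poly F t = poly (smult (poly F 1) (\<Prod>i<N. [:1 - \<alpha> i, \<alpha> i:])) t"
      using assms[of t] by (simp add: poly_prod mult.commute)
  qed
  hence "ceval F v = of_real (poly F 1) * (\<Prod>i<N. of_real (1 - \<alpha> i) + v * of_real (\<alpha> i))" for v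
  proof -
    interpret h: comm_ring_hom "\<lambda>q. ceval q v" by (rule ceval_hom)
    have "ceval F v = ceval (smult (poly F 1) (\<Prod>i<N. [:1 - \<alpha> i, \<alpha> i:])) v"
      using \<open>F = _\<close> by (rule arg_cong)
    also have "\<dots> = of_real (poly F 1) * (\<Prod>i<N. ceval [:1 - \<alpha> i, \<alpha> i:] v)"
      by (simp add: ceval_smult h.hom_prod)
    finally show ?thesis by (simp add: ceval_pCons ceval_0)
  qed
  thus ?thesis by (simp add: poly_prod algebra_simps)
qed

text \<open>If \<open>\<alpha> i > 0\<close> then \<open>\<gamma> i > 0\<close>, and if
  \<open>\<gamma> (Suc i) > 0\<close> then \<open>\<alpha> i > 0\<close>, so the numbers of zeros
  differ by at most one; \<open>(1 - u) / u\<close> decreases in \<open>u\<close> and gives the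
  chain.\<close>

lemma weakly_interlacing_of_factored:
  fixes s :: real and \<alpha> \<gamma> :: "nat \<Rightarrow> real"
  assumes Q: "Q = smult c (\<Prod>i<N. [:of_real (1 - \<alpha> i), of_real (s * \<alpha> i):])" "c \<noteq> 0"
    and Q': "Q' = smult c' (\<Prod>i<N. [:of_real (1 - \<gamma> i), of_real (s * \<gamma> i):])" "c' \<noteq> 0"
    and s: "s = 1 \<or> s = -1"
    and ag: "\<And>i. i < N \<Longrightarrow> 0 \<le> \<alpha> i \<and> \<alpha> i \<le> \<gamma> i \<and> \<gamma> i \<le> 1" "\<And>i. Suc i < N \<Longrightarrow> \<gamma> (Suc i) \<le> \<alpha> i"
    and z: "zeros_by_modulus Q xs" "zeros_by_modulus Q' ys"
  shows "weakly_interlacing ys xs"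
proof -
  have \<alpha>: "0 \<le> \<alpha> i \<and> \<alpha> i \<le> 1" if "i < N" for i using ag(1)[OF that] by linarith
  have \<gamma>: "0 \<le> \<gamma> i \<and> \<gamma> i \<le> 1" if "i < N" for i using ag(1)[OF that] by linarith
  have \<alpha>': "\<alpha> (Suc i) \<le> \<alpha> i" if "Suc i < N" for i using ag(1)[OF that] ag(2)[OF that] by linarith
  have \<gamma>': "\<gamma> (Suc i) \<le> \<gamma> i" if "Suc i < N" for i using ag(1)[of i] ag(2)[OF that] that by auto
  have X: "length xs \<le> N" "\<And>i. i < N \<Longrightarrow> \<alpha> i > 0 \<longleftrightarrow> i < length xs"
    "\<And>i. i < length xs \<Longrightarrow> cmod (xs ! i) = (1 - \<alpha> i) / \<alpha> i"
    using zeros_of_factored[OF Q s _ _ z(1)] \<alpha> \<alpha>' by blast+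
  have Y: "length ys \<le> N" "\<And>i. i < N \<Longrightarrow> \<gamma> i > 0 \<longleftrightarrow> i < length ys"
    "\<And>i. i < length ys \<Longrightarrow> cmod (ys ! i) = (1 - \<gamma> i) / \<gamma> i"
    using zeros_of_factored[OF Q' s _ _ z(2)] \<gamma> \<gamma>' by blast+
  have le: "length xs \<le> length ys"
  proof (rule ccontr)
    assume "\<not> ?thesis"
    hence "length ys < length xs" by simp
    thus False using X(1) X(2)[of "length ys"] Y(2)[of "length ys"] ag(1)[of "length ys"] by force
  qed
  have ge: "length ys \<le> Suc (length xs)"
  proof (rule ccontr)
    assume "\<not> ?thesis"
    hence "Suc (length xs) < length ys" by simp
    thus False using Y(1) X(2)[of "length xs"] Y(2)[of "Suc (length xs)"] ag(2)[of "length xs"] by force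
  qed
  have frac: "(1 - v) / v \<le> (1 - u) / u" if "0 < u" "u \<le> v" for u v :: real
    using that by (simp add: field_simps)
  show ?thesis unfolding weakly_interlacing_def
  proof (intro conjI allI impI)
    show "length ys = length xs \<or> length ys = length xs + 1" using le ge by linarith
  next
    fix i assume i: "i < length xs"
    hence "i < N" "i < length ys" using X(1) le by auto
    thus "cmod (ys ! i) \<le> cmod (xs ! i)"
      using X(3)[OF i] Y(3)[of i] X(2)[of i] i ag(1)[of i] frac[of "\<alpha> i" "\<gamma> i"] by simp
  next
    fix i assume i: "i + 1 < length ys"
    hence "i < length xs" "Suc i < N" using ge Y(1) by auto
    thus "cmod (xs ! i) \<le> cmod (ys ! (i + 1))"
      using X(3)[of i] Y(3)[of "Suc i"] Y(2)[of "Suc i"] i ag(2)[of i] frac[of "\<gamma> (Suc i)" "\<alpha> i"] by simp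
  qed
qed

text \<open>Powers of the positive integers are infinitely many points of agreement. It identifies a
  reduced polynomial from its defining equation in \<open>x\<close>.\<close>

lemma poly_eq_on_powers:
  fixes P Q :: "complex poly"
  assumes "\<And>x. x \<noteq> 0 \<Longrightarrow> poly P (x ^ Suc p) = poly Q (x ^ Suc p)"
  shows "P = Q"
proof (rule ccontr)
  assume "P \<noteq> Q"
  hence "finite {z. poly (P - Q) z = 0}" by (intro poly_roots_finite) simp
  moreover have "(\<lambda>m. complex_of_real (real (Suc m)) ^ Suc p) ` UNIV \<subseteq> {z. poly (P - Q) z = 0}"
    using assms by (auto simp del: of_nat_Suc power_Suc)
  moreover have "inj (\<lambda>m. complex_of_real (real (Suc m)) ^ Suc p)"
  proof (rule injI)
    fix m m' assume "complex_of_real (real (Suc m)) ^ Suc p = complex_of_real (real (Suc m')) ^ Suc p"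
    hence eq: "real (Suc m) ^ Suc p = real (Suc m') ^ Suc p" unfolding of_real_power[symmetric] of_real_eq_iff .
    have "real (Suc m) = real (Suc m')" by (rule power_eq_imp_eq_base[OF eq]) simp_all
    thus "m = m'" by simp
  qed
  ultimately show False using finite_imageD finite_subset by (metis infinite_UNIV_nat)
qed

context two_diagonal
begin

text \<open>Replacing index \<open>n - k\<close> by \<open>n - l\<close> changes one exponent in
  \<open>sum_expo\<close> from \<open>p - k\<close> to \<open>p - l\<close>, hence the summand
  \<open>k - l\<close>. The case \<open>l = k\<close> covers the first kind of minor,
  \<open>k < l\<close> the second.\<close>

lemma sol_minor_powi:
  assumes "k \<le> l" "l \<le> p" "l \<le> n" and \<theta>: "\<theta> = 1 \<or> \<theta> = -1"
  shows "\<exists>K. K \<noteq> 0 \<and> (\<forall>x. x \<noteq> 0 \<longrightarrow>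
    minor (sol p a x) [0..<Suc k] ((n - l) # [n-k+1..<Suc n]) =
    K * x powi (int k - int l + int (m_exp p k n)) *
    ceval (W base_lim \<theta> [0..<Suc k] ((p - l) # [p-k+1..<p+1])) (of_real (- \<theta>) * x ^ (p + 1)))"
proof -
  let ?cs = "(n - l) # [n-k+1..<Suc n]"
  let ?K = "complex_of_real (\<Prod>s\<leftarrow>[0..<Suc k]. row_sign \<theta> s)"
  have "row_sign \<theta> s \<noteq> 0" for s using \<theta> by (auto simp: row_sign_def)
  hence K: "?K \<noteq> 0" by (auto simp: prod_list_zero_iff simp del: upt_Suc)
  have win: "\<forall>c\<in>set ?cs. n \<le> c + p \<and> c \<le> n" and len: "length ?cs = Suc k"
    using assms by (auto simp del: upt_Suc)
  have shift: "map (\<lambda>c. c + p - n) ?cs = (p - l) # [p-k+1..<p+1]"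
  proof -
    have "map (\<lambda>c. c + p - n) [n-k+1..<Suc n] = [p-k+1..<p+1]"
      using assms by (intro nth_equalityI) (auto simp del: upt_Suc)
    moreover have "n - l + p - n = p - l" using assms by simp
    ultimately show ?thesis by simp
  qed
  have "[n-k..<Suc n] = (n - k) # [n-k+1..<Suc n]"
    using assms by (subst upt_conv_Cons) auto
  moreover have "expo (n - l) = p - l" "expo (n - k) = p - k" using assms by (simp_all add: expo_def)
  ultimately have e: "int (\<Sum>c\<leftarrow>?cs. expo c) - int (\<Sum>s\<leftarrow>[0..<Suc k]. expo s) = int k - int l + int (m_exp p k n)"
    using sum_expo[of k] assms by (simp add: of_nat_diff del: upt_Suc)
  show ?thesis
    using sol_minor_eq[OF \<theta> win len] assms K unfolding e shift
    by (intro exI[of _ ?K]) auto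
qed

end

lemma submatrix_full:
  assumes "A \<in> carrier_mat n n"
  shows "submatrix A {0..<n} {0..<n} = A"
  unfolding submatrix_def using assms pick_atLeastLessThan[of _ n 0] by (intro eq_matI) auto

lemma P_minor_eq_sol_minor:
  assumes "p \<ge> 1" "k < n"
  shows "\<exists>\<kappa>. (\<kappa> = 1 \<or> \<kappa> = -1) \<and> (\<forall>x. poly (P_minor p a k n) x
    = \<kappa> * minor (sol p a x) [0..<Suc k] ((n - k) # [n-k+1..<Suc n]))"
proof -
  have "\<exists>\<kappa>. (\<kappa> = 1 \<or> \<kappa> = -1) \<and> (\<forall>x. poly (Determinant.det (submatrix (hess_char p a n) {k..<n} {0..<n-k})) x
    = \<kappa> * minor (sol p a x) [0..<Suc k] ((n - k) # [n-k+1..<Suc n]))"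
    using assms by (intro hess_minor_eq_sol_minor) (auto simp del: upt_Suc)
  thus ?thesis using assms by (simp add: P_minor_def)
qed

lemma P_minor2_eq_sol_minor:
  assumes "p \<ge> 1" "k < l" "l \<le> n"
  shows "\<exists>\<kappa>. (\<kappa> = 1 \<or> \<kappa> = -1) \<and> (\<forall>x. poly (P_minor2 p a k l n) x
    = \<kappa> * minor (sol p a x) [0..<Suc k] ((n - l) # [n-k+1..<Suc n]))"
proof (cases "k = 0")
  case True
  \<comment> \<open>For \<open>k = 0\<close> the determinant belongs to the matrix of size
    \<open>n - l\<close>, so the formula is applied with \<open>n - l\<close> for \<open>n\<close>;
    \<open>sol\<close> does not depend on the size.\<close>
  have "\<exists>\<kappa>. (\<kappa> = 1 \<or> \<kappa> = -1) \<and> (\<forall>x. poly (Determinant.det (submatrix (hess_char p a (n - l)) {0..<n-l} {0..<n-l})) x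
    = \<kappa> * minor (sol p a x) [0..<Suc 0] [n - l])"
    using assms by (intro hess_minor_eq_sol_minor) auto
  moreover have "hess_char p a (n - l) \<in> carrier_mat (n - l) (n - l)"
    by (rule carrier_matI) (simp_all add: hess_char_def)
  ultimately show ?thesis using True by (simp add: P_minor2_def submatrix_full)
next
  case False
  have "card ({0..<n} - ({n - l} \<union> {n - k + 1..<n})) = card {0..<n} - card ({n - l} \<union> {n - k + 1..<n})"
    using assms by (intro card_Diff_subset) auto
  also have "card ({n - l} \<union> {n - k + 1..<n}) = k"
    using assms False by (subst card_Un_disjoint) auto
  finally have card: "card ({0..<n} - ({n - l} \<union> {n - k + 1..<n})) = n - k" by simp
  have "\<exists>\<kappa>. (\<kappa> = 1 \<or> \<kappa> = -1) \<and> (\<forall>x. poly (Determinant.det (submatrix (hess_char p a n) {k..<n}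
      ({0..<n} - ({n - l} \<union> {n - k + 1..<n})))) x
    = \<kappa> * minor (sol p a x) [0..<Suc k] ((n - l) # [n-k+1..<Suc n]))"
    using assms False card by (intro hess_minor_eq_sol_minor) (auto simp del: upt_Suc)
  thus ?thesis using False by (simp add: P_minor2_def)
qed

theorem theorem2p12:
  fixes p k l n :: nat and a :: "nat \<Rightarrow> real"
  assumes "p \<ge> 1"
    and "\<And>j. a j > 0"
    and "k < l" and "l \<le> p"
    and "n \<ge> 1" and "l \<le> n"
  shows "\<exists>Q2 :: complex poly.
    is_P_tilde2 p a k l n Q2 \<and>
    (Q2 \<noteq> 0 \<longrightarrow>
      (\<forall>z. poly Q2 z = 0 \<longrightarrow>
         (if even k then z \<in> \<real>\<^sub>\<ge>\<^sub>0 else z \<in> \<real>\<^sub>\<le>\<^sub>0))) \<and>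
    (\<forall>Q xs ys.
       is_P_tilde p a k n Q \<longrightarrow> Q2 \<noteq> 0 \<longrightarrow>
       zeros_by_modulus Q xs \<longrightarrow> zeros_by_modulus Q2 ys \<longrightarrow>
       weakly_interlacing ys xs)"
proof -
  interpret two_diagonal p n a by standard (rule assms(2))
  \<comment> \<open>The sign for which minors of size \<open>k + 1\<close> have a positive
    recurrence.\<close>
  define \<theta> :: real where "\<theta> = (-1) ^ k"
  have \<theta>: "\<theta> = 1 \<or> \<theta> = -1" by (simp add: \<theta>_def minus_one_power_iff)
  have \<theta>': "-\<theta> = 1 \<or> -\<theta> = -1" using \<theta> by auto
  define F where "F = W base_lim \<theta> [0..<Suc k] ((p - k) # [p-k+1..<p+1])"
  define G where "G = W base_lim \<theta> [0..<Suc k] ((p - l) # [p-k+1..<p+1])"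
  have "\<exists>N. weakly_interlaced N F G"
    using weakly_interlaced_minors[of k l 0] assms by (simp add: F_def G_def \<theta>_def del: upt_Suc)
  then obtain N \<alpha> \<gamma> where
    ag: "\<And>i. i < N \<Longrightarrow> 0 \<le> \<alpha> i \<and> \<alpha> i \<le> \<gamma> i \<and> \<gamma> i \<le> 1" "\<And>i. Suc i < N \<Longrightarrow> \<gamma> (Suc i) \<le> \<alpha> i"
    and F: "\<And>t. poly F t = poly F 1 * (\<Prod>i<N. 1 - \<alpha> i + \<alpha> i * t)"
    and G: "\<And>t. poly G t = poly G 1 * (\<Prod>i<N. 1 - \<gamma> i + \<gamma> i * t)"
    unfolding weakly_interlaced_def by blast
  obtain \<kappa>1 where \<kappa>1: "\<And>x. poly (P_minor p a k n) x
      = \<kappa>1 * minor (sol p a x) [0..<Suc k] ((n - k) # [n-k+1..<Suc n])"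
    using P_minor_eq_sol_minor[of p k n a] assms by auto
  obtain \<kappa>2 where \<kappa>2: "\<And>x. poly (P_minor2 p a k l n) x
      = \<kappa>2 * minor (sol p a x) [0..<Suc k] ((n - l) # [n-k+1..<Suc n])"
    using P_minor2_eq_sol_minor[of p k l n a] assms by auto
  obtain K1 where K1: "\<And>x. x \<noteq> 0 \<Longrightarrow> minor (sol p a x) [0..<Suc k] ((n - k) # [n-k+1..<Suc n])
      = K1 * x powi (int k - int k + int (m_exp p k n)) * ceval F (of_real (- \<theta>) * x ^ (p + 1))"
    using sol_minor_powi[of k k \<theta>] assms \<theta> unfolding F_def by auto
  obtain K2 where K2: "\<And>x. x \<noteq> 0 \<Longrightarrow> minor (sol p a x) [0..<Suc k] ((n - l) # [n-k+1..<Suc n])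
      = K2 * x powi (int k - int l + int (m_exp p k n)) * ceval G (of_real (- \<theta>) * x ^ (p + 1))"
    using sol_minor_powi[of k l \<theta>] assms \<theta> unfolding G_def by auto
  \<comment> \<open>With \<open>t = -\<theta> * w\<close>, the nonpositive zeros in \<open>t\<close>
    become zeros in \<open>w\<close> that are 0 or have the sign of \<theta>.\<close>
  define Q1 where "Q1 = smult (\<kappa>1 * K1 * of_real (poly F 1)) (\<Prod>i<N. [:of_real (1 - \<alpha> i), of_real (- \<theta> * \<alpha> i) :: complex:])"
  define Q2 where "Q2 = smult (\<kappa>2 * K2 * of_real (poly G 1)) (\<Prod>i<N. [:of_real (1 - \<gamma> i), of_real (- \<theta> * \<gamma> i) :: complex:])"
  have Q1: "poly Q1 w = \<kappa>1 * K1 * ceval F (of_real (- \<theta>) * w)" for w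
    unfolding Q1_def by (rule ceval_factored[OF F, symmetric])
  have Q2: "poly Q2 w = \<kappa>2 * K2 * ceval G (of_real (- \<theta>) * w)" for w
    unfolding Q2_def by (rule ceval_factored[OF G, symmetric])
  show ?thesis
  proof (intro exI[of _ Q2] conjI impI allI)
    show "is_P_tilde2 p a k l n Q2"
      unfolding is_P_tilde2_def
    proof (intro allI impI)
      fix x :: complex assume x: "x \<noteq> 0"
      show "poly (P_minor2 p a k l n) x
          = x powi (int k - int l + int (m_exp p k n)) * poly Q2 (x ^ (p + 1))"
        unfolding \<kappa>2 K2[OF x] Q2 by (simp only: mult_ac)
    qed
  next
    fix z assume "Q2 \<noteq> 0" "poly Q2 z = 0"
    hence "(\<Prod>i<N. of_real (1 - \<gamma> i) + z * of_real (- \<theta> * \<gamma> i)) = 0"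
      by (auto simp: Q2_def poly_prod)
    then obtain i where i: "i < N" "of_real (1 - \<gamma> i) + z * of_real (- \<theta> * \<gamma> i) = 0"
      by (auto simp: prod_zero_iff)
    hence "\<gamma> i \<noteq> 0" by auto
    have "\<theta> * \<theta> = 1" using \<theta> by auto
    hence zg: "z * of_real (\<gamma> i) = of_real (\<theta> * (1 - \<gamma> i))"
      using i(2) \<theta> by (auto simp: algebra_simps)
    define r where "r = (1 - \<gamma> i) / \<gamma> i"
    have "\<theta> * (1 - \<gamma> i) = \<theta> * r * \<gamma> i" using \<open>\<gamma> i \<noteq> 0\<close> by (simp add: r_def)
    hence "z * of_real (\<gamma> i) = of_real (\<theta> * r) * of_real (\<gamma> i)" by (simp only: zg of_real_mult)
    moreover have "complex_of_real (\<gamma> i) \<noteq> 0" using \<open>\<gamma> i \<noteq> 0\<close> by simp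
    ultimately have z: "z = of_real (\<theta> * r)" by (rule mult_right_cancel[THEN iffD1, rotated])
    have "r \<ge> 0" using ag(1)[OF i(1)] by (auto simp: r_def)
    thus "if even k then z \<in> \<real>\<^sub>\<ge>\<^sub>0 else z \<in> \<real>\<^sub>\<le>\<^sub>0"
      unfolding z nonneg_Reals_of_real_iff nonpos_Reals_of_real_iff by (simp add: \<theta>_def)
  next
    fix Q xs ys
    assume Q: "is_P_tilde p a k n Q" and "Q2 \<noteq> 0" and zs: "zeros_by_modulus Q xs" "zeros_by_modulus Q2 ys"
    \<comment> \<open>The reduced polynomial is unique, so it equals the factored \<open>Q1\<close>;
      as \<open>Q\<close> is nonzero at 0, the constant in front of \<open>Q1\<close> is nonzero
      too.\<close>
    have "Q = Q1"
    proof (rule poly_eq_on_powers)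
      fix x :: complex assume x: "x \<noteq> 0"
      have "x ^ m_exp p k n * poly Q (x ^ (p + 1)) = x ^ m_exp p k n * poly Q1 (x ^ (p + 1))"
        using Q x \<kappa>1[of x] K1[OF x] unfolding is_P_tilde_def Q1 by (simp add: mult_ac)
      thus "poly Q (x ^ Suc p) = poly Q1 (x ^ Suc p)" using x by simp
    qed
    moreover have "Q \<noteq> 0" using Q by (auto simp: is_P_tilde_def)
    ultimately show "weakly_interlacing ys xs"
      using \<open>Q2 \<noteq> 0\<close> zs
      by (intro weakly_interlacing_of_factored[OF Q1_def _ Q2_def _ \<theta>' ag]) (auto simp: Q1_def Q2_def)
  qed
qed

end
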